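(* For any $\alpha>0$ there exist $h>0$, $\delta>0$ and $Q<\infty$ such that $$\liminf_{N\uparrow\infty}\mathbf P\big(V_N\in\mathcal A_{h,\delta}\ \text{and}\ |M_h^-(V_N)|\le Q\big)\ge1-\alpha.$$
   Context: Let $\omega=(\omega_x)_{x\in\mathbb Z}$ be i.i.d. under $\mathbf P$ with $\omega_x\in[\kappa,1-\kappa]$ for some $\kappa>0$, $\mathbf E[\ln\frac{\omega_x}{1-\omega_x}]=0$ and $\sigma^2=\mathbf E[\ln^2\frac{\omega_x}{1-\omega_x}]>0$. The potential is $V(0)=0$, $V(x)=\sum_{i=1}^x\ln\frac{1-\omega_i}{\omega_i}$ for $x\ge1$, $V(x)=-\sum_{i=x+1}^0\ln\frac{1-\omega_i}{\omega_i}$ for $x\le-1$. For an integer $N\ge1$, $V_N\in C([-1,1])$ is the restriction to $[-1,1]$ of the linear interpolation of the values $V(k)/\sqrt N$ at the points $k/N$, $k\in\mathbb Z$. $h$-minima. Let $\gamma\in C([-1,1])$, $h>0$. A point $x\in[-1,1]$ is an $h$-minimum if there are $a,b\in[-1,1]$ with $a<x<b$, $\gamma(a)\ge\gamma(x)+h$, $\gamma(b)\ge\gamma(x)+h$, $\gamma(x)=\min_{[a,b]}\gamma$. Two $h$-minima are equivalent, $x\sim x'$, if $\max_{z\in[x\wedge x',x\vee x']}|\gamma(z)-\gamma(x)|<h$; there are finitely many classes, each closed, and $M_h^-(\gamma)$ is the set of the smallest elements of the classes. Saddles. For disjoint finite $A,B\subset[-1,1]$, $Z(A,B)$ is the set of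 $z\in[-1,1]$ such that there are $a\in A$, $b\in B$ with $a\wedge b\le z\le a\vee b$ and $\gamma(z)=\min_{a'\in A,b'\in B}\max_{a'\wedge b'\le x\le a'\vee b'}\gamma(x)$; $z^*(A,B)=\min Z(A,B)$ (singletons are identified with points). Good paths. $\mathcal A_{h,\delta}$ is the set of $\gamma\in C([-1,1])$ such that: $M_h^-(\gamma)\ne\varnothing$; $\gamma(z^*(x,(M_h^-(\gamma)\cup\{-1,1\})\setminus\{x\}))-\gamma(x)\ge h+\delta$ for all $x\in M_h^-(\gamma)$; and, for a suitable labeling $M_h^-(\gamma)=\{x_1,\dots,x_q\}$, setting $S_{h,0}=\{-1,1\}$, $S_{h,k}=\{x_1,\dots,x_k\}\cup\{-1,1\}$, one has for all $1\le k\le q-1$ $$\gamma(z^*(x_k,S_{h,k-1}))-\gamma(x_k)\ge\max_{k<j\le q}\{\gamma(z^*(x_j,S_{h,k-1}))-\gamma(x_j)\}+\delta.$$ *)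

theory Defs
  imports "HOL-Probability.Probability"
begin

definition potential :: "(int \<Rightarrow> real) \<Rightarrow> int \<Rightarrow> real" where
  "potential w x =
     (if 0 \<le> x then (\<Sum>i=1..x. ln ((1 - w i) / w i))
      else - (\<Sum>i=x+1..0. ln ((1 - w i) / w i)))"

definition scaled_potential :: "(int \<Rightarrow> real) \<Rightarrow> nat \<Rightarrow> real \<Rightarrow> real" where
  "scaled_potential w N t =
     (1 - frac (real N * t)) * (potential w \<lfloor>real N * t\<rfloor> / sqrt (real N))
     + frac (real N * t) * (potential w (\<lfloor>real N * t\<rfloor> + 1) / sqrt (real N))"

text \<open>
  An element of C([-1,1]) is represented by a function on the reals that is continuous on
  \<open>{-1..1}\<close>. The notions below only inspect its values on this interval.
\<close>

definition h_minima :: "real \<Rightarrow> (real \<Rightarrow> real) \<Rightarrow> real set" where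
  "h_minima h \<gamma> = {x \<in> {-1..1}. \<exists>a\<in>{-1..1}. \<exists>b\<in>{-1..1}. a < x \<and> x < b \<and>
      \<gamma> a \<ge> \<gamma> x + h \<and> \<gamma> b \<ge> \<gamma> x + h \<and> (\<forall>z\<in>{a..b}. \<gamma> x \<le> \<gamma> z)}"

text \<open>The supremum is a maximum when \<open>f\<close> is continuous on the segment.\<close>

definition seg_max :: "(real \<Rightarrow> real) \<Rightarrow> real \<Rightarrow> real \<Rightarrow> real" where
  "seg_max f a b = (SUP z\<in>{min a b..max a b}. f z)"

definition h_equiv :: "real \<Rightarrow> (real \<Rightarrow> real) \<Rightarrow> (real \<times> real) set" where
  "h_equiv h \<gamma> = {(x, x'). x \<in> h_minima h \<gamma> \<and> x' \<in> h_minima h \<gamma> \<and>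
      seg_max (\<lambda>z. \<bar>\<gamma> z - \<gamma> x\<bar>) x x' < h}"

definition M_minus :: "real \<Rightarrow> (real \<Rightarrow> real) \<Rightarrow> real set" where
  "M_minus h \<gamma> = {x. \<exists>C \<in> h_minima h \<gamma> // h_equiv h \<gamma>. x \<in> C \<and> (\<forall>y\<in>C. x \<le> y)}"

definition saddle_height :: "(real \<Rightarrow> real) \<Rightarrow> real set \<Rightarrow> real set \<Rightarrow> real" where
  "saddle_height \<gamma> A B = Min ((\<lambda>(a, b). seg_max \<gamma> a b) ` (A \<times> B))"

definition saddle_set :: "(real \<Rightarrow> real) \<Rightarrow> real set \<Rightarrow> real set \<Rightarrow> real set" where
  "saddle_set \<gamma> A B = {z \<in> {-1..1}.
      (\<exists>a\<in>A. \<exists>b\<in>B. min a b \<le> z \<and> z \<le> max a b) \<and> \<gamma> z = saddle_height \<gamma> A B}"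

definition z_star :: "(real \<Rightarrow> real) \<Rightarrow> real set \<Rightarrow> real set \<Rightarrow> real" where
  "z_star \<gamma> A B = (LEAST z. z \<in> saddle_set \<gamma> A B)"

text \<open>The bijection also forces \<open>M_minus h \<gamma>\<close> to be finite.\<close>

definition good_paths :: "real \<Rightarrow> real \<Rightarrow> (real \<Rightarrow> real) set" where
  "good_paths h \<delta> = {\<gamma>. continuous_on {-1..1} \<gamma> \<and>
     M_minus h \<gamma> \<noteq> {} \<and>
     (\<forall>x \<in> M_minus h \<gamma>.
        \<gamma> (z_star \<gamma> {x} ((M_minus h \<gamma> \<union> {-1, 1}) - {x})) - \<gamma> x \<ge> h + \<delta>) \<and>
     (\<exists>(q::nat) (x::nat \<Rightarrow> real).
        bij_betw x {1..q} (M_minus h \<gamma>) \<and>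
        (let S = (\<lambda>k. x ` {1..k} \<union> {-1, 1}) in
          \<forall>k. 1 \<le> k \<and> k < q \<longrightarrow>
            \<gamma> (z_star \<gamma> {x k} (S (k - 1))) - \<gamma> (x k)
              \<ge> Max ((\<lambda>j. \<gamma> (z_star \<gamma> {x j} (S (k - 1))) - \<gamma> (x j)) ` {k<..q}) + \<delta>))}"

end

theory Submission
  imports Defs
begin

text \<open>
  The path is a rescaled random walk, and every requirement on a good path is an inequality
  between finitely many local extrema of the walk. A requirement can fail only if the path has
  no \<open>h\<close>-minimum, if it moves by \<open>h\<close> within a very short time, or if a difference of two local
  extrema nearly coincides with \<open>h\<close> or with another such difference. These three events are made
  unlikely one after the other, by the choice of \<open>h\<close>, then of a block length, then of \<open>\<delta>\<close>.

  \<^item> Choice of \<open>h\<close> (\<open>deep_minimum_likely\<close>). Among \<open>R\<close> disjoint pairs of consecutive blocks, each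
    pair consists of a descent and an ascent of the order of the standard deviation, with a
    probability that the central limit theorem bounds away from 0. The pairs are independent,
    so for large \<open>R\<close> one of them contains an \<open>h\<close>-minimum.

  \<^item> Choice of the block length (\<open>adjacent_blocks_oscillation\<close>). Ottaviani's maximal inequality
    with Hoeffding's bound shows that for short blocks the path moves by less than \<open>h\<close> within any
    two adjacent blocks. On this event the geometry becomes discrete, as worked out in the
    locale \<open>separated_blocks\<close>: the chosen representative of a class attains the minimum of its
    block, a saddle attains the maximum of its block, and the blocks of two representatives, or
    of a saddle and a representative, are never equal or adjacent. The depth of a minimum is
    thus a block maximum minus a block minimum, and there are at most as many classes as blocks.

  \<^item> Choice of \<open>\<delta>\<close> (\<open>near_ties_unlikely\<close>). What remains is that such a difference is not within
    \<open>\<delta>\<close> of \<open>h\<close>, and that two of them are not within \<open>\<delta>\<close> of each other. Because the blocks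
    involved are not adjacent, there is a spare block, different from all of them, whose
    increment enters the expression with a nonzero coefficient (\<open>spare_index\<close>). Given all other
    increments, the expression is confined to a short interval only if this one increment is,
    which by the central limit theorem has small probability uniformly in the position of the
    interval (\<open>incr_anticoncentration\<close>). A union bound over the finitely many tuples of blocks
    concludes.

  When no ties occur, the labeling that always takes the deepest remaining minimum next has
  the required gaps (\<open>greedy_labeling\<close>).

  Since \<open>prob\<close> is 0 on sets that are not events, the measurability of the set of good samples is
  part of the claim (\<open>sets_good_path\<close>). It holds because the representatives are lattice points
  that are determined by finitely many comparisons between the values of the potential.
\<close>

section \<open>Linear interpolation of lattice functions\<close>

definition interp :: "nat \<Rightarrow> (int \<Rightarrow> real) \<Rightarrow> real \<Rightarrow> real" where
  "interp N v t = (1 - frac (real N * t)) * v \<lfloor>real N * t\<rfloor>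
     + frac (real N * t) * v (\<lfloor>real N * t\<rfloor> + 1)"

lemma scaled_potential_eq_interp:
  "scaled_potential w N = interp N (\<lambda>k. potential w k / sqrt (real N))"
  by (simp add: fun_eq_iff scaled_potential_def interp_def)

lemma interp_lattice [simp]:
  assumes "N > 0" shows "interp N v (of_int k / real N) = v k"
  using assms by (simp add: interp_def)

lemma interp_affine:
  assumes N: "N > 0" and t: "of_int k / real N \<le> t" "t \<le> (of_int k + 1) / real N"
  shows "interp N v t = v k + (real N * t - of_int k) * (v (k + 1) - v k)"
proof (cases "real N * t = of_int k + 1")
  case True
  then have "\<lfloor>real N * t\<rfloor> = k + 1" by linarith
  with True show ?thesis by (simp add: interp_def frac_def)
next
  case False
  have "of_int k \<le> real N * t" "real N * t \<le> of_int k + 1"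
    using N t by (simp_all add: field_simps)
  with False have "\<lfloor>real N * t\<rfloor> = k" by linarith
  then show ?thesis by (simp add: interp_def frac_def algebra_simps)
qed

lemma lattice_cell:
  assumes "N > 0"
  obtains k :: int where "k = \<lfloor>real N * t\<rfloor>" "of_int k / real N \<le> t" "t < (of_int k + 1) / real N"
proof (rule that[of "\<lfloor>real N * t\<rfloor>"])
  show "of_int \<lfloor>real N * t\<rfloor> / real N \<le> t"
    using assms of_int_floor_le[of "real N * t"] by (simp add: field_simps)
  have "real N * t < of_int \<lfloor>real N * t\<rfloor> + 1" by linarith
  then show "t < (of_int \<lfloor>real N * t\<rfloor> + 1) / real N"
    using assms by (simp add: field_simps)
qed auto

lemma continuous_on_interp:
  assumes N: "N > 0" shows "continuous_on {-1..1} (interp N v)"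
proof -
  let ?U = "\<lambda>k::int. {of_int k / real N .. (of_int k + 1) / real N}"
  have "continuous_on (?U k) (interp N v)" for k
  proof -
    have "continuous_on (?U k) (\<lambda>t. v k + (real N * t - of_int k) * (v (k + 1) - v k))"
      by (intro continuous_intros)
    then show ?thesis
      by (rule continuous_on_eq) (auto simp: interp_affine[OF N])
  qed
  then have "continuous_on (\<Union>k\<in>{- int N..int N}. ?U k) (interp N v)"
    by (intro continuous_on_closed_Union) auto
  moreover have "{-1..1} \<subseteq> (\<Union>k\<in>{- int N..int N}. ?U k)"
  proof
    fix t :: real assume t: "t \<in> {-1..1}"
    obtain k where k: "k = \<lfloor>real N * t\<rfloor>" "of_int k / real N \<le> t" "t < (of_int k + 1) / real N"
      using lattice_cell[OF N] by blast
    have "- real N \<le> real N * t" "real N * t \<le> real N"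
      using t mult_left_mono[of "-1" t "real N"] mult_left_mono[of t 1 "real N"] by auto
    then have "- int N \<le> k" "k \<le> int N" unfolding k by linarith+
    with k show "t \<in> (\<Union>k\<in>{- int N..int N}. ?U k)" by (auto intro!: bexI[of _ k])
  qed
  ultimately show ?thesis by (rule continuous_on_subset)
qed

text \<open>
  An affine piece lies between its end values. So extrema of the interpolation over lattice
  intervals are attained at lattice points, and each notion below reduces to lattice values.
\<close>

lemma interp_between_lattice:
  assumes N: "N > 0" and t: "of_int i / real N \<le> t" "t \<le> of_int j / real N"
  shows "\<exists>k\<in>{i..j}. interp N v t \<le> v k" "\<exists>k\<in>{i..j}. v k \<le> interp N v t"
proof -
  obtain k where k: "k = \<lfloor>real N * t\<rfloor>" "of_int k / real N \<le> t" "t < (of_int k + 1) / real N"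
    using lattice_cell[OF N] by blast
  define f where "f = frac (real N * t)"
  have f: "0 \<le> f" "f < 1" by (auto simp: f_def frac_lt_1)
  have eq: "interp N v t = (1 - f) * v k + f * v (k + 1)"
    by (simp add: interp_def f_def k)
  have ij: "of_int i \<le> real N * t" "real N * t \<le> of_int j"
    using N t by (simp_all add: field_simps)
  then have ki: "k \<in> {i..j}" using k(1) by (auto simp: le_floor_iff floor_le_iff)
  have "(\<exists>k\<in>{i..j}. interp N v t \<le> v k) \<and> (\<exists>k\<in>{i..j}. v k \<le> interp N v t)"
  proof (cases "k + 1 \<le> j")
    case True
    have up: "interp N v t \<le> max (v k) (v (k + 1))"
      unfolding eq by (rule convex_bound_le) (use f in auto)
    have "(1 - f) * min (v k) (v (k + 1)) + f * min (v k) (v (k + 1)) \<le> interp N v t"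
      unfolding eq by (intro add_mono mult_left_mono) (use f in auto)
    then have lo: "min (v k) (v (k + 1)) \<le> interp N v t"
      by (simp add: algebra_simps)
    have "k + 1 \<in> {i..j}" using ki True by auto
    with ki up lo show ?thesis by (metis max_def min_def)
  next
    case False
    with ki have "k = j" by simp
    with ij k have "real N * t = of_int j" by (metis floor_correct linorder_not_less not_less_iff_gr_or_eq)
    then have "f = 0" by (simp add: f_def)
    with eq ki show ?thesis by auto
  qed
  then show "\<exists>k\<in>{i..j}. interp N v t \<le> v k" "\<exists>k\<in>{i..j}. v k \<le> interp N v t" by auto
qed

lemma seg_max_attained:
  assumes "continuous_on {min a b..max a b} f"
  obtains z where "z \<in> {min a b..max a b}" "f z = seg_max f a b"
    "\<And>y. y \<in> {min a b..max a b} \<Longrightarrow> f y \<le> seg_max f a b"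
proof -
  obtain z where z: "z \<in> {min a b..max a b}" "\<forall>y\<in>{min a b..max a b}. f y \<le> f z"
    using continuous_attains_sup[OF _ _ assms] by fastforce
  have "seg_max f a b = f z"
    unfolding seg_max_def using z by (intro cSup_eq_maximum) auto
  with z that show ?thesis by auto
qed

lemma seg_max_less_iff:
  assumes "continuous_on {min a b..max a b} f"
  shows "seg_max f a b < c \<longleftrightarrow> (\<forall>z\<in>{min a b..max a b}. f z < c)"
  using seg_max_attained[OF assms] by (metis le_less_trans)

lemma seg_max_ge:
  assumes "continuous_on {min a b..max a b} f" "z \<in> {min a b..max a b}"
  shows "f z \<le> seg_max f a b"
  using seg_max_attained[OF assms(1)] assms(2) by metis

lemma seg_max_commute: "seg_max f a b = seg_max f b a"
  by (simp add: seg_max_def min.commute max.commute)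

lemma seg_max_interp_attained:
  assumes N: "N > 0" and ij: "i \<le> j" "- int N \<le> i" "j \<le> int N"
  shows "\<exists>k\<in>{i..j}. seg_max (interp N v) (of_int i / real N) (of_int j / real N) = v k"
    (is "\<exists>k\<in>_. ?s = _")
proof -
  have sub: "{min (of_int i / real N) (of_int j / real N)..max (of_int i / real N) (of_int j / real N)}
      = {of_int i / real N..of_int j / real N}"
    using N ij by (simp add: min_def max_def divide_right_mono)
  have "{of_int i / real N..of_int j / real N} \<subseteq> {-1..1}"
  proof -
    have "-1 \<le> of_int i / real N" "of_int j / real N \<le> 1"
      using N ij by (simp_all add: field_simps)
    then show ?thesis by auto
  qed
  then have c: "continuous_on {min (of_int i / real N) (of_int j / real N)..max (of_int i / real N) (of_int j / real N)} (interp N v)"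
    unfolding sub by (rule continuous_on_subset[OF continuous_on_interp[OF N]])
  obtain z where z: "z \<in> {of_int i / real N..of_int j / real N}" "interp N v z = ?s"
     "\<And>y. y \<in> {of_int i / real N..of_int j / real N} \<Longrightarrow> interp N v y \<le> ?s"
    using seg_max_attained[OF c] unfolding sub by metis
  obtain k where k: "k \<in> {i..j}" "?s \<le> v k"
    using interp_between_lattice(1)[OF N, of i z j v] z by auto
  have "v k \<le> ?s"
    using z(3)[of "of_int k / real N"] k N by (simp add: divide_right_mono)
  with k show ?thesis by force
qed

section \<open>Classes of h-minima and saddle heights\<close>

lemma h_minima_interior: "h_minima h \<gamma> \<subseteq> {-1<..<1}"
  unfolding h_minima_def by fastforce

lemma h_minimaE:
  assumes "x \<in> h_minima h \<gamma>"
  obtains a b where "-1 \<le> a" "a < x" "x < b" "b \<le> 1" "\<gamma> x + h \<le> \<gamma> a" "\<gamma> x + h \<le> \<gamma> b"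
    "\<And>z. a \<le> z \<Longrightarrow> z \<le> b \<Longrightarrow> \<gamma> x \<le> \<gamma> z"
  using assms unfolding h_minima_def by fastforce

lemma h_minimaI:
  assumes "-1 \<le> a" "a < x" "x < b" "b \<le> 1" "\<gamma> x + h \<le> \<gamma> a" "\<gamma> x + h \<le> \<gamma> b"
    "\<And>z. a \<le> z \<Longrightarrow> z \<le> b \<Longrightarrow> \<gamma> x \<le> \<gamma> z"
  shows "x \<in> h_minima h \<gamma>"
  unfolding h_minima_def
  by (rule CollectI, intro conjI bexI[of _ a] bexI[of _ b]) (use assms in auto)

text \<open>
  The witnesses \<open>a\<close>, \<open>b\<close> for \<open>x\<close> lie outside of the segment from \<open>x\<close> to \<open>x'\<close>, where the path stays
  within \<open>h\<close> of \<open>\<gamma> x\<close>, so \<open>\<gamma> x\<close> is minimal on it; then the same holds for \<open>x'\<close>. This makes the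
  equivalence symmetric, although its definition refers to the height of the first point only.
\<close>

lemma equivalent_h_minima_same_height:
  assumes x: "x \<in> h_minima h \<gamma>" and x': "x' \<in> h_minima h \<gamma>"
    and close: "\<And>z. z \<in> {min x x'..max x x'} \<Longrightarrow> \<bar>\<gamma> z - \<gamma> x\<bar> < h"
  shows "\<gamma> x' = \<gamma> x"
proof (rule antisym)
  obtain a b where ab: "a < x" "x < b" "-1 \<le> a" "b \<le> 1" "\<gamma> x + h \<le> \<gamma> a" "\<gamma> x + h \<le> \<gamma> b"
    "\<And>z. a \<le> z \<Longrightarrow> z \<le> b \<Longrightarrow> \<gamma> x \<le> \<gamma> z"
    using h_minimaE[OF x] by metis
  have out: "u \<notin> {min x x'..max x x'}" if "\<gamma> x + h \<le> \<gamma> u" for u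
    using close that by (metis abs_ge_self add.commute le_diff_eq linorder_not_le order_trans)
  with out[OF ab(5)] out[OF ab(6)] ab(1,2) show ge: "\<gamma> x \<le> \<gamma> x'" by (intro ab(7)) auto
  obtain a' b' where ab': "a' < x'" "x' < b'" "-1 \<le> a'" "b' \<le> 1" "\<gamma> x' + h \<le> \<gamma> a'" "\<gamma> x' + h \<le> \<gamma> b'"
    "\<And>z. a' \<le> z \<Longrightarrow> z \<le> b' \<Longrightarrow> \<gamma> x' \<le> \<gamma> z"
    using h_minimaE[OF x'] by metis
  have "a' \<notin> {min x x'..max x x'}" "b' \<notin> {min x x'..max x x'}"
    by (intro out order_trans[OF add_right_mono[OF ge]] ab'(5,6))+
  with ab'(1,2) show "\<gamma> x' \<le> \<gamma> x" by (intro ab'(7)) auto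
qed

context
  fixes \<gamma> :: "real \<Rightarrow> real"
  assumes cont: "continuous_on {-1..1} \<gamma>"
begin

lemma continuous_on_segment:
  assumes "a \<in> {-1..1}" "b \<in> {-1..1}" shows "continuous_on {min a b..max a b} \<gamma>"
  by (rule continuous_on_subset[OF cont]) (use assms in auto)

lemma h_equiv_iff:
  "(x, x') \<in> h_equiv h \<gamma> \<longleftrightarrow> x \<in> h_minima h \<gamma> \<and> x' \<in> h_minima h \<gamma> \<and>
     (\<forall>z\<in>{min x x'..max x x'}. \<bar>\<gamma> z - \<gamma> x\<bar> < h)"
proof -
  have "seg_max (\<lambda>z. \<bar>\<gamma> z - \<gamma> x\<bar>) x x' < h \<longleftrightarrow> (\<forall>z\<in>{min x x'..max x x'}. \<bar>\<gamma> z - \<gamma> x\<bar> < h)"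
    if "x \<in> h_minima h \<gamma>" "x' \<in> h_minima h \<gamma>"
  proof (rule seg_max_less_iff, intro continuous_intros continuous_on_segment)
    show "x \<in> {-1..1}" "x' \<in> {-1..1}" using that h_minima_interior[of h \<gamma>] by force+
  qed
  then show ?thesis unfolding h_equiv_def by auto
qed

lemma equiv_h_equiv:
  assumes h: "h > 0" shows "equiv (h_minima h \<gamma>) (h_equiv h \<gamma>)"
proof (rule equivI)
  show "h_equiv h \<gamma> \<subseteq> h_minima h \<gamma> \<times> h_minima h \<gamma>" by (auto simp: h_equiv_iff)
  show "refl_on (h_minima h \<gamma>) (h_equiv h \<gamma>)" using h by (auto simp: refl_on_def h_equiv_iff)
  show "sym (h_equiv h \<gamma>)"
  proof (rule symI)
    fix x y assume "(x, y) \<in> h_equiv h \<gamma>"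
    moreover from this have "\<gamma> y = \<gamma> x"
      unfolding h_equiv_iff using equivalent_h_minima_same_height by blast
    ultimately show "(y, x) \<in> h_equiv h \<gamma>"
      by (auto simp: h_equiv_iff min.commute max.commute)
  qed
  show "trans (h_equiv h \<gamma>)"
  proof (rule transI)
    fix x y z assume xy: "(x, y) \<in> h_equiv h \<gamma>" and yz: "(y, z) \<in> h_equiv h \<gamma>"
    have "\<gamma> y = \<gamma> x"
      using xy unfolding h_equiv_iff using equivalent_h_minima_same_height by blast
    moreover have "u \<in> {min x y..max x y} \<or> u \<in> {min y z..max y z}"
      if "u \<in> {min x z..max x z}" for u using that by auto
    ultimately show "(x, z) \<in> h_equiv h \<gamma>" using xy yz unfolding h_equiv_iff by metis
  qed
qed

lemma M_minus_iff:
  assumes h: "h > 0"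
  shows "x \<in> M_minus h \<gamma> \<longleftrightarrow> x \<in> h_minima h \<gamma> \<and>
    (\<forall>y\<in>h_minima h \<gamma>. y < x \<longrightarrow> (\<exists>z\<in>{y..x}. h \<le> \<bar>\<gamma> z - \<gamma> x\<bar>))"
proof -
  note eq = equiv_h_equiv[OF h]
  have "x \<in> M_minus h \<gamma> \<longleftrightarrow> x \<in> h_minima h \<gamma> \<and> (\<forall>y. (x, y) \<in> h_equiv h \<gamma> \<longrightarrow> x \<le> y)"
  proof
    assume "x \<in> M_minus h \<gamma>"
    then obtain C where C: "C \<in> h_minima h \<gamma> // h_equiv h \<gamma>" "x \<in> C" "\<forall>y\<in>C. x \<le> y"
      unfolding M_minus_def by auto
    from C have "x \<in> h_minima h \<gamma>" using in_quotient_imp_subset[OF eq] by blast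
    moreover have "y \<in> C" if "(x, y) \<in> h_equiv h \<gamma>" for y
      using in_quotient_imp_closed[OF eq C(1,2) that] .
    ultimately show "x \<in> h_minima h \<gamma> \<and> (\<forall>y. (x, y) \<in> h_equiv h \<gamma> \<longrightarrow> x \<le> y)" using C(3) by auto
  next
    assume "x \<in> h_minima h \<gamma> \<and> (\<forall>y. (x, y) \<in> h_equiv h \<gamma> \<longrightarrow> x \<le> y)"
    then show "x \<in> M_minus h \<gamma>" unfolding M_minus_def
      using equiv_class_self[OF eq] by (auto intro!: bexI[of _ "h_equiv h \<gamma> `` {x}"] quotientI)
  qed
  also have "\<dots> \<longleftrightarrow> x \<in> h_minima h \<gamma> \<and>
    (\<forall>y\<in>h_minima h \<gamma>. y < x \<longrightarrow> (\<exists>z\<in>{min x y..max x y}. h \<le> \<bar>\<gamma> z - \<gamma> x\<bar>))"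
    unfolding h_equiv_iff by (metis linorder_not_le)
  also have "\<dots> \<longleftrightarrow> x \<in> h_minima h \<gamma> \<and>
    (\<forall>y\<in>h_minima h \<gamma>. y < x \<longrightarrow> (\<exists>z\<in>{y..x}. h \<le> \<bar>\<gamma> z - \<gamma> x\<bar>))"
    by (intro conj_cong ball_cong imp_cong refl) (simp add: min_def max_def)
  finally show ?thesis .
qed

lemma M_minus_subset: "h > 0 \<Longrightarrow> M_minus h \<gamma> \<subseteq> h_minima h \<gamma>"
  by (auto simp: M_minus_iff)

text \<open>
  Only the height of the saddle enters the definition of a good path, and it can be computed
  without locating the saddle. The set of saddles is compact and nonempty, so its least element exists.
\<close>

lemma height_z_star:
  assumes A: "finite A" "A \<noteq> {}" "A \<subseteq> {-1..1}" and B: "finite B" "B \<noteq> {}" "B \<subseteq> {-1..1}"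
  shows "\<gamma> (z_star \<gamma> A B) = saddle_height \<gamma> A B"
proof -
  let ?c = "saddle_height \<gamma> A B"
  let ?S = "\<Union>(a, b)\<in>A \<times> B. {z \<in> {min a b..max a b}. \<gamma> z = ?c}"
  have S: "saddle_set \<gamma> A B = ?S"
    using A(3) B(3) by (fastforce simp: saddle_set_def)
  have "compact ?S"
  proof (intro compact_UN, goal_cases)
    case 1 show ?case using A B by simp
  next
    case (2 p)
    then obtain a b where p: "p = (a, b)" "a \<in> A" "b \<in> B" by auto
    have "closed {z \<in> {min a b..max a b}. \<gamma> z = ?c}"
      by (intro continuous_closed_preimage_constant continuous_on_segment) (use p A B in auto)
    moreover have "bounded {z \<in> {min a b..max a b}. \<gamma> z = ?c}"
      by (rule bounded_subset[of "{min a b..max a b}"]) auto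
    ultimately show ?case using p by (simp add: compact_eq_bounded_closed)
  qed
  moreover have "?S \<noteq> {}"
  proof -
    have "?c \<in> (\<lambda>(a, b). seg_max \<gamma> a b) ` (A \<times> B)"
      unfolding saddle_height_def using A B by (intro Min_in) auto
    then obtain a b where ab: "a \<in> A" "b \<in> B" "?c = seg_max \<gamma> a b" by auto
    have "continuous_on {min a b..max a b} \<gamma>"
      by (rule continuous_on_segment) (use ab A B in auto)
    then obtain z where "z \<in> {min a b..max a b}" "\<gamma> z = seg_max \<gamma> a b"
      using seg_max_attained by metis
    with ab show ?thesis by auto
  qed
  ultimately obtain z where "z \<in> ?S" "\<forall>y\<in>?S. z \<le> y"
    using compact_attains_inf by blast
  then have z: "z \<in> saddle_set \<gamma> A B" "\<And>y. y \<in> saddle_set \<gamma> A B \<Longrightarrow> z \<le> y"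
    unfolding S by auto
  have "z_star \<gamma> A B = z"
    unfolding z_star_def using z by (intro Least_equality) auto
  with z(1) show ?thesis by (simp add: saddle_set_def)
qed

end

definition depth :: "(real \<Rightarrow> real) \<Rightarrow> real \<Rightarrow> real set \<Rightarrow> real" where
  "depth \<gamma> x S = Min (seg_max \<gamma> x ` S) - \<gamma> x"

lemma depth_eq: "depth \<gamma> x S = saddle_height \<gamma> {x} S - \<gamma> x"
proof -
  have "(\<lambda>(a, b). seg_max \<gamma> a b) ` ({x} \<times> S) = seg_max \<gamma> x ` S" by force
  then show ?thesis by (simp add: depth_def saddle_height_def)
qed

lemma good_paths_iff:
  assumes cont: "continuous_on {-1..1} \<gamma>" and h: "h > 0" and fin: "finite (M_minus h \<gamma>)"
  defines "M \<equiv> M_minus h \<gamma>"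
  shows "\<gamma> \<in> good_paths h \<delta> \<longleftrightarrow> M \<noteq> {} \<and>
    (\<forall>x\<in>M. h + \<delta> \<le> depth \<gamma> x ((M \<union> {-1, 1}) - {x})) \<and>
    (\<exists>(q::nat) x. bij_betw x {1..q} M \<and> (\<forall>k j. 1 \<le> k \<longrightarrow> k < j \<longrightarrow> j \<le> q \<longrightarrow>
       depth \<gamma> (x j) (x ` {1..k - 1} \<union> {-1, 1}) + \<delta> \<le> depth \<gamma> (x k) (x ` {1..k - 1} \<union> {-1, 1})))"
proof -
  have int: "M \<subseteq> {-1<..<1}"
    using M_minus_subset[OF cont h] h_minima_interior unfolding M_def by blast
  have z: "\<gamma> (z_star \<gamma> {x} S) - \<gamma> x = depth \<gamma> x S"
    if "x \<in> M" "finite S" "S \<noteq> {}" "S \<subseteq> M \<union> {-1, 1}" for x S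
    unfolding depth_eq using height_z_star[OF cont, of "{x}" S] that int by fastforce
  have 1: "(\<forall>x\<in>M. \<gamma> (z_star \<gamma> {x} ((M \<union> {-1, 1}) - {x})) - \<gamma> x \<ge> h + \<delta>) \<longleftrightarrow>
     (\<forall>x\<in>M. h + \<delta> \<le> depth \<gamma> x ((M \<union> {-1, 1}) - {x}))"
  proof (intro ball_cong refl)
    fix x assume x: "x \<in> M"
    then have "1 \<in> (M \<union> {-1, 1}) - {x}" using int by auto
    then have "(M \<union> {-1, 1}) - {x} \<noteq> {}" by blast
    then show "(\<gamma> (z_star \<gamma> {x} ((M \<union> {-1, 1}) - {x})) - \<gamma> x \<ge> h + \<delta>) =
       (h + \<delta> \<le> depth \<gamma> x ((M \<union> {-1, 1}) - {x}))"
      using z[of x "(M \<union> {-1, 1}) - {x}"] x fin by (auto simp: M_def)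
  qed
  have 2: "(let S = (\<lambda>k. x ` {1..k} \<union> {-1, 1}) in
          \<forall>k. 1 \<le> k \<and> k < q \<longrightarrow>
            \<gamma> (z_star \<gamma> {x k} (S (k - 1))) - \<gamma> (x k)
              \<ge> Max ((\<lambda>j. \<gamma> (z_star \<gamma> {x j} (S (k - 1))) - \<gamma> (x j)) ` {k<..q}) + \<delta>) \<longleftrightarrow>
     (\<forall>k j. 1 \<le> k \<longrightarrow> k < j \<longrightarrow> j \<le> q \<longrightarrow>
       depth \<gamma> (x j) (x ` {1..k - 1} \<union> {-1, 1}) + \<delta> \<le> depth \<gamma> (x k) (x ` {1..k - 1} \<union> {-1, 1}))"
    (is "?L q x = ?R q x")
    if bij: "bij_betw x {1..q} M" for q and x :: "nat \<Rightarrow> real"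
  proof -
    have zz: "\<gamma> (z_star \<gamma> {x j} (x ` {1..k - 1} \<union> {-1, 1})) - \<gamma> (x j)
        = depth \<gamma> (x j) (x ` {1..k - 1} \<union> {-1, 1})" if "1 \<le> j" "j \<le> q" "k \<le> q" for j k
      by (rule z) (use bij that in \<open>auto simp: bij_betw_def\<close>)
    have *: "(\<gamma> (z_star \<gamma> {x k} (x ` {1..k - 1} \<union> {-1, 1})) - \<gamma> (x k)
              \<ge> Max ((\<lambda>j. \<gamma> (z_star \<gamma> {x j} (x ` {1..k - 1} \<union> {-1, 1})) - \<gamma> (x j)) ` {k<..q}) + \<delta>)
       \<longleftrightarrow> (\<forall>j. k < j \<longrightarrow> j \<le> q \<longrightarrow>
       depth \<gamma> (x j) (x ` {1..k - 1} \<union> {-1, 1}) + \<delta> \<le> depth \<gamma> (x k) (x ` {1..k - 1} \<union> {-1, 1}))"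
      if k: "1 \<le> k" "k < q" for k
    proof -
      have im: "(\<lambda>j. \<gamma> (z_star \<gamma> {x j} (x ` {1..k - 1} \<union> {-1, 1})) - \<gamma> (x j)) ` {k<..q}
         = (\<lambda>j. depth \<gamma> (x j) (x ` {1..k - 1} \<union> {-1, 1})) ` {k<..q}"
        by (intro image_cong refl zz) (use k in auto)
      have "{k<..q} \<noteq> {}" using k by auto
      then show ?thesis unfolding im zz[of k k, OF k(1) less_imp_le[OF k(2)] less_imp_le[OF k(2)]]
        unfolding le_diff_eq[symmetric] by auto
    qed
    have "?L q x \<longleftrightarrow> (\<forall>k. 1 \<le> k \<and> k < q \<longrightarrow> (\<forall>j. k < j \<longrightarrow> j \<le> q \<longrightarrow>
       depth \<gamma> (x j) (x ` {1..k - 1} \<union> {-1, 1}) + \<delta> \<le> depth \<gamma> (x k) (x ` {1..k - 1} \<union> {-1, 1})))"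
      unfolding Let_def using * by blast
    also have "\<dots> \<longleftrightarrow> ?R q x" by (meson le_less_trans less_le_trans)
    finally show ?thesis .
  qed
  have 3: "(\<exists>(q::nat) x. bij_betw x {1..q} M \<and> ?L q x) \<longleftrightarrow> (\<exists>q x. bij_betw x {1..q} M \<and> ?R q x)"
    by (intro arg_cong[where f = Ex] ext conj_cong refl 2)
  show ?thesis
    unfolding good_paths_def mem_Collect_eq M_def[symmetric] 1 3 using cont by (simp only: simp_thms)
qed

section \<open>The h-minima of interpolated paths\<close>

text \<open>
  If the minimum is not a lattice point, then the affine piece through it must be constant, so
  its left end is an equivalent \<open>h\<close>-minimum. The least element of a class is thus a lattice point.
\<close>

lemma h_minima_round_down:
  assumes N: "N > 0" and h: "h > 0" and x: "x \<in> h_minima h (interp N v)"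
  defines "k \<equiv> \<lfloor>real N * x\<rfloor>"
  shows "of_int k / real N \<in> h_minima h (interp N v)"
    "\<forall>z\<in>{of_int k / real N..x}. interp N v z = interp N v x"
proof -
  let ?\<gamma> = "interp N v" and ?l = "of_int k / real N" and ?r = "(of_int k + 1) / real N"
  have l: "?l \<le> x" and r: "x < ?r"
    using lattice_cell[OF N, of x] unfolding k_def by blast+
  obtain a b where ab: "-1 \<le> a" "a < x" "x < b" "b \<le> 1" "?\<gamma> x + h \<le> ?\<gamma> a" "?\<gamma> x + h \<le> ?\<gamma> b"
    "\<And>z. a \<le> z \<Longrightarrow> z \<le> b \<Longrightarrow> ?\<gamma> x \<le> ?\<gamma> z"
    using h_minimaE[OF x] by metis
  have "?l \<in> h_minima h ?\<gamma> \<and> (\<forall>z\<in>{?l..x}. ?\<gamma> z = ?\<gamma> x)"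
  proof (cases "?l = x")
    case True then show ?thesis using x by auto
  next
    case False
    with l have l: "?l < x" by simp
    define c where "c = v (k + 1) - v k"
    have aff: "?\<gamma> z = v k + (real N * z - of_int k) * c" if "?l \<le> z" "z \<le> ?r" for z
      unfolding c_def using interp_affine[OF N] that by blast
    have "c = 0"
    proof (rule antisym)
      \<comment> \<open>Points on both sides of the local minimum \<open>x\<close> force the slope to vanish.\<close>
      obtain z1 where z1: "max a ?l < z1" "z1 < x" using dense[of "max a ?l" x] ab l by auto
      then have "?\<gamma> x \<le> ?\<gamma> z1" by (intro ab) (use ab in auto)
      then have "0 \<le> real N * (z1 - x) * c" using z1 r aff[of x] aff[of z1] l by (simp add: algebra_simps)
      moreover have "real N * (z1 - x) < 0" using N z1 by (simp add: mult_pos_neg)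
      ultimately show "c \<le> 0" by (meson mult_neg_pos not_le)
      obtain z2 where z2: "x < z2" "z2 < min b ?r" using dense[of x "min b ?r"] ab r by auto
      then have "?\<gamma> x \<le> ?\<gamma> z2" by (intro ab) (use ab in auto)
      then have "0 \<le> real N * (z2 - x) * c" using z2 r aff[of x] aff[of z2] l by (simp add: algebra_simps)
      moreover have "real N * (z2 - x) > 0" using N z2 by simp
      ultimately show "0 \<le> c" by (meson mult_pos_neg not_le)
    qed
    then have const: "?\<gamma> z = ?\<gamma> x" if "?l \<le> z" "z \<le> ?r" for z
      using aff that l r by simp
    have "a < ?l"
    proof (rule ccontr)
      assume "\<not> a < ?l"
      then have "?\<gamma> a = ?\<gamma> x" using ab(2) r by (intro const) linarith+
      with ab(5) h show False by simp
    qed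
    moreover have "?\<gamma> ?l = ?\<gamma> x" by (rule const) (use l r in auto)
    ultimately have "?l \<in> h_minima h ?\<gamma>"
      using ab l by (intro h_minimaI[of a _ b]) auto
    moreover have "\<forall>z\<in>{?l..x}. ?\<gamma> z = ?\<gamma> x"
      using r by (intro ballI const) auto
    ultimately show ?thesis ..
  qed
  then show "?l \<in> h_minima h ?\<gamma>" "\<forall>z\<in>{?l..x}. ?\<gamma> z = ?\<gamma> x" by blast+
qed

lemma M_minus_interp_subset:
  assumes N: "N > 0" and h: "h > 0"
  shows "M_minus h (interp N v) \<subseteq> (\<lambda>k. of_int k / real N) ` {- int N..int N}"
proof
  fix x assume x: "x \<in> M_minus h (interp N v)"
  let ?k = "\<lfloor>real N * x\<rfloor>"
  note iff = M_minus_iff[OF continuous_on_interp[OF N] h]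
  note xm = conjunct1[OF x[unfolded iff]] and least = conjunct2[OF x[unfolded iff]]
  note rd = h_minima_round_down[OF N h xm]
  have "\<not> of_int ?k / real N < x"
  proof
    assume "of_int ?k / real N < x"
    with least rd(1) obtain z where z: "z \<in> {of_int ?k / real N..x}" "h \<le> \<bar>interp N v z - interp N v x\<bar>"
      by blast
    with rd(2) have "interp N v z = interp N v x" by blast
    with z(2) h show False by simp
  qed
  then have eq: "x = of_int ?k / real N"
    using lattice_cell[OF N, of x] by (metis linorder_neqE_linordered_idom linorder_not_le)
  have "-1 < x" "x < 1" using xm h_minima_interior by force+
  moreover have "real N * x = of_int ?k"
    using N by (subst eq) simp
  ultimately have "- real N \<le> of_int ?k" "of_int ?k \<le> real N"
    using N mult_left_mono[of "-1" x "real N"] mult_left_mono[of x 1 "real N"] by auto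
  then have "?k \<in> {- int N..int N}" by auto
  with eq show "x \<in> (\<lambda>k. of_int k / real N) ` {- int N..int N}" by (rule image_eqI)
qed

text \<open>
  A witness between two lattice points can be replaced by the neighbor with the larger value.
\<close>

lemma h_minima_lattice_iff:
  assumes N: "N > 0" and h: "h > 0"
  shows "of_int k / real N \<in> h_minima h (interp N v) \<longleftrightarrow>
    (\<exists>a\<in>{- int N..<k}. \<exists>b\<in>{k<..int N}. v k + h \<le> v a \<and> v k + h \<le> v b \<and> (\<forall>z\<in>{a..b}. v k \<le> v z))"
    (is "?L \<longleftrightarrow> ?R")
proof
  let ?\<gamma> = "interp N v" and ?x = "of_int k / real N"
  assume L: ?L
  obtain a b where ab: "-1 \<le> a" "a < ?x" "?x < b" "b \<le> 1" "v k + h \<le> ?\<gamma> a" "v k + h \<le> ?\<gamma> b"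
    "\<And>z. a \<le> z \<Longrightarrow> z \<le> b \<Longrightarrow> v k \<le> ?\<gamma> z"
    using h_minimaE[OF L] interp_lattice[OF N] by metis
  have lat: "v k \<le> v z" if "a \<le> of_int z / real N" "of_int z / real N \<le> b" for z
    using ab(7)[OF that] N by simp
  define i where "i = \<lfloor>real N * a\<rfloor>"
  have i: "of_int i \<le> real N * a" "real N * a < of_int i + 1" unfolding i_def by linarith+
  have "\<exists>a'\<in>{i..i + 1}. ?\<gamma> a \<le> v a'"
    by (rule interp_between_lattice(1)[OF N]) (use i N in \<open>auto simp: field_simps\<close>)
  then obtain a' where a': "a' \<in> {i..i + 1}" "?\<gamma> a \<le> v a'" ..
  define j where "j = \<lceil>real N * b\<rceil>"
  have j: "of_int j - 1 < real N * b" "real N * b \<le> of_int j" unfolding j_def by linarith+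
  have "\<exists>b'\<in>{j - 1..j}. ?\<gamma> b \<le> v b'"
    by (rule interp_between_lattice(1)[OF N]) (use j N in \<open>auto simp: field_simps\<close>)
  then obtain b' where b': "b' \<in> {j - 1..j}" "?\<gamma> b \<le> v b'" ..
  have "real N * a < of_int k" "of_int k < real N * b" "- real N \<le> real N * a" "real N * b \<le> real N"
    using ab(1-4) N mult_left_mono[of "-1" a "real N"] by (auto simp: field_simps)
  then have ik: "i < k" "k < j" "- int N \<le> i" "j \<le> int N"
    unfolding i_def j_def by linarith+
  have ne: "a' \<noteq> k" "b' \<noteq> k" using a'(2) b'(2) ab h by auto
  have "v k \<le> v z" if z: "z \<in> {a'..b'}" for z
  proof -
    consider "z = a'" | "z = b'" | "a' < z" "z < b'" using z by force
    then show ?thesis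
    proof cases
      case 3
      then have "i + 1 \<le> z" "z \<le> j - 1" using a' b' by auto
      then have "real N * a \<le> of_int z" "of_int z \<le> real N * b" using i j by linarith+
      then show ?thesis using N by (intro lat) (simp_all add: field_simps)
    qed (use a' b' ab h in auto)
  qed
  with a' b' ik ne ab show ?R
    by (intro bexI[of _ a'] bexI[of _ b']) auto
next
  let ?\<gamma> = "interp N v" and ?x = "of_int k / real N"
  assume ?R
  then obtain a b where ab: "a \<in> {- int N..<k}" "b \<in> {k<..int N}" "v k + h \<le> v a" "v k + h \<le> v b"
    "\<forall>z\<in>{a..b}. v k \<le> v z" by auto
  show ?L
  proof (rule h_minimaI[of "of_int a / real N" _ "of_int b / real N"])
    show "?\<gamma> ?x \<le> ?\<gamma> z" if z: "of_int a / real N \<le> z" "z \<le> of_int b / real N" for z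
    proof -
      obtain i where "i \<in> {a..b}" "v i \<le> ?\<gamma> z"
        using interp_between_lattice(2)[OF N z, of v] ..
      with ab(5) show ?thesis using N by force
    qed
    show "of_int a / real N < ?x" "?x < of_int b / real N"
      using ab N by (simp_all add: divide_strict_right_mono)
    show "-1 \<le> of_int a / real N" "of_int b / real N \<le> 1"
      using ab(1,2) N by (simp_all add: le_divide_eq divide_le_eq)
  qed (use ab N in simp_all)
qed

text \<open>
  By rounding down, an equivalent \<open>h\<close>-minimum to the left may be taken on the lattice.
\<close>

lemma M_minus_lattice_iff:
  assumes N: "N > 0" and h: "h > 0"
  shows "of_int k / real N \<in> M_minus h (interp N v) \<longleftrightarrow>
    of_int k / real N \<in> h_minima h (interp N v) \<and>
    (\<forall>j\<in>{- int N..<k}. of_int j / real N \<in> h_minima h (interp N v) \<longrightarrow>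
       (\<exists>z\<in>{j..k}. h \<le> \<bar>v z - v k\<bar>))"
    (is "?L \<longleftrightarrow> ?x \<in> ?H \<and> ?R")
proof -
  let ?\<gamma> = "interp N v"
  note iff = M_minus_iff[OF continuous_on_interp[OF N] h]
  have "(\<forall>y\<in>?H. y < ?x \<longrightarrow> (\<exists>z\<in>{y..?x}. h \<le> \<bar>?\<gamma> z - ?\<gamma> ?x\<bar>)) \<longleftrightarrow> ?R"
  proof
    assume L: "\<forall>y\<in>?H. y < ?x \<longrightarrow> (\<exists>z\<in>{y..?x}. h \<le> \<bar>?\<gamma> z - ?\<gamma> ?x\<bar>)"
    show ?R
    proof (intro ballI impI)
      fix j assume j: "j \<in> {- int N..<k}" "of_int j / real N \<in> ?H"
      then have "of_int j / real N < ?x" using N by (simp add: divide_strict_right_mono)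
      with L j(2) have "\<exists>z\<in>{of_int j / real N..?x}. h \<le> \<bar>?\<gamma> z - ?\<gamma> ?x\<bar>" by blast
      then obtain z where z: "of_int j / real N \<le> z" "z \<le> ?x" "h \<le> \<bar>?\<gamma> z - v k\<bar>"
        using N by auto
      note ib = interp_between_lattice[OF N z(1,2), of v]
      show "\<exists>z\<in>{j..k}. h \<le> \<bar>v z - v k\<bar>"
      proof (cases "?\<gamma> z \<ge> v k")
        case True
        with z(3) have "v k + h \<le> ?\<gamma> z" by simp
        with ib(1) show ?thesis by force
      next
        case False
        with z(3) have "?\<gamma> z \<le> v k - h" by simp
        with ib(2) show ?thesis by force
      qed
    qed
  next
    assume R: ?R
    show "\<forall>y\<in>?H. y < ?x \<longrightarrow> (\<exists>z\<in>{y..?x}. h \<le> \<bar>?\<gamma> z - ?\<gamma> ?x\<bar>)"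
    proof (intro ballI impI)
      fix y assume y: "y \<in> ?H" "y < ?x"
      define j where "j = \<lfloor>real N * y\<rfloor>"
      note rd = h_minima_round_down[OF N h y(1), folded j_def]
      have jl: "of_int j / real N \<le> y"
        by (rule lattice_cell[OF N, of y]) (simp add: j_def)
      have "real N * y < of_int k" using y N by (simp add: field_simps)
      then have jk: "j < k" unfolding j_def by linarith
      have "-1 < of_int j / real N" using rd(1) h_minima_interior by force
      then have "- int N \<le> j" using N by (simp add: field_simps)
      with R rd(1) jk obtain z where z: "z \<in> {j..k}" "h \<le> \<bar>v z - v k\<bar>" by auto
      show "\<exists>z\<in>{y..?x}. h \<le> \<bar>?\<gamma> z - ?\<gamma> ?x\<bar>"
      proof (cases "y \<le> of_int z / real N")
        case True
        then show ?thesis using z N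
          by (intro bexI[of _ "of_int z / real N"]) (simp_all add: divide_right_mono)
      next
        case False
        then have "of_int z < real N * y" using N by (simp add: field_simps)
        then have "z \<le> j" unfolding j_def by linarith
        with z have "z = j" by auto
        moreover have "?\<gamma> y = v j" using rd(2) jl N by (metis atLeastAtMost_iff interp_lattice order_refl)
        ultimately show ?thesis using z(2) y(2) N by (intro bexI[of _ y]) simp_all
      qed
    qed
  qed
  then show ?thesis unfolding iff by (simp only:)
qed

section \<open>Greedy labeling\<close>

text \<open>
  Here \<open>f S x\<close> is the value of \<open>x\<close> once the elements of \<open>S\<close> have been labeled. Taking an element
  of maximal value at each step makes the gap between maximal and other values the gap required.
\<close>

lemma greedy_labeling:
  fixes f :: "'a set \<Rightarrow> 'a \<Rightarrow> real"
  assumes fin: "finite M"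
    and gap: "\<And>S x y. S \<subseteq> M \<Longrightarrow> x \<in> M - S \<Longrightarrow> y \<in> M - S \<Longrightarrow> x \<noteq> y \<Longrightarrow> \<delta> \<le> \<bar>f S x - f S y\<bar>"
  shows "\<exists>x. bij_betw x {1..card M} M \<and>
    (\<forall>k j. 1 \<le> k \<longrightarrow> k < j \<longrightarrow> j \<le> card M \<longrightarrow> f (x ` {1..k - 1}) (x j) + \<delta> \<le> f (x ` {1..k - 1}) (x k))"
proof -
  have partial: "\<exists>x. inj_on x {1..n} \<and> x ` {1..n} \<subseteq> M \<and>
      (\<forall>k\<in>{1..n}. \<forall>y\<in>M - x ` {1..k}. f (x ` {1..k - 1}) y + \<delta> \<le> f (x ` {1..k - 1}) (x k))"
    if "n \<le> card M" for n
    using that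
  proof (induction n)
    case 0
    show ?case by simp
  next
    case (Suc n)
    then obtain x where x: "inj_on x {1..n}" "x ` {1..n} \<subseteq> M"
      "\<And>k y. k \<in> {1..n} \<Longrightarrow> y \<in> M - x ` {1..k} \<Longrightarrow> f (x ` {1..k - 1}) y + \<delta> \<le> f (x ` {1..k - 1}) (x k)"
      by auto
    let ?S = "x ` {1..n}"
    have "card ?S = n" using x(1) by (simp add: card_image)
    with Suc.prems have "card ?S < card M" by simp
    then have ne: "M - ?S \<noteq> {}" using x(2) by auto
    have "Max (f ?S ` (M - ?S)) \<in> f ?S ` (M - ?S)" using fin ne by (intro Max_in) auto
    then obtain m where mS: "m \<in> M - ?S" and "f ?S m = Max (f ?S ` (M - ?S))" by force
    then have m: "f ?S y \<le> f ?S m" if "y \<in> M - ?S" for y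
      using fin that by simp
    define x' where "x' = x(Suc n := m)"
    have old: "x' ` {1..k} = x ` {1..k}" "x' k = x k" if "k \<le> n" for k
      using that by (auto simp: x'_def)
    have new: "x' ` {1..Suc n} = insert m ?S"
    proof -
      have "{1..Suc n} = insert (Suc n) {1..n}" by auto
      then have "x' ` {1..Suc n} = insert (x' (Suc n)) (x' ` {1..n})" by (simp only: image_insert)
      then show ?thesis using old(1)[of n] by (simp add: x'_def del: fun_upd_image)
    qed
    have "inj_on x' {1..Suc n}"
    proof (rule eq_card_imp_inj_on)
      show "card (x' ` {1..Suc n}) = card {1..Suc n}"
        unfolding new using mS \<open>card ?S = n\<close> by simp
    qed simp
    moreover have "x' ` {1..Suc n} \<subseteq> M" unfolding new using mS x(2) by auto
    moreover have "f (x' ` {1..k - 1}) y + \<delta> \<le> f (x' ` {1..k - 1}) (x' k)"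
      if k: "k \<in> {1..Suc n}" and y: "y \<in> M - x' ` {1..k}" for k y
    proof (cases "k = Suc n")
      case True
      have y': "y \<in> M - ?S" "y \<noteq> m" using y unfolding True new by auto
      have "f ?S y + \<delta> \<le> f ?S m"
        using gap[OF x(2) mS y'(1)] m[OF y'(1)] y'(2) by auto
      then show ?thesis using True old(1)[of n] by (simp add: x'_def)
    next
      case False
      with k have kn: "k \<in> {1..n}" "k - 1 \<le> n" by auto
      then show ?thesis using x(3)[of k y] y old[of k] old(1)[of "k - 1"] by auto
    qed
    ultimately show ?case by blast
  qed
  obtain x where x: "inj_on x {1..card M}" "x ` {1..card M} \<subseteq> M"
      "\<forall>k\<in>{1..card M}. \<forall>y\<in>M - x ` {1..k}. f (x ` {1..k - 1}) y + \<delta> \<le> f (x ` {1..k - 1}) (x k)"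
    using partial[OF order_refl] by blast
  have "x ` {1..card M} = M"
    using x(1,2) fin by (intro card_subset_eq) (auto simp: card_image)
  then have "bij_betw x {1..card M} M" using x(1) by (simp add: bij_betw_def)
  moreover have "f (x ` {1..k - 1}) (x j) + \<delta> \<le> f (x ` {1..k - 1}) (x k)"
    if kj: "1 \<le> k" "k < j" "j \<le> card M" for k j
  proof -
    have "x j \<notin> x ` {1..k}"
      using inj_on_image_mem_iff[OF x(1), of j "{1..k}"] kj by auto
    moreover have "x j \<in> M" using x(2) kj by auto
    ultimately show ?thesis using x(3) kj by auto
  qed
  ultimately show ?thesis by blast
qed

section \<open>Paths with separated block extrema\<close>

text \<open>
  \<open>\<Lambda>\<close> is the lattice and \<open>\<beta> t\<close> is the number of the block that contains \<open>t\<close>. The last assumption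
  makes points whose heights differ by \<open>h\<close> lie at least two blocks apart; all separation
  statements below are instances of this.
\<close>

locale separated_blocks =
  fixes \<gamma> :: "real \<Rightarrow> real" and h :: real and \<Lambda> :: "real set" and \<beta> :: "real \<Rightarrow> int"
  assumes cont: "continuous_on {-1..1} \<gamma>" and h: "h > 0"
    and fin: "finite \<Lambda>" and \<Lambda>: "\<Lambda> \<subseteq> {-1..1}" "-1 \<in> \<Lambda>" "1 \<in> \<Lambda>"
    and attained: "\<And>s t. s \<in> \<Lambda> \<Longrightarrow> t \<in> \<Lambda> \<Longrightarrow> \<exists>z\<in>\<Lambda> \<inter> {min s t..max s t}. seg_max \<gamma> s t = \<gamma> z"
    and M_sub: "M_minus h \<gamma> \<subseteq> \<Lambda>" and M_ne: "M_minus h \<gamma> \<noteq> {}"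
    and mono: "mono \<beta>"
    and osc: "\<And>s t. s \<in> \<Lambda> \<Longrightarrow> t \<in> \<Lambda> \<Longrightarrow> \<bar>\<beta> s - \<beta> t\<bar> \<le> 1 \<Longrightarrow> \<bar>\<gamma> s - \<gamma> t\<bar> < h"
begin

abbreviation "M \<equiv> M_minus h \<gamma>"

definition far :: "real \<Rightarrow> real \<Rightarrow> bool" where "far s t \<longleftrightarrow> 2 \<le> \<bar>\<beta> s - \<beta> t\<bar>"

definition blockmin :: "int \<Rightarrow> real" where "blockmin i = Min (\<gamma> ` {t\<in>\<Lambda>. \<beta> t = i})"
definition blockmax :: "int \<Rightarrow> real" where "blockmax i = Max (\<gamma> ` {t\<in>\<Lambda>. \<beta> t = i})"

lemma far_if_height: "s \<in> \<Lambda> \<Longrightarrow> t \<in> \<Lambda> \<Longrightarrow> h \<le> \<bar>\<gamma> s - \<gamma> t\<bar> \<Longrightarrow> far s t"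
  using osc[of s t] unfolding far_def by force

lemma far_commute: "far s t \<longleftrightarrow> far t s"
  by (simp add: far_def abs_minus_commute)

lemma far_mono: "far s t \<Longrightarrow> s \<le> t \<Longrightarrow> s' \<le> s \<Longrightarrow> t \<le> t' \<Longrightarrow> far s' t'"
  using monoD[OF mono, of s t] monoD[OF mono, of s' s] monoD[OF mono, of t t'] unfolding far_def by auto

lemma far_if_between:
  assumes "far s t" "s \<in> {min t u..max t u}" shows "far u t"
proof (cases "t \<le> u")
  case True
  then show ?thesis using far_mono[of t s t u] assms far_commute by force
next
  case False
  then show ?thesis using far_mono[of s t u t] assms by auto
qed

lemma M_interior: "x \<in> M \<Longrightarrow> -1 < x \<and> x < 1"
  using M_minus_subset[OF cont h] h_minima_interior by fastforce

lemma cont_seg: "s \<in> \<Lambda> \<Longrightarrow> t \<in> \<Lambda> \<Longrightarrow> continuous_on {min s t..max s t} \<gamma>"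
  using \<Lambda>(1) by (intro continuous_on_segment[OF cont]) auto

lemma seg_max_ge_witness:
  assumes x: "x \<in> M" and s: "s \<in> \<Lambda>" and out: "s \<notin> {a..b}" and ab: "a < x" "x < b"
    "\<gamma> x + h \<le> \<gamma> a" "\<gamma> x + h \<le> \<gamma> b"
  shows "\<gamma> x + h \<le> seg_max \<gamma> x s"
proof (cases "s < a")
  case True
  with ab show ?thesis using seg_max_ge[OF cont_seg, of x s a] x s M_sub by force
next
  case False
  with out have "b < s" by auto
  with ab show ?thesis using seg_max_ge[OF cont_seg, of x s b] x s M_sub by force
qed

text \<open>
  The path climbs by \<open>h\<close> from \<open>x\<close> before it can reach another class or an end point. If \<open>s\<close> lies
  beyond the witnesses \<open>a\<close>, \<open>b\<close> of \<open>x\<close>, one of them is passed on the way. Otherwise the path stays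
  above \<open>\<gamma> x\<close> on the way, and by inequivalence it moves away from \<open>\<gamma> x\<close> by \<open>h\<close>, hence upwards.
\<close>

lemma seg_max_ge_minimum:
  assumes x: "x \<in> M" and s: "s \<in> M \<union> {-1, 1}" "s \<noteq> x"
  shows "\<gamma> x + h \<le> seg_max \<gamma> x s"
proof -
  have sL: "s \<in> \<Lambda>" "x \<in> \<Lambda>" using s x M_sub \<Lambda> by auto
  have "x \<in> h_minima h \<gamma>" using x M_minus_subset[OF cont h] by auto
  then obtain a b where ab: "-1 \<le> a" "a < x" "x < b" "b \<le> 1" "\<gamma> x + h \<le> \<gamma> a" "\<gamma> x + h \<le> \<gamma> b"
    "\<And>z. a \<le> z \<Longrightarrow> z \<le> b \<Longrightarrow> \<gamma> x \<le> \<gamma> z"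
    using h_minimaE by metis
  consider "s = -1" | "s = 1" | "s \<in> M" "s \<notin> {a..b}" | "s \<in> M" "s \<in> {a..b}" using s by auto
  then show ?thesis
  proof cases
    case 1
    then have "\<gamma> a \<le> seg_max \<gamma> x s" using ab by (intro seg_max_ge cont_seg sL) auto
    with ab show ?thesis by simp
  next
    case 2
    then have "\<gamma> b \<le> seg_max \<gamma> x s" using ab by (intro seg_max_ge cont_seg sL) auto
    with ab show ?thesis by simp
  next
    case 3
    then show ?thesis using seg_max_ge_witness[OF x sL(1) _ ab(2,3,5,6)] by simp
  next
    case 4
    then have mem: "s \<in> h_minima h \<gamma>" "x \<in> h_minima h \<gamma>" using x M_minus_subset[OF cont h] by auto
    \<comment> \<open>Otherwise \<open>x\<close> and \<open>s\<close> are equivalent, and the larger of them is not the least in its class.\<close>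
    have "\<exists>z\<in>{min x s..max x s}. h \<le> \<bar>\<gamma> z - \<gamma> x\<bar>"
    proof (rule ccontr)
      assume no: "\<not> ?thesis"
      then have eq: "\<gamma> s = \<gamma> x"
        by (intro equivalent_h_minima_same_height[OF mem(2,1)]) (meson not_le)
      show False
      proof (cases "x < s")
        case True
        then obtain z where "z \<in> {x..s}" "h \<le> \<bar>\<gamma> z - \<gamma> s\<bar>"
          using 4(1) mem unfolding M_minus_iff[OF cont h] by blast
        with no eq True show False by auto
      next
        case False
        then obtain z where "z \<in> {s..x}" "h \<le> \<bar>\<gamma> z - \<gamma> x\<bar>"
          using x mem s(2) unfolding M_minus_iff[OF cont h] by force
        with no False show False by auto
      qed
    qed
    then obtain z where z: "z \<in> {min x s..max x s}" "h \<le> \<bar>\<gamma> z - \<gamma> x\<bar>" ..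
    have "\<gamma> x \<le> \<gamma> z" using z(1) 4(2) ab(2,3) by (intro ab(7)) auto
    with z seg_max_ge[OF cont_seg[OF sL(2,1)] z(1)] show ?thesis by simp
  qed
qed

lemma far_minima:
  assumes "x \<in> M" "y \<in> M" "x \<noteq> y" shows "far x y"
proof -
  have L: "x \<in> \<Lambda>" "y \<in> \<Lambda>" using assms M_sub by auto
  obtain z where z: "z \<in> \<Lambda>" "z \<in> {min x y..max x y}" "seg_max \<gamma> x y = \<gamma> z"
    using attained[OF L] by auto
  have "h \<le> \<gamma> z - \<gamma> x" using seg_max_ge_minimum[of x y] assms z by auto
  then have "far z x" using far_if_height z L by auto
  then show ?thesis using far_if_between[of z x y] z far_commute by auto
qed

text \<open>
  A minimum \<open>y\<close> on the way from \<open>x\<close> to \<open>s\<close> lies at least \<open>h\<close> below the maximum \<open>\<gamma> z\<close>. A minimum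
  \<open>y\<close> off the way is separated from \<open>z\<close> by \<open>x\<close> or by \<open>s\<close>, which lies \<open>h\<close> below \<open>\<gamma> z\<close> itself; there is
  no minimum beyond an end point.
\<close>

lemma far_saddle:
  assumes x: "x \<in> M" and s: "s \<in> M \<union> {-1, 1}" "s \<noteq> x"
    and z: "z \<in> \<Lambda>" "z \<in> {min x s..max x s}" "\<gamma> z = seg_max \<gamma> x s" and y: "y \<in> M"
  shows "far z y"
proof -
  have L: "x \<in> \<Lambda>" "y \<in> \<Lambda>" "s \<in> \<Lambda>" using assms M_sub \<Lambda> by auto
  have fx: "far z x" using seg_max_ge_minimum[OF x s] z by (intro far_if_height L) auto
  have fs: "far z s" if "s \<in> M"
  proof -
    have "\<gamma> s + h \<le> \<gamma> z"
      using seg_max_ge_minimum[OF that, of x] x s z by (simp add: seg_max_commute)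
    then show ?thesis by (intro far_if_height L z) auto
  qed
  have sM: "s \<in> M \<or> s = -1 \<or> s = 1" using s by auto
  have "x \<in> {min z y..max z y} \<or> s \<in> {min z y..max z y} \<and> s \<in> M"
    if "y \<notin> {min x s..max x s}"
  proof (cases "x \<le> s")
    case True
    with that z(2) have "x \<le> z" "z \<le> s" "y < x \<or> s < y" by auto
    moreover have "s \<in> M" if "s < y" using sM that True M_interior[OF y] M_interior[OF x] by auto
    ultimately show ?thesis by auto
  next
    case False
    with that z(2) have "s \<le> z" "z \<le> x" "y < s \<or> x < y" by auto
    moreover have "s \<in> M" if "y < s" using sM that False M_interior[OF y] M_interior[OF x] by auto
    ultimately show ?thesis by auto
  qed
  then consider "y = x" | "y = s" | "y \<in> {min x s..max x s}" "y \<noteq> x" "y \<noteq> s" | "x \<in> {min z y..max z y}"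
    | "s \<in> {min z y..max z y}" "s \<in> M"
    by blast
  then show ?thesis
  proof cases
    case 1 then show ?thesis using fx by simp
  next
    case 2 then show ?thesis using fs y by simp
  next
    case 3
    have "\<gamma> y + h \<le> seg_max \<gamma> x y"
      using seg_max_ge_minimum[OF y, of x] x 3 by (simp add: seg_max_commute)
    moreover obtain z' where z': "z' \<in> \<Lambda>" "z' \<in> {min x y..max x y}" "seg_max \<gamma> x y = \<gamma> z'"
      using attained[OF L(1,2)] by auto
    moreover have "\<gamma> z' \<le> \<gamma> z"
      unfolding z(3) using z' 3 by (intro seg_max_ge cont_seg L) auto
    ultimately show ?thesis by (intro far_if_height z L) auto
  next
    case 4
    then show ?thesis using far_if_between[of x z y] fx far_commute by auto
  next
    case 5
    then show ?thesis using far_if_between[of s z y] fs far_commute by auto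
  qed
qed

lemma same_block_seg:
  assumes "far s x" "t \<in> \<Lambda>" "\<beta> t = \<beta> s" shows "(t \<le> x) = (s \<le> x)"
  using assms monoD[OF mono, of t x] monoD[OF mono, of x t] monoD[OF mono, of s x] monoD[OF mono, of x s]
  unfolding far_def by (smt (verit))

text \<open>
  A lattice point of the same block outside of the interval on which \<open>\<gamma> x\<close> is minimal could be
  reached from \<open>x\<close> only across a height of \<open>\<gamma> x + h\<close>, that is, only by leaving the block.
\<close>

lemma blockmin_at_minimum:
  assumes x: "x \<in> M" shows "\<gamma> x = blockmin (\<beta> x)"
proof -
  have xL: "x \<in> \<Lambda>" using x M_sub by auto
  have "x \<in> h_minima h \<gamma>" using x M_minus_subset[OF cont h] by auto
  then obtain a b where ab: "-1 \<le> a" "a < x" "x < b" "b \<le> 1" "\<gamma> x + h \<le> \<gamma> a" "\<gamma> x + h \<le> \<gamma> b"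
    "\<And>z. a \<le> z \<Longrightarrow> z \<le> b \<Longrightarrow> \<gamma> x \<le> \<gamma> z"
    using h_minimaE by metis
  have "\<gamma> x \<le> \<gamma> t" if t: "t \<in> \<Lambda>" "\<beta> t = \<beta> x" for t
  proof (cases "t \<in> {a..b}")
    case True then show ?thesis using ab by auto
  next
    case False
    then have "\<gamma> x + h \<le> seg_max \<gamma> x t" using seg_max_ge_witness[OF x t(1) _ ab(2,3,5,6)] by simp
    moreover obtain z where z: "z \<in> \<Lambda>" "z \<in> {min x t..max x t}" "seg_max \<gamma> x t = \<gamma> z"
      using attained[OF xL t(1)] by auto
    ultimately have "far z x" by (intro far_if_height xL) auto
    then have "far x t" using far_if_between[of z x t] z far_commute by auto
    then show ?thesis using t by (simp add: far_def)
  qed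
  then show ?thesis unfolding blockmin_def
    by (intro Min_eqI[symmetric]) (use fin xL in auto)
qed

text \<open>
  The whole block of \<open>z\<close> lies between \<open>x\<close> and \<open>s\<close>, because \<open>x\<close> is far from \<open>z\<close>, and \<open>s\<close> is far from \<open>z\<close>
  or an end point.
\<close>

lemma blockmax_at_saddle:
  assumes x: "x \<in> M" and s: "s \<in> M \<union> {-1, 1}" "s \<noteq> x"
    and z: "z \<in> \<Lambda>" "z \<in> {min x s..max x s}" "\<gamma> z = seg_max \<gamma> x s"
  shows "\<gamma> z = blockmax (\<beta> z)"
proof -
  have L: "x \<in> \<Lambda>" "s \<in> \<Lambda>" using assms M_sub \<Lambda> by auto
  have "\<gamma> t \<le> \<gamma> z" if t: "t \<in> \<Lambda>" "\<beta> t = \<beta> z" for t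
  proof -
    have fx: "far z x" using far_saddle[OF x s z x] .
    have ne: "z \<noteq> x" "t \<noteq> x" using fx t by (auto simp: far_def)
    have tx: "(t \<le> x) = (z \<le> x)" using same_block_seg[OF fx t] .
    have "t \<in> {min x s..max x s}"
    proof (cases "s \<in> M")
      case True
      then have fs: "far z s" using far_saddle[OF x s z] by simp
      then have "(t \<le> s) = (z \<le> s)" "t \<noteq> s" "z \<noteq> s" using same_block_seg[OF fs t] t by (auto simp: far_def)
      then show ?thesis using tx ne z(2) by (auto simp: min_def max_def split: if_splits)
    next
      case False
      then have "s = 1 \<or> s = -1" using s by auto
      then show ?thesis using tx ne z(2) t(1) \<Lambda>(1) M_interior[OF x] by (auto simp: min_def max_def)
    qed
    then show ?thesis unfolding z(3) by (intro seg_max_ge cont_seg L)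
  qed
  then show ?thesis unfolding blockmax_def
    by (intro Max_eqI[symmetric]) (use fin z(1) in auto)
qed

lemma depth_blocks:
  assumes x: "x \<in> M" and S: "S \<subseteq> M \<union> {-1, 1}" "S \<noteq> {}" "x \<notin> S"
  obtains z where "z \<in> \<Lambda>" "depth \<gamma> x S = blockmax (\<beta> z) - blockmin (\<beta> x)" "h \<le> depth \<gamma> x S"
    "\<And>y. y \<in> M \<Longrightarrow> far z y"
proof -
  have "finite S" using S(1) finite_subset[OF M_sub fin] by (auto intro: finite_subset)
  then have "Min (seg_max \<gamma> x ` S) \<in> seg_max \<gamma> x ` S" using S(2) by (intro Min_in) auto
  then obtain s where s: "s \<in> S" "Min (seg_max \<gamma> x ` S) = seg_max \<gamma> x s" by auto
  have s': "s \<in> M \<union> {-1, 1}" "s \<noteq> x" using s S by auto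
  have L: "x \<in> \<Lambda>" "s \<in> \<Lambda>" using x s' M_sub \<Lambda> by auto
  obtain z where z: "z \<in> \<Lambda>" "z \<in> {min x s..max x s}" "\<gamma> z = seg_max \<gamma> x s"
    using attained[OF L] by auto
  show ?thesis
  proof
    show "depth \<gamma> x S = blockmax (\<beta> z) - blockmin (\<beta> x)"
      unfolding depth_def s(2) z(3)[symmetric]
      using blockmax_at_saddle[OF x s' z] blockmin_at_minimum[OF x] by simp
    show "h \<le> depth \<gamma> x S" unfolding depth_def s(2) using seg_max_ge_minimum[OF x s'] by simp
    show "far z y" if "y \<in> M" for y by (rule far_saddle[OF x s' z that])
  qed (fact z(1))
qed

text \<open>
  Different representatives lie in different blocks.
\<close>

lemma card_minima_le: "card M \<le> card (\<beta> ` \<Lambda>)"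
proof -
  have "inj_on \<beta> M"
    using far_minima by (intro inj_onI) (force simp: far_def)
  then have "card M = card (\<beta> ` M)" by (simp add: card_image)
  also have "\<dots> \<le> card (\<beta> ` \<Lambda>)" using M_sub fin by (intro card_mono) auto
  finally show "card M \<le> card (\<beta> ` \<Lambda>)" .
qed

text \<open>
  In \<open>tie_gap\<close> the blocks \<open>i\<close> and \<open>k\<close> of the two saddles may coincide or be adjacent, but \<open>j\<close> and \<open>l\<close>,
  the blocks of the minima, are apart from each other and from the saddles.
\<close>

theorem good_path_if_blocks_separated:
  fixes \<delta> :: real
  assumes \<delta>: "\<delta> \<ge> 0" and depth_gap: "\<And>i j. i \<in> \<beta> ` \<Lambda> \<Longrightarrow> j \<in> \<beta> ` \<Lambda> \<Longrightarrow> 2 \<le> \<bar>i - j\<bar> \<Longrightarrow>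
      \<delta> \<le> \<bar>blockmax i - blockmin j - h\<bar>"
    and tie_gap: "\<And>i j k l. {i, j, k, l} \<subseteq> \<beta> ` \<Lambda> \<Longrightarrow> 2 \<le> \<bar>j - l\<bar> \<Longrightarrow> 2 \<le> \<bar>i - j\<bar> \<Longrightarrow> 2 \<le> \<bar>i - l\<bar> \<Longrightarrow>
      2 \<le> \<bar>k - j\<bar> \<Longrightarrow> 2 \<le> \<bar>k - l\<bar> \<Longrightarrow>
      \<delta> \<le> \<bar>(blockmax i - blockmin j) - (blockmax k - blockmin l)\<bar>"
  shows "\<gamma> \<in> good_paths h \<delta>"
proof -
  have finM: "finite M" by (rule finite_subset[OF M_sub fin])
  have 1: "h + \<delta> \<le> depth \<gamma> x ((M \<union> {-1, 1}) - {x})" if x: "x \<in> M" for x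
  proof -
    have "1 \<in> (M \<union> {-1, 1}) - {x}" using M_interior[OF x] by auto
    then have "(M \<union> {-1, 1}) - {x} \<noteq> {}" by blast
    then obtain z where z: "z \<in> \<Lambda>"
        "depth \<gamma> x ((M \<union> {-1, 1}) - {x}) = blockmax (\<beta> z) - blockmin (\<beta> x)"
        "h \<le> depth \<gamma> x ((M \<union> {-1, 1}) - {x})" "far z x"
      using depth_blocks[OF x, of "(M \<union> {-1, 1}) - {x}"] x by auto
    have "\<delta> \<le> \<bar>blockmax (\<beta> z) - blockmin (\<beta> x) - h\<bar>"
      using z x M_sub by (intro depth_gap) (auto simp: far_def)
    with z show ?thesis by simp
  qed
  have 2: "\<delta> \<le> \<bar>depth \<gamma> x (S \<union> {-1, 1}) - depth \<gamma> y (S \<union> {-1, 1})\<bar>"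
    if S: "S \<subseteq> M" and x: "x \<in> M - S" and y: "y \<in> M - S" and ne: "x \<noteq> y" for S x y
  proof -
    have *: "S \<union> {-1, 1} \<subseteq> M \<union> {-1, 1}" "S \<union> {-1, 1} \<noteq> {}" "x \<notin> S \<union> {-1, 1}" "y \<notin> S \<union> {-1, 1}"
      using S x y M_interior by force+
    obtain z where z: "z \<in> \<Lambda>" "depth \<gamma> x (S \<union> {-1, 1}) = blockmax (\<beta> z) - blockmin (\<beta> x)"
      "\<And>y. y \<in> M \<Longrightarrow> far z y" using depth_blocks[OF _ *(1,2,3)] x by blast
    obtain z' where z': "z' \<in> \<Lambda>" "depth \<gamma> y (S \<union> {-1, 1}) = blockmax (\<beta> z') - blockmin (\<beta> y)"
      "\<And>y. y \<in> M \<Longrightarrow> far z' y" using depth_blocks[OF _ *(1,2,4)] y by blast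
    show ?thesis unfolding z(2) z'(2)
    proof (rule tie_gap)
      show "{\<beta> z, \<beta> x, \<beta> z', \<beta> y} \<subseteq> \<beta> ` \<Lambda>" using x y z z' M_sub by auto
    qed (use x y ne z(3) z'(3) far_minima[of x y] in \<open>auto simp: far_def\<close>)
  qed
  obtain x where x: "bij_betw x {1..card M} M"
     "\<forall>k j. 1 \<le> k \<longrightarrow> k < j \<longrightarrow> j \<le> card M \<longrightarrow>
     depth \<gamma> (x j) (x ` {1..k - 1} \<union> {-1, 1}) + \<delta> \<le> depth \<gamma> (x k) (x ` {1..k - 1} \<union> {-1, 1})"
    using greedy_labeling[OF finM, of \<delta> "\<lambda>S x. depth \<gamma> x (S \<union> {-1, 1})"] 2 by blast
  show ?thesis
    unfolding good_paths_iff[OF cont h finM] using M_ne 1 x by blast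
qed

end

section \<open>Measurability of the set of good samples\<close>

lemma seg_max_interp:
  assumes N: "N > 0" and ij: "i \<le> j" "- int N \<le> i" "j \<le> int N"
  shows "seg_max (interp N v) (of_int i / real N) (of_int j / real N) = Max (v ` {i..j})"
proof -
  obtain k where k: "k \<in> {i..j}" "seg_max (interp N v) (of_int i / real N) (of_int j / real N) = v k"
    using seg_max_interp_attained[OF N ij] by blast
  have "v l \<le> v k" if l: "l \<in> {i..j}" for l
  proof -
    have "continuous_on {min (of_int i / real N) (of_int j / real N)..max (of_int i / real N) (of_int j / real N)} (interp N v)"
      by (rule continuous_on_segment[OF continuous_on_interp[OF N]])
        (use N ij in \<open>auto simp: divide_le_eq le_divide_eq\<close>)
    then have "interp N v (of_int l / real N) \<le> v k"
      unfolding k(2)[symmetric] by (rule seg_max_ge) (use l N in \<open>auto simp: min_def max_def divide_right_mono\<close>)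
    then show ?thesis using N by simp
  qed
  then show ?thesis unfolding k(2) by (intro Max_eqI[symmetric]) (use k in auto)
qed

context
  fixes M :: "'a measure" and v :: "int \<Rightarrow> 'a \<Rightarrow> real" and N :: nat and h :: real
  assumes v [measurable]: "\<And>k. v k \<in> borel_measurable M" and N: "N > 0" and h: "h > 0"
begin

abbreviation (input) "lattice_points \<equiv> (\<lambda>k::int. of_int k / real N) ` {- int N..int N}"
abbreviation (input) "sample_path w \<equiv> interp N (\<lambda>k. v k w)"

lemma pred_h_minima [measurable]: "Measurable.pred M (\<lambda>w. of_int k / real N \<in> h_minima h (sample_path w))"
  unfolding h_minima_lattice_iff[OF N h] by measurable

lemma pred_M_minus: "Measurable.pred M (\<lambda>w. of_int k / real N \<in> M_minus h (sample_path w))"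
  unfolding M_minus_lattice_iff[OF N h] by measurable

lemma pred_M_minus_eq:
  assumes F: "F \<subseteq> lattice_points"
  shows "Measurable.pred M (\<lambda>w. M_minus h (sample_path w) = F)"
proof -
  have "M_minus h (sample_path w) = F \<longleftrightarrow>
      (\<forall>k\<in>{- int N..int N}. of_int k / real N \<in> M_minus h (sample_path w) \<longleftrightarrow> of_int k / real N \<in> F)" for w
    using M_minus_interp_subset[OF N h, of "\<lambda>k. v k w"] F by blast
  moreover have "Measurable.pred M (\<lambda>w. \<forall>k\<in>{- int N..int N}. of_int k / real N \<in> M_minus h (sample_path w) \<longleftrightarrow> of_int k / real N \<in> F)"
    by (intro pred_intros_finite pred_intros_logic pred_M_minus) auto
  ultimately show ?thesis by simp
qed

lemma measurable_seg_max:
  assumes "s \<in> lattice_points" "t \<in> lattice_points"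
  shows "(\<lambda>w. seg_max (sample_path w) s t) \<in> borel_measurable M"
proof -
  have *: "(\<lambda>w. seg_max (sample_path w) (of_int i / real N) (of_int j / real N)) \<in> borel_measurable M"
    if "i \<le> j" "- int N \<le> i" "j \<le> int N" for i j
    unfolding seg_max_interp[OF N that] using that by (intro borel_measurable_Max) auto
  obtain i j where "s = of_int i / real N" "t = of_int j / real N" "i \<in> {- int N..int N}" "j \<in> {- int N..int N}"
    using assms by blast
  then show ?thesis using *[of i j] *[of j i] seg_max_commute[of _ s t] by (cases "i \<le> j") auto
qed

lemma measurable_path:
  assumes "s \<in> lattice_points" shows "(\<lambda>w. sample_path w s) \<in> borel_measurable M"
  using assms N by auto

lemma measurable_depth:
  assumes "x \<in> lattice_points" "S \<subseteq> lattice_points" "S \<noteq> {}"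
  shows "(\<lambda>w. depth (sample_path w) x S) \<in> borel_measurable M"
proof -
  have "finite S" using assms(2) by (rule finite_subset) auto
  then show ?thesis unfolding depth_def
    by (intro borel_measurable_diff measurable_path borel_measurable_Min measurable_seg_max)
      (use assms in auto)
qed

text \<open>
  For each of the finitely many sets \<open>F\<close> of lattice points, the event that \<open>F\<close> is the set of
  representatives is measurable, and on it the conditions are inequalities between depths that
  refer to fixed points. The labelings are restricted to \<open>{1..card F}\<close> to be finite in number.
\<close>

lemma sets_good_path:
  "{w \<in> space M. sample_path w \<in> good_paths h \<delta> \<and> card (M_minus h (sample_path w)) \<le> Q} \<in> sets M"
proof -
  define gap where "gap w x j k \<longleftrightarrow> depth (sample_path w) (x j) (x ` {1..k - 1} \<union> {-1, 1}) + \<delta>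
     \<le> depth (sample_path w) (x k) (x ` {1..k - 1} \<union> {-1, 1})" for w and x :: "nat \<Rightarrow> real" and j k
  define labels where "labels F = {x \<in> PiE {1..card F} (\<lambda>_. F). bij_betw x {1..card F} F}" for F :: "real set"
  define good where "good F w \<longleftrightarrow> M_minus h (sample_path w) = F \<and>
      (\<forall>x\<in>F. h + \<delta> \<le> depth (sample_path w) x ((F \<union> {-1, 1}) - {x})) \<and>
      (\<exists>x\<in>labels F. \<forall>j\<in>{1..card F}. \<forall>k\<in>{1..<j}. gap w x j k)" for F w
  have ends: "{-1, 1} \<subseteq> lattice_points"
    using N by (auto intro: image_eqI[of _ _ "- int N"] image_eqI[of _ _ "int N"])
  have "Measurable.pred M (good F)" if F: "F \<subseteq> lattice_points" for F
  proof -
    have finF: "finite F" using F by (rule finite_subset) auto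
    have "finite (labels F)" unfolding labels_def using finF by (intro finite_Collect_conjI disjI1) (simp add: finite_PiE)
    moreover have "Measurable.pred M (\<lambda>w. gap w x j k)"
      if "x \<in> labels F" "j \<in> {1..card F}" "k \<in> {1..<j}" for x j k
    proof -
      have x: "x i \<in> lattice_points" if "i \<in> {1..card F}" for i
        using \<open>x \<in> labels F\<close> that F by (auto simp: labels_def)
      then have sub: "x ` {1..k - 1} \<union> {-1, 1} \<subseteq> lattice_points" using ends that by auto
      have meas: "(\<lambda>w. depth (sample_path w) (x i) (x ` {1..k - 1} \<union> {-1, 1})) \<in> borel_measurable M"
        if "i \<in> {1..card F}" for i
        by (intro measurable_depth sub x that) auto
      have [measurable]: "(\<lambda>w. depth (sample_path w) (x j) (x ` {1..k - 1} \<union> {-1, 1})) \<in> borel_measurable M"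
        "(\<lambda>w. depth (sample_path w) (x k) (x ` {1..k - 1} \<union> {-1, 1})) \<in> borel_measurable M"
        using that by (intro meas; simp)+
      show ?thesis unfolding gap_def by measurable
    qed
    moreover have "Measurable.pred M (\<lambda>w. h + \<delta> \<le> depth (sample_path w) x ((F \<union> {-1, 1}) - {x}))" if "x \<in> F" for x
    proof -
      have "-1 \<noteq> (1::real)" by simp
      then have "(F \<union> {-1, 1}) - {x} \<noteq> {}" by blast
      then have [measurable]: "(\<lambda>w. depth (sample_path w) x ((F \<union> {-1, 1}) - {x})) \<in> borel_measurable M"
        by (intro measurable_depth) (use that F ends in auto)
      show ?thesis by measurable
    qed
    ultimately show ?thesis unfolding good_def
      by (intro pred_intros_logic pred_intros_finite pred_M_minus_eq F finF) auto
  qed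
  then have "Measurable.pred M (\<lambda>w. \<exists>F\<in>{F\<in>Pow lattice_points. F \<noteq> {} \<and> card F \<le> Q}. good F w)"
    by (intro pred_intros_finite) auto
  moreover have "sample_path w \<in> good_paths h \<delta> \<and> card (M_minus h (sample_path w)) \<le> Q \<longleftrightarrow>
      (\<exists>F\<in>{F\<in>Pow lattice_points. F \<noteq> {} \<and> card F \<le> Q}. good F w)" for w
  proof -
    define F where "F = M_minus h (sample_path w)"
    have F: "F \<subseteq> lattice_points" unfolding F_def by (rule M_minus_interp_subset[OF N h])
    have finF: "finite F" using F by (rule finite_subset) auto
    have "(\<exists>(q::nat) x. bij_betw x {1..q} F \<and> (\<forall>k j. 1 \<le> k \<longrightarrow> k < j \<longrightarrow> j \<le> q \<longrightarrow> gap w x j k)) \<longleftrightarrow>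
       (\<exists>x\<in>labels F. \<forall>j\<in>{1..card F}. \<forall>k\<in>{1..<j}. gap w x j k)" (is "?L \<longleftrightarrow> ?R")
    proof
      assume ?L
      then obtain q x where x: "bij_betw x {1..q} F" "\<And>k j. 1 \<le> k \<Longrightarrow> k < j \<Longrightarrow> j \<le> q \<Longrightarrow> gap w x j k"
        by blast
      have q: "q = card F" using bij_betw_same_card[OF x(1)] by simp
      define y where "y = restrict x {1..card F}"
      have "bij_betw y {1..card F} F"
        using x(1) unfolding q by (rule bij_betw_cong[THEN iffD1, rotated]) (simp add: y_def)
      then have "y \<in> labels F" by (auto simp: labels_def y_def bij_betw_def)
      moreover have "gap w y j k" if "j \<in> {1..card F}" "k \<in> {1..<j}" for j k
      proof -
        have "y ` {1..k - 1} = x ` {1..k - 1}" "y j = x j" "y k = x k"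
          using that by (auto simp: y_def)
        then show ?thesis using x(2)[of k j] that unfolding gap_def q by auto
      qed
      ultimately show ?R by blast
    next
      assume ?R
      then obtain x where x: "x \<in> labels F" "\<And>j k. j \<in> {1..card F} \<Longrightarrow> k \<in> {1..<j} \<Longrightarrow> gap w x j k" by blast
      then have "bij_betw x {1..card F} F \<and> (\<forall>k j. 1 \<le> k \<longrightarrow> k < j \<longrightarrow> j \<le> card F \<longrightarrow> gap w x j k)"
        by (auto simp: labels_def)
      then show ?L by blast
    qed
    then have "sample_path w \<in> good_paths h \<delta> \<longleftrightarrow> F \<noteq> {} \<and> good F w"
      unfolding good_paths_iff[OF continuous_on_interp[OF N] h finF[unfolded F_def]] good_def gap_def F_def[symmetric]
      by blast
    moreover have "F' = F" if "good F' w" for F' using that by (simp add: good_def F_def)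
    ultimately show ?thesis using F unfolding F_def[symmetric] by blast
  qed
  ultimately show ?thesis by (simp add: pred_def)
qed

end

section \<open>Anticoncentration from a Gaussian limit\<close>

lemma std_normal_interval_le:
  assumes "a \<le> b" shows "cdf std_normal_distribution b - cdf std_normal_distribution a \<le> b - a"
proof (cases "a = b")
  case False
  interpret real_distribution std_normal_distribution by (rule real_dist_normal_dist)
  have "std_normal_density x \<le> 1" for x
  proof -
    have "1 \<le> sqrt (2 * pi)" using pi_ge_two by (simp add: real_le_rsqrt)
    then have "1 / sqrt (2 * pi) * exp (- x\<^sup>2 / 2) \<le> 1 * 1"
      by (intro mult_mono) (auto simp: divide_le_eq_1)
    then show ?thesis by (simp add: std_normal_density_def)
  qed
  then have "emeasure std_normal_distribution {a<..b} \<le> (\<integral>\<^sup>+x. indicator {a<..b} x \<partial>lborel)"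
    by (subst emeasure_density, simp, simp, intro nn_integral_mono) (auto simp: indicator_def)
  also have "\<dots> = ennreal (b - a)" using assms by simp
  finally have "measure std_normal_distribution {a<..b} \<le> b - a"
    unfolding emeasure_eq_measure using assms by (simp add: ennreal_le_iff)
  then show ?thesis using cdf_diff_eq[of a b] False assms by simp
qed simp

lemma isCont_cdf_std_normal: "isCont (cdf std_normal_distribution) x"
proof -
  interpret real_distribution std_normal_distribution by (rule real_dist_normal_dist)
  have "measure std_normal_distribution {x} \<le> 0 + e" if "e > 0" for e
  proof -
    have "measure std_normal_distribution {x} \<le> measure std_normal_distribution {x - e<..x}"
      using that by (intro finite_measure_mono) auto
    also have "\<dots> \<le> e"
      using cdf_diff_eq[of "x - e" x] std_normal_interval_le[of "x - e" x] that by simp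
    finally show ?thesis by simp
  qed
  then have "measure std_normal_distribution {x} \<le> 0" by (rule field_le_epsilon)
  then show ?thesis unfolding isCont_cdf using measure_nonneg by (rule antisym)
qed

lemma std_normal_interval_pos:
  assumes "a < b" shows "cdf std_normal_distribution a < cdf std_normal_distribution b"
proof -
  interpret real_distribution std_normal_distribution by (rule real_dist_normal_dist)
  have "measure std_normal_distribution {a<..b} \<noteq> 0"
  proof
    assume "measure std_normal_distribution {a<..b} = 0"
    then have "{a<..b} \<in> null_sets std_normal_distribution"
      by (auto simp: null_sets_def emeasure_eq_measure)
    then have "AE x in lborel. x \<in> {a<..b} \<longrightarrow> ennreal (std_normal_density x) = 0"
      by (subst (asm) null_sets_density_iff) auto
    then have "AE x in lborel. x \<notin> {a<..b}"
      by (rule eventually_mono) (metis ennreal_eq_0_iff normal_density_pos zero_less_one not_le)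
    then have "{a<..b} \<in> null_sets lborel"
      by (subst AE_iff_null_sets) auto
    with assms show False by (simp add: null_sets_def)
  qed
  then show ?thesis using cdf_diff_eq[OF assms] measure_nonneg[of std_normal_distribution "{a<..b}"] by linarith
qed

text \<open>
  Convergence of the distribution functions at the points of a finite grid of mesh \<open>\<delta>\<close> suffices
  for uniformity in \<open>y\<close>: an interval of length \<open>2 * \<delta>\<close> either lies between two grid points at distance
  \<open>4 * \<delta>\<close>, where the normal distribution has mass at most \<open>4 * \<delta>\<close>, or in one of the two tails.
\<close>

lemma normal_limit_anticoncentration:
  assumes real: "\<And>n. real_distribution (\<mu> n)"
    and conv: "weak_conv_m \<mu> std_normal_distribution" and \<epsilon>: "\<epsilon> > 0"
  shows "\<exists>\<delta>>0. \<forall>\<^sub>F n in sequentially. \<forall>y. measure (\<mu> n) {y - \<delta>..y + \<delta>} \<le> \<epsilon>"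
proof -
  let ?F = "cdf std_normal_distribution"
  interpret N: real_distribution std_normal_distribution by (rule real_dist_normal_dist)
  \<comment> \<open>In each case below the bound obtained is \<open>6 * \<delta>\<close>.\<close>
  define \<delta> where "\<delta> = \<epsilon> / 8"
  have \<delta>: "\<delta> > 0" using \<epsilon> by (simp add: \<delta>_def)
  have lip: "?F ((i + 4) * \<delta>) \<le> ?F (i * \<delta>) + 4 * \<delta>" for i :: real
    using std_normal_interval_le[of "i * \<delta>" "(i + 4) * \<delta>"] \<delta> by (simp add: algebra_simps)
  obtain R where R: "?F x < \<delta>" if "x \<le> R" for x
    using order_tendstoD(2)[OF N.cdf_lim_at_bot \<delta>] by (auto simp: eventually_at_bot_linorder)
  obtain R' where R': "1 - \<delta> < ?F x" if "x \<ge> R'" for x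
    using order_tendstoD(1)[OF N.cdf_lim_at_top_prob, of "1 - \<delta>"] \<delta> by (auto simp: eventually_at_top_linorder)
  obtain m :: nat where m: "max \<bar>R\<bar> \<bar>R'\<bar> / \<delta> < m" using reals_Archimedean2 by blast
  then have m': "\<bar>R\<bar> \<le> m * \<delta>" "\<bar>R'\<bar> \<le> m * \<delta>" using \<delta> by (auto simp: field_simps max_def split: if_splits)
  then have "- (m * \<delta>) \<le> R" "R' \<le> m * \<delta>" by auto
  then have lo: "?F (- real m * \<delta>) < \<delta>" and hi: "1 - \<delta> < ?F (real m * \<delta>)"
    using R R' by auto
  have "\<forall>\<^sub>F n in sequentially. \<forall>i\<in>{- int m - 4..int m + 4}. \<bar>cdf (\<mu> n) (i * \<delta>) - ?F (i * \<delta>)\<bar> < \<delta>"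
  proof (intro eventually_ball_finite ballI)
    fix i
    have "(\<lambda>n. cdf (\<mu> n) (i * \<delta>)) \<longlonglongrightarrow> ?F (i * \<delta>)"
      using conv isCont_cdf_std_normal unfolding weak_conv_m_def weak_conv_def by blast
    from tendstoD[OF this \<delta>] show "\<forall>\<^sub>F n in sequentially. \<bar>cdf (\<mu> n) (i * \<delta>) - ?F (i * \<delta>)\<bar> < \<delta>"
      by (simp add: dist_real_def)
  qed auto
  then have "\<forall>\<^sub>F n in sequentially. \<forall>y. measure (\<mu> n) {y - \<delta>..y + \<delta>} \<le> \<epsilon>"
  proof (rule eventually_mono, intro allI)
    fix n y assume close: "\<forall>i\<in>{- int m - 4..int m + 4}. \<bar>cdf (\<mu> n) (i * \<delta>) - ?F (i * \<delta>)\<bar> < \<delta>"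
    interpret \<mu>: real_distribution "\<mu> n" by (rule real)
    define i where "i = \<lfloor>y / \<delta>\<rfloor>"
    have "of_int i \<le> y / \<delta>" "y / \<delta> < of_int i + 1" unfolding i_def by linarith+
    then have i: "of_int i * \<delta> \<le> y" "y < (of_int i + 1) * \<delta>" using \<delta> by (simp_all add: field_simps)
    then have y: "of_int (i - 2) * \<delta> < y - \<delta>" "y + \<delta> \<le> of_int (i + 2) * \<delta>"
      using \<delta> by (auto simp: algebra_simps)
    consider (mid) "- int m \<le> i - 2" "i + 2 \<le> int m" | (low) "i - 2 < - int m" | (high) "- int m \<le> i - 2" "int m < i + 2" by linarith
    then show "measure (\<mu> n) {y - \<delta>..y + \<delta>} \<le> \<epsilon>"
    proof cases
      case mid
      have "measure (\<mu> n) {y - \<delta>..y + \<delta>} \<le> measure (\<mu> n) {of_int (i - 2) * \<delta><..of_int (i + 2) * \<delta>}"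
        using y by (intro \<mu>.finite_measure_mono) auto
      also have "\<dots> = cdf (\<mu> n) (of_int (i + 2) * \<delta>) - cdf (\<mu> n) (of_int (i - 2) * \<delta>)"
        using \<delta> by (intro \<mu>.cdf_diff_eq[symmetric]) simp
      also have "\<dots> \<le> (?F (of_int (i + 2) * \<delta>) + \<delta>) - (?F (of_int (i - 2) * \<delta>) - \<delta>)"
        using bspec[OF close, of "i + 2"] bspec[OF close, of "i - 2"] mid by auto
      also have "\<dots> \<le> 6 * \<delta>" using lip[of "of_int (i - 2)"] by (simp add: algebra_simps)
      finally show ?thesis using \<epsilon> by (simp add: \<delta>_def)
    next
      case low
      then have "of_int (i + 2) \<le> (- real m + 4)" by linarith
      then have "y + \<delta> \<le> (- real m + 4) * \<delta>" using y(2) \<delta> by (meson mult_right_mono order.trans less_imp_le)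
      then have "measure (\<mu> n) {y - \<delta>..y + \<delta>} \<le> cdf (\<mu> n) (of_int (- int m + 4) * \<delta>)"
        unfolding cdf_def by (intro \<mu>.finite_measure_mono) auto
      also have "\<dots> \<le> ?F (of_int (- int m + 4) * \<delta>) + \<delta>"
        using bspec[OF close, of "- int m + 4"] by auto
      also have "\<dots> \<le> 6 * \<delta>" using lip[of "- real m"] lo by simp
      finally show ?thesis using \<epsilon> by (simp add: \<delta>_def)
    next
      case high
      then have "real m - 4 \<le> of_int (i - 2)" by linarith
      then have "(real m - 4) * \<delta> < y - \<delta>" using y(1) \<delta> by (meson mult_right_mono le_less_trans less_imp_le)
      then have "measure (\<mu> n) {y - \<delta>..y + \<delta>} \<le> measure (\<mu> n) (space (\<mu> n) - {..of_int (int m - 4) * \<delta>})"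
        by (intro \<mu>.finite_measure_mono) auto
      also have "\<dots> = 1 - cdf (\<mu> n) (of_int (int m - 4) * \<delta>)"
        unfolding cdf_def by (intro \<mu>.prob_compl) auto
      also have "\<dots> \<le> 1 - ?F (of_int (int m - 4) * \<delta>) + \<delta>"
        using bspec[OF close, of "int m - 4"] by auto
      also have "\<dots> \<le> 6 * \<delta>" using lip[of "real m - 4"] hi by (simp add: algebra_simps)
      finally show ?thesis using \<epsilon> by (simp add: \<delta>_def)
    qed
  qed
  with \<delta> show ?thesis by blast
qed

text \<open>
  The bound for \<open>U\<close> holds given the value of \<open>Y\<close>, by Fubini's theorem.
\<close>

lemma (in prob_space) indep_shift_anticoncentration:
  assumes indep: "indep_var borel Y borel U"
    and U: "\<And>y. prob {w \<in> space M. \<bar>U w - y\<bar> \<le> \<delta>} \<le> \<epsilon>"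
  shows "prob {w \<in> space M. \<bar>U w + (Y w :: real)\<bar> \<le> \<delta>} \<le> \<epsilon>"
proof -
  have rv [measurable]: "random_variable borel Y" "random_variable borel U"
    using indep by (auto dest: indep_var_rv1 indep_var_rv2)
  interpret U: prob_space "distr M borel U" by (rule prob_space_distr) simp
  interpret Y: prob_space "distr M borel Y" by (rule prob_space_distr) simp
  have \<epsilon>: "\<epsilon> \<ge> 0" using U[of 0] measure_nonneg by (rule order_trans[rotated])
  define B where "B = {p :: real \<times> real. \<bar>snd p + fst p\<bar> \<le> \<delta>}"
  have B [measurable]: "B \<in> sets (borel \<Otimes>\<^sub>M borel)"
  proof -
    have eq: "B = {p \<in> space (borel \<Otimes>\<^sub>M borel). \<bar>snd p + fst p\<bar> \<le> \<delta>}"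
      by (auto simp: B_def space_pair_measure)
    show ?thesis unfolding eq by measurable
  qed
  have vimage: "(\<lambda>w. (Y w, U w)) -` B \<inter> space M = {w \<in> space M. \<bar>U w + Y w\<bar> \<le> \<delta>}"
    by (auto simp: B_def)
  have "emeasure M {w \<in> space M. \<bar>U w + Y w\<bar> \<le> \<delta>}
      = emeasure (distr M (borel \<Otimes>\<^sub>M borel) (\<lambda>w. (Y w, U w))) B"
    by (subst emeasure_distr) (simp_all add: vimage)
  also have "\<dots> = emeasure (distr M borel Y \<Otimes>\<^sub>M distr M borel U) B"
    using indep unfolding indep_var_distribution_eq by simp
  also have "\<dots> = (\<integral>\<^sup>+y. emeasure (distr M borel U) (Pair y -` B) \<partial>distr M borel Y)"
    by (rule U.emeasure_pair_measure_alt) simp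
  also have "\<dots> \<le> (\<integral>\<^sup>+y. ennreal \<epsilon> \<partial>distr M borel Y)"
  proof (rule nn_integral_mono)
    fix y
    have "Pair y -` B = {u. \<bar>u - (- y)\<bar> \<le> \<delta>}" by (auto simp: B_def)
    then have "emeasure (distr M borel U) (Pair y -` B) = emeasure M {w \<in> space M. \<bar>U w - (- y)\<bar> \<le> \<delta>}"
      by (subst emeasure_distr) (auto intro!: arg_cong[where f = "emeasure M"])
    also have "\<dots> \<le> ennreal \<epsilon>" using U[of "- y"] \<epsilon> by (simp add: emeasure_eq_measure ennreal_le_iff)
    finally show "emeasure (distr M borel U) (Pair y -` B) \<le> ennreal \<epsilon>" .
  qed
  also have "\<dots> = ennreal \<epsilon>" using Y.emeasure_space_1 by simp
  finally show ?thesis using \<epsilon> by (simp add: emeasure_eq_measure ennreal_le_iff)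
qed

section \<open>Random walks with bounded centered increments\<close>

definition walk :: "(int \<Rightarrow> real) \<Rightarrow> int \<Rightarrow> real" where
  "walk x k = (if 0 \<le> k then (\<Sum>i=1..k. x i) else - (\<Sum>i=k+1..0. x i))"

definition incr :: "(int \<Rightarrow> real) \<Rightarrow> int \<Rightarrow> int \<Rightarrow> real" where
  "incr x a b = (\<Sum>i\<in>{a<..b}. x i)"

text \<open>
  Erasing the increments outside of \<open>I\<close>. Unlike restrictions to \<open>I\<close>, masked sequences for
  different \<open>I\<close> live in the same product space, so that the same functionals apply to them.
\<close>

definition mask :: "int set \<Rightarrow> (int \<Rightarrow> real) \<Rightarrow> int \<Rightarrow> real" where
  "mask I x i = (if i \<in> I then x i else 0)"

lemma walk_step: "walk x (k + 1) = walk x k + x (k + 1)"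
proof -
  consider "0 \<le> k" | "k = -1" | "k < -1" by linarith
  then show ?thesis
  proof cases
    case 1
    then have "{1..k + 1} = insert (k + 1) {1..k}" by auto
    with 1 show ?thesis by (simp add: walk_def)
  next
    case 2
    then show ?thesis by (simp add: walk_def)
  next
    case 3
    then have "{k + 1..0} = insert (k + 1) {k + 1 + 1..0}" by auto
    with 3 show ?thesis by (simp add: walk_def)
  qed
qed

lemma incr_refl [simp]: "incr x a a = 0" by (simp add: incr_def)

lemma walk_diff: "a \<le> b \<Longrightarrow> walk x b - walk x a = incr x a b"
proof (induction b rule: int_ge_induct)
  case (step b)
  then have "{a<..b + 1} = insert (b + 1) {a<..b}" by auto
  with step show ?case by (simp add: walk_step incr_def)
qed simp

lemma incr_split: "a \<le> b \<Longrightarrow> b \<le> c \<Longrightarrow> incr x a c = incr x a b + incr x b c"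
  using walk_diff[of a b x] walk_diff[of b c x] walk_diff[of a c x] by linarith

lemma incr_mask: "{a<..b} \<subseteq> I \<Longrightarrow> incr (mask I x) a b = incr x a b"
  unfolding incr_def by (intro sum.cong) (auto simp: mask_def)

lemma incr_mask_Compl: "{a<..b} \<inter> I = {} \<Longrightarrow> incr (mask (- I) x) a b = incr x a b"
  by (rule incr_mask) auto

lemma incr_nat_index: "incr x a (a + int n) = (\<Sum>i<n. x (a + 1 + int i))"
proof -
  have "{a<..a + int n} = (\<lambda>i. a + 1 + int i) ` {..<n}"
  proof (intro equalityI subsetI)
    fix k assume "k \<in> {a<..a + int n}"
    then show "k \<in> (\<lambda>i. a + 1 + int i) ` {..<n}"
      by (intro image_eqI[of _ _ "nat (k - a - 1)"]) auto
  qed auto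
  then show ?thesis unfolding incr_def by (simp add: sum.reindex inj_on_def)
qed

abbreviation "seqs \<equiv> PiM (UNIV :: int set) (\<lambda>_. borel :: real measure)"

lemma measurable_incr [measurable]: "(\<lambda>x. incr x a b) \<in> borel_measurable seqs"
  unfolding incr_def by measurable

lemma measurable_walk [measurable]: "(\<lambda>x. walk x k) \<in> borel_measurable seqs"
  unfolding walk_def by measurable

locale bounded_increments = prob_space +
  fixes X :: "int \<Rightarrow> 'a \<Rightarrow> real" and B \<sigma> :: real
  assumes indep: "indep_vars (\<lambda>_. borel) X UNIV"
    and ident: "\<And>i. distr M borel (X i) = distr M borel (X 0)"
    and bounded: "\<And>i. AE w in M. \<bar>X i w\<bar> \<le> B"
    and mean_0: "expectation (X 0) = 0"
    and variance_0: "expectation (\<lambda>w. (X 0 w)\<^sup>2) = \<sigma>\<^sup>2"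
    and B_pos: "B > 0" and \<sigma>_pos: "\<sigma> > 0"
begin

abbreviation seq :: "'a \<Rightarrow> int \<Rightarrow> real" where "seq w \<equiv> (\<lambda>i. X i w)"

lemma X_measurable [measurable]: "X i \<in> borel_measurable M"
  using indep unfolding indep_vars_def2 by blast

lemma seq_measurable [measurable]: "seq \<in> measurable M seqs"
  by (rule measurable_PiM_single') auto

lemma mean: "expectation (X i) = 0"
proof -
  have "expectation (X i) = (\<integral>x. x \<partial>distr M borel (X i))"
    by (subst integral_distr) auto
  also have "\<dots> = expectation (X 0)" unfolding ident[of i] by (subst integral_distr) auto
  finally show ?thesis using mean_0 by simp
qed

lemma variance_X: "variance (X i) = \<sigma>\<^sup>2"
proof -
  have "expectation (\<lambda>w. (X i w)\<^sup>2) = (\<integral>x. x\<^sup>2 \<partial>distr M borel (X i))"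
    by (subst integral_distr) auto
  also have "\<dots> = expectation (\<lambda>w. (X 0 w)\<^sup>2)" unfolding ident[of i] by (subst integral_distr) auto
  finally show ?thesis using variance_0 mean by simp
qed

lemma indep_masks:
  assumes "I \<inter> J = {}"
  shows "indep_var seqs (\<lambda>w. mask I (seq w)) seqs (\<lambda>w. mask J (seq w))"
proof -
  have m: "mask K \<in> measurable (PiM K (\<lambda>_. borel)) seqs" for K
  proof (rule measurable_PiM_single')
    show "(\<lambda>x. mask K x i) \<in> borel_measurable (PiM K (\<lambda>_. borel))" for i
      by (cases "i \<in> K") (simp_all add: mask_def)
  qed simp
  have eq: "mask K \<circ> (\<lambda>w. restrict (\<lambda>i. X i w) K) = (\<lambda>w. mask K (seq w))" for K
    by (auto simp: fun_eq_iff mask_def)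
  show ?thesis
    using indep_var_compose[OF indep_var_restrict[OF indep assms] m m] unfolding eq by simp
qed

lemma indep_masked:
  assumes "I \<inter> J = {}" "f \<in> measurable seqs N1" "g \<in> measurable seqs N2"
  shows "indep_var N1 (\<lambda>w. f (mask I (seq w))) N2 (\<lambda>w. g (mask J (seq w)))"
  using indep_var_compose[OF indep_masks[OF assms(1)] assms(2,3)] by (simp add: comp_def)

lemma prob_masked_conj:
  assumes IJ: "I \<inter> J = {}" and P: "Measurable.pred seqs P" and Q: "Measurable.pred seqs Q"
  shows "prob {w \<in> space M. P (mask I (seq w)) \<and> Q (mask J (seq w))}
    = prob {w \<in> space M. P (mask I (seq w))} * prob {w \<in> space M. Q (mask J (seq w))}"
  using indep_varD[OF indep_masked[OF IJ P Q], of "{True}" "{True}"]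
  by (simp add: vimage_def Int_def conj_commute)

lemma indep_vars_X_from: "indep_vars (\<lambda>_. borel) (\<lambda>i. X (a + 1 + int i)) (A :: nat set)"
proof -
  have "indep_vars (\<lambda>i. PiM {a + 1 + int i} (\<lambda>_. borel)) (\<lambda>i w. restrict (\<lambda>k. X k w) {a + 1 + int i}) A"
    by (rule indep_vars_restrict[OF indep]) (auto simp: disjoint_family_on_def)
  from indep_vars_compose2[OF this, of "\<lambda>i u. u (a + 1 + int i)" "\<lambda>_. borel"]
  show ?thesis by simp
qed

text \<open>
  Both sums have the characteristic function of one increment to the power \<open>n\<close>. This makes the
  bounds from the central limit theorem uniform in the position \<open>a\<close> of a block.
\<close>

lemma distr_incr_shift:
  "distr M borel (\<lambda>w. incr (seq w) a (a + int n)) = distr M borel (\<lambda>w. incr (seq w) 0 (int n))"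
proof (rule Levy_uniqueness)
  show "real_distribution (distr M borel (\<lambda>w. incr (seq w) a (a + int n)))"
     "real_distribution (distr M borel (\<lambda>w. incr (seq w) 0 (int n)))"
    by (intro real_distribution_distr; measurable)+
  have "char (distr M borel (\<lambda>w. incr (seq w) a (a + int n))) t = char (distr M borel (X 0)) t ^ n" for a t
    unfolding incr_nat_index by (subst char_distr_sum[OF indep_vars_X_from]) (simp add: ident[of "a + 1 + int _"])
  from this[of a] this[of 0]
  show "char (distr M borel (\<lambda>w. incr (seq w) a (a + int n))) = char (distr M borel (\<lambda>w. incr (seq w) 0 (int n)))"
    by (simp add: fun_eq_iff)
qed

lemma prob_incr_shift:
  assumes "A \<in> sets borel"
  shows "prob {w \<in> space M. incr (seq w) a (a + int n) \<in> A} = prob {w \<in> space M. incr (seq w) 0 (int n) \<in> A}"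
proof -
  have "prob {w \<in> space M. incr (seq w) a (a + int n) \<in> A} = measure (distr M borel (\<lambda>w. incr (seq w) a (a + int n))) A" for a
    using assms by (subst measure_distr) (auto simp: vimage_def Int_def conj_commute)
  from this[of a] this[of 0] distr_incr_shift[of a n] show ?thesis by simp
qed

abbreviation "normalized n \<equiv> distr M borel (\<lambda>w. incr (seq w) 0 (int n) / sqrt (real n * \<sigma>\<^sup>2))"

lemma normalized_real_distribution: "real_distribution (normalized n)"
  by (intro real_distribution_distr) measurable

lemma normalized_converges: "weak_conv_m normalized std_normal_distribution"
proof -
  have "weak_conv_m (\<lambda>n. distr M borel (\<lambda>w. (\<Sum>i<n. X (0 + 1 + int i) w) / sqrt (real n * \<sigma>\<^sup>2))) std_normal_distribution"
  proof (rule central_limit_theorem_zero_mean)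
    show "indep_vars (\<lambda>_. borel) (\<lambda>i. X (0 + 1 + int i)) UNIV" by (rule indep_vars_X_from)
    show "integrable M (\<lambda>w. (X (0 + 1 + int i) w)\<^sup>2)" for i
    proof (rule integrable_const_bound)
      show "AE w in M. norm ((X (0 + 1 + int i) w)\<^sup>2) \<le> B\<^sup>2"
        using bounded[of "0 + 1 + int i"] by eventually_elim (use B_pos in \<open>simp add: abs_le_square_iff[symmetric]\<close>)
    qed measurable
    show "distr M borel (X (0 + 1 + int n)) = distr M borel (X 0)" for n by (rule ident)
  qed (use \<sigma>_pos variance_X mean in auto)
  then show ?thesis using incr_nat_index[of _ 0] by simp
qed

lemma incr_anticoncentration:
  assumes \<epsilon>: "\<epsilon> > 0"
  shows "\<exists>\<delta>>0. \<forall>\<^sub>F n in sequentially. \<forall>a y.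
    prob {w \<in> space M. \<bar>incr (seq w) a (a + int n) / sqrt n - y\<bar> \<le> \<delta>} \<le> \<epsilon>"
proof -
  obtain d where d: "d > 0" "\<forall>\<^sub>F n in sequentially. \<forall>y. measure (normalized n) {y - d..y + d} \<le> \<epsilon>"
    using normal_limit_anticoncentration[OF normalized_real_distribution normalized_converges \<epsilon>] by blast
  have "\<forall>\<^sub>F n in sequentially. \<forall>a y.
      prob {w \<in> space M. \<bar>incr (seq w) a (a + int n) / sqrt n - y\<bar> \<le> d * \<sigma>} \<le> \<epsilon>"
    using d(2) eventually_gt_at_top[of 0]
  proof (eventually_elim, intro allI)
    fix n :: nat and a y
    assume n: "n > 0" and le: "\<forall>y. measure (normalized n) {y - d..y + d} \<le> \<epsilon>"
    have "{z. \<bar>z / sqrt n - y\<bar> \<le> d * \<sigma>} \<in> sets borel" by measurable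
    from prob_incr_shift[OF this, of a n]
    have "prob {w \<in> space M. \<bar>incr (seq w) a (a + int n) / sqrt n - y\<bar> \<le> d * \<sigma>}
      = prob {w \<in> space M. \<bar>incr (seq w) 0 (int n) / sqrt n - y\<bar> \<le> d * \<sigma>}" by simp
    also have "\<dots> = measure (normalized n) {y / \<sigma> - d..y / \<sigma> + d}"
    proof (subst measure_distr)
      have sq: "sqrt (real n * \<sigma>\<^sup>2) = sqrt n * \<sigma>" using \<sigma>_pos by (simp add: real_sqrt_mult)
      have eq: "\<bar>z / sqrt n - y\<bar> \<le> d * \<sigma> \<longleftrightarrow> z / (sqrt n * \<sigma>) \<in> {y / \<sigma> - d..y / \<sigma> + d}" for z
      proof -
        have "\<bar>z / sqrt n - y\<bar> \<le> d * \<sigma> \<longleftrightarrow> \<bar>z / sqrt n - y\<bar> / \<sigma> \<le> d"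
          using \<sigma>_pos by (simp add: field_simps)
        also have "\<bar>z / sqrt n - y\<bar> / \<sigma> = \<bar>(z / sqrt n - y) / \<sigma>\<bar>" using \<sigma>_pos by simp
        also have "(z / sqrt n - y) / \<sigma> = z / (sqrt n * \<sigma>) - y / \<sigma>" by (simp add: diff_divide_distrib)
        finally show ?thesis by (auto simp: abs_le_iff)
      qed
      show "prob {w \<in> space M. \<bar>incr (seq w) 0 (int n) / sqrt (real n) - y\<bar> \<le> d * \<sigma>} =
        prob ((\<lambda>w. incr (seq w) 0 (int n) / sqrt (real n * \<sigma>\<^sup>2)) -` {y / \<sigma> - d..y / \<sigma> + d} \<inter> space M)"
        unfolding sq by (rule arg_cong[where f = prob], rule set_eqI)
          (simp only: vimage_eq Int_iff mem_Collect_eq eq conj_commute)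
    qed auto
    also have "\<dots> \<le> \<epsilon>" using le by blast
    finally show "prob {w \<in> space M. \<bar>incr (seq w) a (a + int n) / sqrt n - y\<bar> \<le> d * \<sigma>} \<le> \<epsilon>" .
  qed
  then show ?thesis using d(1) \<sigma>_pos by (intro exI[of _ "d * \<sigma>"]) auto
qed

text \<open>
  The normal distribution charges both half-lines beyond one standard deviation.
\<close>

lemma large_incr_prob:
  "\<exists>p>0. \<forall>\<^sub>F n in sequentially. \<forall>a.
     p \<le> prob {w \<in> space M. incr (seq w) a (a + int n) \<le> - (\<sigma> * sqrt n)} \<and>
     p \<le> prob {w \<in> space M. \<sigma> * sqrt n \<le> incr (seq w) a (a + int n)}"
proof -
  let ?F = "cdf std_normal_distribution"
  interpret N: real_distribution std_normal_distribution by (rule real_dist_normal_dist)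
  define p where "p = min (?F (-1)) (1 - ?F 1) / 2"
  have "0 \<le> ?F (-2)" "?F (-2) < ?F (-1)" "?F 1 < ?F 2" "?F 2 \<le> 1"
    using N.cdf_nonneg N.cdf_bounded_prob std_normal_interval_pos by auto
  then have p: "p > 0" "p < ?F (-1)" "p < 1 - ?F 1" by (auto simp: p_def min_def)
  have lim: "(\<lambda>n. cdf (normalized n) t) \<longlonglongrightarrow> ?F t" for t
    using normalized_converges isCont_cdf_std_normal unfolding weak_conv_m_def weak_conv_def by blast
  have "\<forall>\<^sub>F n in sequentially. p < cdf (normalized n) (-1)"
    by (rule order_tendstoD(1)[OF lim]) (rule p)
  moreover have "\<forall>\<^sub>F n in sequentially. cdf (normalized n) 1 < 1 - p"
    by (rule order_tendstoD(2)[OF lim]) (use p in simp)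
  ultimately have "\<forall>\<^sub>F n in sequentially. \<forall>a.
     p \<le> prob {w \<in> space M. incr (seq w) a (a + int n) \<le> - (\<sigma> * sqrt n)} \<and>
     p \<le> prob {w \<in> space M. \<sigma> * sqrt n \<le> incr (seq w) a (a + int n)}"
    using eventually_gt_at_top[of 0]
  proof (eventually_elim, intro allI)
    fix n :: nat and a assume lo: "p < cdf (normalized n) (-1)" and hi: "cdf (normalized n) 1 < 1 - p" and n: "n > 0"
    have sq: "sqrt (real n * \<sigma>\<^sup>2) = \<sigma> * sqrt n" "\<sigma> * sqrt n > 0" using \<sigma>_pos n by (simp_all add: real_sqrt_mult)
    have "prob {w \<in> space M. incr (seq w) a (a + int n) \<le> - (\<sigma> * sqrt n)}
       = prob {w \<in> space M. incr (seq w) 0 (int n) \<le> - (\<sigma> * sqrt n)}"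
      using prob_incr_shift[of "{..- (\<sigma> * sqrt n)}" a n] by simp
    also have "\<dots> = cdf (normalized n) (-1)"
      unfolding cdf_def using sq
      by (subst measure_distr) (auto intro!: arg_cong[where f = prob] simp: divide_le_eq)
    finally have 1: "p \<le> prob {w \<in> space M. incr (seq w) a (a + int n) \<le> - (\<sigma> * sqrt n)}" using lo by simp
    interpret S: real_distribution "normalized n" by (rule normalized_real_distribution)
    have "p \<le> 1 - cdf (normalized n) 1" using hi by simp
    also have "\<dots> = measure (normalized n) (space (normalized n) - {..1})"
      unfolding cdf_def by (intro S.prob_compl[symmetric]) auto
    also have "\<dots> \<le> prob {w \<in> space M. \<sigma> * sqrt n \<le> incr (seq w) 0 (int n)}"
      using sq by (subst measure_distr) (auto intro!: finite_measure_mono simp: le_divide_eq not_le less_divide_eq)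
    also have "\<dots> = prob {w \<in> space M. \<sigma> * sqrt n \<le> incr (seq w) a (a + int n)}"
      using prob_incr_shift[of "{\<sigma> * sqrt n..}" a n] by simp
    finally show "p \<le> prob {w \<in> space M. incr (seq w) a (a + int n) \<le> - (\<sigma> * sqrt n)} \<and>
     p \<le> prob {w \<in> space M. \<sigma> * sqrt n \<le> incr (seq w) a (a + int n)}" using 1 by blast
  qed
  with p(1) show ?thesis by blast
qed

lemma incr_tail:
  fixes m n :: nat
  assumes c: "c > 0" and n: "n > 0" and m: "m \<le> n"
  shows "prob {w \<in> space M. c \<le> \<bar>incr (seq w) a (a + int m)\<bar>} \<le> 2 * exp (- c\<^sup>2 / (2 * real n * B\<^sup>2))"
proof (cases "m = 0")
  case True
  then show ?thesis using c by simp
next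
  case False
  interpret H: Hoeffding_ineq M "{..<m}" "\<lambda>i. X (a + 1 + int i)" "\<lambda>_. - B" "\<lambda>_. B" 0
  proof unfold_locales
    show "indep_vars (\<lambda>_. borel) (\<lambda>i. X (a + 1 + int i)) {..<m}" by (rule indep_vars_X_from)
    show "AE w in M. X (a + 1 + int i) w \<in> {- B..B}" if "i \<in> {..<m}" for i
      using bounded by eventually_elim (auto simp: abs_le_iff)
  qed (simp_all add: mean)
  have "prob {w \<in> space M. c \<le> \<bar>incr (seq w) a (a + int m)\<bar>} \<le> 2 * exp (- 2 * c\<^sup>2 / (\<Sum>i<m. (B - - B)\<^sup>2))"
    unfolding incr_nat_index using H.Hoeffding_ineq_abs_ge[of c] c False B_pos by simp
  also have "- 2 * c\<^sup>2 / (\<Sum>i<m. (B - - B)\<^sup>2) = - (c\<^sup>2 / (2 * real m * B\<^sup>2))"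
    by (simp add: power2_eq_square)
  also have "c\<^sup>2 / (2 * real n * B\<^sup>2) \<le> c\<^sup>2 / (2 * real m * B\<^sup>2)"
    using False m B_pos by (intro divide_left_mono mult_mono) auto
  then have "2 * exp (- (c\<^sup>2 / (2 * real m * B\<^sup>2))) \<le> 2 * exp (- c\<^sup>2 / (2 * real n * B\<^sup>2))" by simp
  finally show ?thesis .
qed

text \<open>
  Ottaviani's inequality. At the first time \<open>m\<close> when the sum reaches \<open>2 * c\<close> in absolute value, the
  remaining increment is independent of the past, and with probability at least \<open>1 / 2\<close> it is less than
  \<open>c\<close> in absolute value; in that case the full sum is at least \<open>c\<close> in absolute value. If the tail bound
  is too weak to give \<open>1 / 2\<close>, the claim is trivial.
\<close>

lemma maximal_inequality:
  fixes n :: nat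
  assumes c: "c > 0" and n: "n > 0"
  shows "prob {w \<in> space M. \<exists>m\<le>n. 2 * c \<le> \<bar>incr (seq w) a (a + int m)\<bar>} \<le> 4 * exp (- c\<^sup>2 / (2 * real n * B\<^sup>2))"
proof (cases "2 * exp (- c\<^sup>2 / (2 * real n * B\<^sup>2)) \<le> 1 / 2")
  case False
  have "prob {w \<in> space M. \<exists>m\<le>n. 2 * c \<le> \<bar>incr (seq w) a (a + int m)\<bar>} \<le> 1" by simp
  with False show ?thesis by linarith
next
  case True
  define T where "T x m = incr x a (a + int m)" for x m
  define P where "P m x \<longleftrightarrow> 2 * c \<le> \<bar>T x m\<bar> \<and> (\<forall>l<m. \<bar>T x l\<bar> < 2 * c)" for m x
  define R where "R m x \<longleftrightarrow> \<bar>incr x (a + int m) (a + int n)\<bar> < c" for m x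
  have [measurable]: "Measurable.pred seqs (P m)" "Measurable.pred seqs (R m)" for m
    unfolding P_def R_def T_def by measurable
  define A where "A m = {w \<in> space M. P m (seq w)}" for m
  define C where "C m = {w \<in> space M. P m (seq w) \<and> R m (seq w)}" for m
  have sets [measurable]: "A m \<in> events" "C m \<in> events" for m unfolding A_def C_def by measurable
  have disj: "disjoint_family_on A {..n}"
    unfolding disjoint_family_on_def A_def P_def by (auto simp: not_less[symmetric]) (metis linorder_neqE_nat not_le)
  then have disjC: "disjoint_family_on C {..n}"
    unfolding disjoint_family_on_def A_def C_def by blast
  have half: "prob (A m) \<le> 2 * prob (C m)" if m: "m \<le> n" for m
  proof -
    let ?I = "{a<..a + int m}" and ?J = "{a + int m<..a + int n}"
    have P: "P m (mask ?I x) = P m x" for x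
    proof -
      have "T (mask ?I x) l = T x l" if "l \<le> m" for l
        unfolding T_def using that by (intro incr_mask) auto
      then show ?thesis unfolding P_def by auto
    qed
    have R: "R m (mask ?J x) = R m x" for x unfolding R_def by (simp add: incr_mask)
    have "prob (C m) = prob (A m) * prob {w \<in> space M. R m (seq w)}"
      unfolding A_def C_def using prob_masked_conj[of ?I ?J "P m" "R m"] by (simp add: P R)
    moreover have "1 / 2 \<le> prob {w \<in> space M. R m (seq w)}"
    proof -
      have "prob {w \<in> space M. \<not> R m (seq w)}
          = prob {w \<in> space M. c \<le> \<bar>incr (seq w) (a + int m) ((a + int m) + int (n - m))\<bar>}"
        using m by (simp add: R_def not_less)
      also have "\<dots> \<le> 2 * exp (- c\<^sup>2 / (2 * real n * B\<^sup>2))" by (rule incr_tail[OF c n]) simp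
      finally show ?thesis using True prob_neg[of "\<lambda>w. R m (seq w)"] by simp
    qed
    ultimately show ?thesis using mult_left_mono[of "1 / 2" "prob {w \<in> space M. R m (seq w)}" "prob (A m)"] by simp
  qed
  have "{w \<in> space M. \<exists>m\<le>n. 2 * c \<le> \<bar>incr (seq w) a (a + int m)\<bar>} \<subseteq> (\<Union>m\<le>n. A m)"
  proof
    fix w assume w: "w \<in> {w \<in> space M. \<exists>m\<le>n. 2 * c \<le> \<bar>incr (seq w) a (a + int m)\<bar>}"
    define m where "m = (LEAST m. 2 * c \<le> \<bar>T (seq w) m\<bar>)"
    obtain m' where m': "m' \<le> n" "2 * c \<le> \<bar>T (seq w) m'\<bar>" using w by (auto simp: T_def)
    have "2 * c \<le> \<bar>T (seq w) m\<bar>" unfolding m_def by (rule LeastI) (rule m')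
    moreover have "\<bar>T (seq w) l\<bar> < 2 * c" if "l < m" for l
      using not_less_Least[OF that[unfolded m_def]] by simp
    moreover have "m \<le> n" using Least_le[of "\<lambda>m. 2 * c \<le> \<bar>T (seq w) m\<bar>" m'] m' unfolding m_def by simp
    ultimately show "w \<in> (\<Union>m\<le>n. A m)" using w by (auto simp: A_def P_def)
  qed
  then have "prob {w \<in> space M. \<exists>m\<le>n. 2 * c \<le> \<bar>incr (seq w) a (a + int m)\<bar>} \<le> prob (\<Union>m\<le>n. A m)"
    by (intro finite_measure_mono) auto
  also have "\<dots> = (\<Sum>m\<le>n. prob (A m))" by (intro finite_measure_finite_Union disj) auto
  also have "\<dots> \<le> (\<Sum>m\<le>n. 2 * prob (C m))" by (intro sum_mono half) auto
  also have "\<dots> = 2 * prob (\<Union>m\<le>n. C m)"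
    by (subst finite_measure_finite_Union[OF _ _ disjC]) (auto simp: sum_distrib_left)
  also have "prob (\<Union>m\<le>n. C m) \<le> prob {w \<in> space M. c \<le> \<bar>incr (seq w) a (a + int n)\<bar>}"
  proof (intro finite_measure_mono subsetI)
    fix w assume "w \<in> (\<Union>m\<le>n. C m)"
    then obtain m where m: "m \<le> n" "w \<in> space M" "2 * c \<le> \<bar>T (seq w) m\<bar>"
        "\<bar>incr (seq w) (a + int m) (a + int n)\<bar> < c"
      by (auto simp: C_def P_def R_def)
    moreover have "incr (seq w) a (a + int n) = T (seq w) m + incr (seq w) (a + int m) (a + int n)"
      unfolding T_def using m by (intro incr_split) auto
    ultimately show "w \<in> {w \<in> space M. c \<le> \<bar>incr (seq w) a (a + int n)\<bar>}" by auto
  qed measurable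
  also have "\<dots> \<le> 2 * exp (- c\<^sup>2 / (2 * real n * B\<^sup>2))" by (rule incr_tail[OF c n]) simp
  finally show ?thesis by simp
qed

end

section \<open>Extrema over blocks of a walk\<close>

definition cell :: "nat \<Rightarrow> int \<Rightarrow> int \<Rightarrow> int set" where
  "cell N L j = {k \<in> {- int N..int N}. k div L = j}"

definition cell_max :: "nat \<Rightarrow> int \<Rightarrow> (int \<Rightarrow> real) \<Rightarrow> int \<Rightarrow> real" where
  "cell_max N L x j = Max ((\<lambda>k. walk x k / sqrt N) ` cell N L j)"

definition cell_min :: "nat \<Rightarrow> int \<Rightarrow> (int \<Rightarrow> real) \<Rightarrow> int \<Rightarrow> real" where
  "cell_min N L x j = Min ((\<lambda>k. walk x k / sqrt N) ` cell N L j)"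

lemma finite_cell [simp]: "finite (cell N L j)"
  by (rule finite_subset[of _ "{- int N..int N}"]) (auto simp: cell_def)

lemma measurable_cell_max [measurable]: "(\<lambda>x. cell_max N L x j) \<in> borel_measurable seqs"
  unfolding cell_max_def by (intro borel_measurable_Max) auto

lemma measurable_cell_min [measurable]: "(\<lambda>x. cell_min N L x j) \<in> borel_measurable seqs"
  unfolding cell_min_def by (intro borel_measurable_Min) auto

lemma measurable_mask [measurable]: "mask I \<in> measurable seqs seqs"
proof (rule measurable_PiM_single')
  show "(\<lambda>x. mask I x i) \<in> borel_measurable seqs" for i
    by (cases "i \<in> I") (simp_all add: mask_def)
qed simp

text \<open>
  Without the increments of block \<open>s\<close>, the walk to the left of this block changes by a constant,
  and to the right of it by the same constant and the increment over the block.
\<close>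

lemma cell_extrema_mask:
  assumes L: "L > 0"
  obtains C where
    "\<And>i. cell N L i \<noteq> {} \<Longrightarrow> i \<noteq> s \<Longrightarrow> cell_max N L x i = cell_max N L (mask (- {s * L<..s * L + L}) x) i
       + (C + of_bool (s < i) * (incr x (s * L) (s * L + L) / sqrt N))"
    "\<And>i. cell N L i \<noteq> {} \<Longrightarrow> i \<noteq> s \<Longrightarrow> cell_min N L x i = cell_min N L (mask (- {s * L<..s * L + L}) x) i
       + (C + of_bool (s < i) * (incr x (s * L) (s * L + L) / sqrt N))"
proof -
  let ?J = "{s * L<..s * L + L}"
  define x' where "x' = mask (- ?J) x"
  define C0 where "C0 = walk x (s * L) - walk x' (s * L)"
  have walk: "walk x k / sqrt N = walk x' k / sqrt N + (C0 / sqrt N + of_bool (s < i) * (incr x (s * L) (s * L + L) / sqrt N))"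
    if i: "i \<noteq> s" and k: "k \<in> cell N L i" for i k
  proof (cases "s < i")
    case True
    then have "(s + 1) * L \<le> i * L" using L by (intro mult_right_mono) auto
    moreover have "i * L \<le> k" using k L by (auto simp: cell_def) (metis minus_mod_eq_div_mult pos_mod_sign diff_ge_0_iff_ge minus_div_mult_eq_mod)
    ultimately have le: "s * L + L \<le> k" by (simp add: algebra_simps)
    have "walk x k - walk x (s * L) = incr x (s * L) (s * L + L) + incr x (s * L + L) k"
      using walk_diff[of "s * L" k x] incr_split[of "s * L" "s * L + L" k x] le L by simp
    moreover have "walk x' k - walk x' (s * L) = incr x' (s * L) (s * L + L) + incr x' (s * L + L) k"
      using walk_diff[of "s * L" k x'] incr_split[of "s * L" "s * L + L" k x'] le L by simp
    moreover have "incr x' (s * L) (s * L + L) = 0" by (simp add: incr_def x'_def mask_def)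
    moreover have "incr x' (s * L + L) k = incr x (s * L + L) k"
      unfolding x'_def by (rule incr_mask_Compl) auto
    ultimately have "walk x k = walk x' k + (C0 + incr x (s * L) (s * L + L))" by (simp add: C0_def)
    then show ?thesis using True by (simp add: add_divide_distrib)
  next
    case False
    then have "(i + 1) * L \<le> s * L" using L i by (intro mult_right_mono) auto
    moreover have "k < (i + 1) * L" using k L by (auto simp: cell_def algebra_simps) (metis add.commute mult.commute mult_div_mod_eq add_strict_left_mono pos_mod_bound)
    ultimately have le: "k \<le> s * L" by simp
    have "incr x' k (s * L) = incr x k (s * L)"
      unfolding x'_def by (rule incr_mask_Compl) auto
    then have "walk x k = walk x' k + C0"
      using walk_diff[OF le, of x] walk_diff[OF le, of x'] by (simp add: C0_def)
    then show ?thesis using False by (simp add: add_divide_distrib)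
  qed
  show ?thesis
  proof (rule that[of "C0 / sqrt N"])
    fix i assume i: "cell N L i \<noteq> {}" "i \<noteq> s"
    let ?c = "C0 / sqrt N + of_bool (s < i) * (incr x (s * L) (s * L + L) / sqrt N)"
    have im: "(\<lambda>k. walk x k / sqrt N) ` cell N L i = (\<lambda>k. walk x' k / sqrt N + ?c) ` cell N L i"
      using walk[OF i(2)] by (intro image_cong) auto
    show "cell_max N L x i = cell_max N L (mask (- ?J) x) i + ?c"
      unfolding cell_max_def im x'_def[symmetric] using i by (intro Max_add_commute) auto
    show "cell_min N L x i = cell_min N L (mask (- ?J) x) i + ?c"
      unfolding cell_min_def im x'_def[symmetric] using i by (intro Min_add_commute) auto
  qed
qed

text \<open>
  The coefficient of the increment over block \<open>s\<close> counts, with signs, the blocks among \<open>i, j, k, l\<close>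
  to the right of \<open>s\<close>. Cut off a single block on one side: \<open>j\<close> or \<open>l\<close> if one of them is outermost,
  else the leftmost of \<open>i\<close> and \<open>k\<close>. As the signs add up to 0, an odd number remains on each side.
\<close>

lemma spare_index:
  fixes i j k l :: int
  assumes "2 \<le> \<bar>j - l\<bar>" "2 \<le> \<bar>i - j\<bar>" "2 \<le> \<bar>i - l\<bar>" "2 \<le> \<bar>k - j\<bar>" "2 \<le> \<bar>k - l\<bar>"
  obtains s where "s \<noteq> i" "s \<noteq> j" "s \<noteq> k" "s \<noteq> l"
    "1 \<le> \<bar>(of_bool (s < i) - of_bool (s < j)) - (of_bool (s < k) - of_bool (s < l)) :: real\<bar>"
proof -
  let ?ok = "\<lambda>s. s \<noteq> i \<and> s \<noteq> j \<and> s \<noteq> k \<and> s \<noteq> l \<and>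
    1 \<le> \<bar>(of_bool (s < i) - of_bool (s < j)) - (of_bool (s < k) - of_bool (s < l)) :: real\<bar>"
  consider "j \<le> i" "j \<le> k" "j \<le> l" | "l \<le> i" "l \<le> j" "l \<le> k"
    | "i \<le> j" "k \<le> j" "l \<le> j" | "i \<le> l" "j \<le> l" "k \<le> l"
    | "i < j" "i < l" "j < k" "l < k" | "k < j" "k < l" "j < i" "l < i" by linarith
  then have "\<exists>s. ?ok s"
  proof cases
    case 1 then have "?ok (j + 1)" using assms by auto
    then show ?thesis ..
  next
    case 2 then have "?ok (l + 1)" using assms by auto
    then show ?thesis ..
  next
    case 3 then have "?ok (j - 1)" using assms by auto
    then show ?thesis ..
  next
    case 4 then have "?ok (l - 1)" using assms by auto
    then show ?thesis ..
  next
    case 5 then have "?ok (i + 1)" using assms by auto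
    then show ?thesis ..
  next
    case 6 then have "?ok (k + 1)" using assms by auto
    then show ?thesis ..
  qed
  with that show ?thesis by blast
qed

text \<open>
  The remainder of the division is absorbed by lengthening the blocks, so that the blocks from
  \<open>- K\<close> to \<open>K\<close> cover \<open>{- N..N}\<close>; the outermost ones need not be full.
\<close>

definition block_length :: "nat \<Rightarrow> nat \<Rightarrow> int" where
  "block_length K N = int (N div K + 1)"

lemma block_length_bounds:
  assumes K: "K > 0"
  shows "block_length K N > 0" "int N < int K * block_length K N" "real N \<le> real K * real_of_int (block_length K N)"
    "K \<le> N \<Longrightarrow> real K * real_of_int (block_length K N) \<le> 2 * real N"
proof -
  have "N < K * (N div K + 1)" using dividend_less_times_div[OF K, of N] by simp
  then have "int N < int (K * (N div K + 1))" by (simp only: of_nat_less_iff)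
  then show lt: "int N < int K * block_length K N" by (simp add: block_length_def algebra_simps)
  have "real_of_int (int N) < real_of_int (int K * block_length K N)" using lt by (simp only: of_int_less_iff)
  then show "real N \<le> real K * real_of_int (block_length K N)" by simp
  show "block_length K N > 0" by (simp add: block_length_def)
  assume "K \<le> N"
  moreover have "K * (N div K) \<le> N" by simp
  ultimately have "K * (N div K + 1) \<le> 2 * N" unfolding distrib_left by linarith
  then have "real (K * (N div K + 1)) \<le> real (2 * N)" by (simp only: of_nat_le_iff)
  then show "real K * real_of_int (block_length K N) \<le> 2 * real N" by (simp add: block_length_def algebra_simps)
qed

lemma div_block_length_range:
  assumes K: "K > 0" and k: "k \<in> {- int N..int N}"
  shows "k div block_length K N \<in> {- int K..int K}"
proof -
  let ?L = "block_length K N"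
  note L = block_length_bounds[OF K, of N]
  have "- int K * ?L \<le> k" "k \<le> int K * ?L" using k L(2) by auto
  then have "(- int K * ?L) div ?L \<le> k div ?L" "k div ?L \<le> (int K * ?L) div ?L"
    using L(1) by (intro zdiv_mono1; simp)+
  moreover have "(m * ?L) div ?L = m" for m
    by (rule nonzero_mult_div_cancel_right) (use L(1) in simp)
  ultimately have "- int K \<le> k div ?L" "k div ?L \<le> int K" by (simp_all only:)
  then show ?thesis by auto
qed

text \<open>
  The failure of the gap between the depths \<open>max i - min j\<close> and \<open>max k - min l\<close> of two minima.
\<close>

definition near_tie :: "nat \<Rightarrow> int \<Rightarrow> real \<Rightarrow> (int \<Rightarrow> real) \<Rightarrow> int \<times> int \<times> int \<times> int \<Rightarrow> bool" where
  "near_tie N L \<delta> x = (\<lambda>(i, j, k, l).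
     (\<forall>m\<in>{i, j, k, l}. cell N L m \<noteq> {}) \<and> 2 \<le> \<bar>j - l\<bar> \<and> 2 \<le> \<bar>i - j\<bar> \<and> 2 \<le> \<bar>i - l\<bar> \<and> 2 \<le> \<bar>k - j\<bar> \<and> 2 \<le> \<bar>k - l\<bar> \<and>
     \<bar>(cell_max N L x i - cell_min N L x j) - (cell_max N L x k - cell_min N L x l)\<bar> \<le> \<delta>)"

text \<open>
  The failure of the gap between the depth of a minimum and \<open>h\<close>.
\<close>

definition near_depth :: "nat \<Rightarrow> int \<Rightarrow> real \<Rightarrow> real \<Rightarrow> (int \<Rightarrow> real) \<Rightarrow> int \<times> int \<Rightarrow> bool" where
  "near_depth N L h \<delta> x = (\<lambda>(i, j). cell N L i \<noteq> {} \<and> cell N L j \<noteq> {} \<and> 2 \<le> \<bar>i - j\<bar> \<and>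
     \<bar>cell_max N L x i - cell_min N L x j - h\<bar> \<le> \<delta>)"

lemma measurable_near [measurable]:
  "Measurable.pred seqs (\<lambda>x. near_tie N L \<delta> x t)" "Measurable.pred seqs (\<lambda>x. near_depth N L h \<delta> x p)"
  unfolding near_tie_def near_depth_def by (auto simp: split_beta)

lemma (in prob_space) prob_Union_le:
  assumes A: "finite A" "A \<noteq> {}" and E: "\<And>a. a \<in> A \<Longrightarrow> E a \<in> events" "\<And>a. a \<in> A \<Longrightarrow> prob (E a) \<le> \<epsilon> / card A"
  shows "prob (\<Union>a\<in>A. E a) \<le> \<epsilon>"
proof -
  have "prob (\<Union>a\<in>A. E a) \<le> (\<Sum>a\<in>A. prob (E a))"
    using A E(1) by (intro finite_measure_subadditive_finite) auto
  also have "\<dots> \<le> (\<Sum>a\<in>A. \<epsilon> / card A)" by (intro sum_mono E)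
  also have "\<dots> = \<epsilon>" using A by simp
  finally show ?thesis .
qed

context bounded_increments
begin

text \<open>
  There are about \<open>2 * K\<close> pairs of adjacent blocks, and each of them violates the bound with
  probability exponentially small in \<open>K\<close>.
\<close>

lemma adjacent_blocks_oscillation:
  assumes h: "h > 0" and \<epsilon>: "\<epsilon> > 0"
  shows "\<exists>K>0. \<forall>\<^sub>F N in sequentially. prob {w \<in> space M. \<exists>k\<in>{- int N..int N}. \<exists>l\<in>{- int N..int N}.
     \<bar>k div block_length K N - l div block_length K N\<bar> \<le> 1 \<and>
     h \<le> \<bar>walk (seq w) k / sqrt N - walk (seq w) l / sqrt N\<bar>} \<le> \<epsilon>"
proof -
  \<comment> \<open>The rate for which \<open>maximal_inequality\<close>, with level \<open>h * sqrt N / 4\<close> and blocks of length at most \<open>2 * N / K\<close>, gives \<open>exp (- a * K)\<close>.\<close>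
  define a where "a = h\<^sup>2 / (128 * B\<^sup>2)"
  have a: "a > 0" using h B_pos by (simp add: a_def)
  obtain K :: nat where "max 1 (24 / (a\<^sup>2 * \<epsilon>)) < K" using reals_Archimedean2 by blast
  then have K: "K > 0" "24 / (a\<^sup>2 * \<epsilon>) < K" by auto
  have small: "4 * exp (- (a * K)) \<le> \<epsilon> / (2 * real K + 1)"
  proof -
    have "(a * K)\<^sup>2 / 2 \<le> exp (a * K)"
      using exp_lower_Taylor_quadratic[of "a * K"] mult_nonneg_nonneg[of a "real K"] a by linarith
    then have "exp (- (a * K)) \<le> 2 / (a * K)\<^sup>2"
      using a K by (simp add: exp_minus field_simps)
    then have "(2 * real K + 1) * (4 * exp (- (a * K))) \<le> (3 * real K) * (4 * (2 / (a * K)\<^sup>2))"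
      using K by (intro mult_mono) auto
    also have "\<dots> = 24 / (a\<^sup>2 * K)" using K by (simp add: power2_eq_square)
    also have "\<dots> \<le> \<epsilon>" using K \<epsilon> a by (simp add: field_simps)
    finally show ?thesis by (simp add: field_simps)
  qed
  have "\<forall>\<^sub>F N in sequentially. prob {w \<in> space M. \<exists>k\<in>{- int N..int N}. \<exists>l\<in>{- int N..int N}.
     \<bar>k div block_length K N - l div block_length K N\<bar> \<le> 1 \<and>
     h \<le> \<bar>walk (seq w) k / sqrt N - walk (seq w) l / sqrt N\<bar>} \<le> \<epsilon>"
    using eventually_ge_at_top[of K]
  proof eventually_elim
    fix N assume N: "K \<le> N"
    let ?L = "block_length K N"
    define n where "n = nat (2 * ?L)"
    note L = block_length_bounds[OF K(1), of N]
    have n: "int n = 2 * ?L" "n > 0" using L by (auto simp: n_def)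
    \<comment> \<open>Two points of adjacent blocks are compared with the left end of the pair of blocks, and the maximal inequality loses another factor 2.\<close>
    define c where "c = h * sqrt N / 4"
    have c: "c > 0" using h N K by (simp add: c_def)
    define E where "E j = {w \<in> space M. \<exists>m\<le>n. 2 * c \<le> \<bar>incr (seq w) (j * ?L) (j * ?L + int m)\<bar>}" for j
    have "prob (\<Union>j\<in>{- int K..int K}. E j) \<le> \<epsilon>"
    proof (rule prob_Union_le)
      fix j
      show "E j \<in> events" unfolding E_def by measurable
      have "a * K \<le> c\<^sup>2 / (2 * real n * B\<^sup>2)"
      proof -
        have rn: "real n = 2 * of_int ?L" using n(1) by (metis of_int_mult of_int_numeral of_int_of_nat_eq)
        have "K * (128 * (of_int ?L)) \<le> 256 * real N" using L(4)[OF N] by simp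
        then have "h\<^sup>2 * (K * (128 * of_int ?L)) \<le> h\<^sup>2 * (256 * real N)" by (intro mult_left_mono) auto
        then show ?thesis unfolding a_def c_def rn using B_pos L(1)
          by (simp add: power_mult_distrib power_divide field_simps)
      qed
      then have le: "4 * exp (- c\<^sup>2 / (2 * real n * B\<^sup>2)) \<le> 4 * exp (- (a * K))" by simp
      have "prob (E j) \<le> 4 * exp (- c\<^sup>2 / (2 * real n * B\<^sup>2))"
        unfolding E_def by (rule maximal_inequality[OF c n(2)])
      also note le
      also note small
      finally show "prob (E j) \<le> \<epsilon> / real (card {- int K..int K})" by simp
    qed auto
    moreover have "{w \<in> space M. \<exists>k\<in>{- int N..int N}. \<exists>l\<in>{- int N..int N}.
       \<bar>k div ?L - l div ?L\<bar> \<le> 1 \<and> h \<le> \<bar>walk (seq w) k / sqrt N - walk (seq w) l / sqrt N\<bar>}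
       \<subseteq> (\<Union>j\<in>{- int K..int K}. E j)"
    proof
      fix w assume "w \<in> {w \<in> space M. \<exists>k\<in>{- int N..int N}. \<exists>l\<in>{- int N..int N}.
       \<bar>k div ?L - l div ?L\<bar> \<le> 1 \<and> h \<le> \<bar>walk (seq w) k / sqrt N - walk (seq w) l / sqrt N\<bar>}"
      then obtain k l where w: "w \<in> space M" and kl: "k \<in> {- int N..int N}" "l \<in> {- int N..int N}"
        "\<bar>k div ?L - l div ?L\<bar> \<le> 1" "h \<le> \<bar>walk (seq w) k / sqrt N - walk (seq w) l / sqrt N\<bar>" by blast
      have big: "4 * c \<le> \<bar>walk (seq w) k - walk (seq w) l\<bar>"
      proof -
        have "sqrt N > 0" using N K by simp
        with kl(4) show ?thesis by (simp add: c_def flip: diff_divide_distrib) (simp add: field_simps)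
      qed
      define j where "j = min (k div ?L) (l div ?L)"
      have j: "j \<in> {- int K..int K}"
        using div_block_length_range[OF K(1) kl(1)] div_block_length_range[OF K(1) kl(2)] by (auto simp: j_def min_def)
      have near: "\<exists>m\<le>n. i = j * ?L + int m" if "i div ?L = j \<or> i div ?L = j + 1" for i
      proof -
        have "i = (i div ?L) * ?L + i mod ?L" by (rule div_mult_mod_eq[symmetric])
        moreover have "0 \<le> i mod ?L" "i mod ?L < ?L" using L(1) by auto
        moreover have "j * ?L \<le> (i div ?L) * ?L" "(i div ?L) * ?L \<le> (j + 1) * ?L"
          using L(1) that by (intro mult_right_mono; auto)+
        moreover have "(j + 1) * ?L = j * ?L + ?L" by (simp add: distrib_right)
        ultimately have "j * ?L \<le> i" "i \<le> j * ?L + 2 * ?L" by linarith+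
        then show ?thesis using n(1) by (intro exI[of _ "nat (i - j * ?L)"]) auto
      qed
      have kj: "k div ?L = j \<or> k div ?L = j + 1" "l div ?L = j \<or> l div ?L = j + 1"
        using kl(3) by (auto simp: j_def min_def)
      obtain m m' where m: "m \<le> n" "k = j * ?L + int m" "m' \<le> n" "l = j * ?L + int m'"
        using near[OF kj(1)] near[OF kj(2)] by blast
      have "walk (seq w) k - walk (seq w) (j * ?L) = incr (seq w) (j * ?L) (j * ?L + int m)"
        "walk (seq w) l - walk (seq w) (j * ?L) = incr (seq w) (j * ?L) (j * ?L + int m')"
        unfolding m by (intro walk_diff; simp)+
      with big have "2 * c \<le> \<bar>incr (seq w) (j * ?L) (j * ?L + int m)\<bar> \<or> 2 * c \<le> \<bar>incr (seq w) (j * ?L) (j * ?L + int m')\<bar>"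
        by linarith
      then have "w \<in> E j" using m w unfolding E_def by blast
      with j show "w \<in> (\<Union>j\<in>{- int K..int K}. E j)" by blast
    qed
    moreover have "(\<Union>j\<in>{- int K..int K}. E j) \<in> events" unfolding E_def by measurable
    ultimately show "prob {w \<in> space M. \<exists>k\<in>{- int N..int N}. \<exists>l\<in>{- int N..int N}.
       \<bar>k div ?L - l div ?L\<bar> \<le> 1 \<and> h \<le> \<bar>walk (seq w) k / sqrt N - walk (seq w) l / sqrt N\<bar>} \<le> \<epsilon>"
      by (meson finite_measure_mono order_trans)
  qed
  with K(1) show ?thesis by blast
qed

text \<open>
  Given the increments outside of block \<open>s\<close>, the value of \<open>G\<close> is close to 0 only if the increment over
  this block lies in a given short interval. In units of \<open>sqrt N\<close>, this increment has spread of order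
  \<open>1 / sqrt K\<close>, so the bound is uniform in \<open>s\<close> and \<open>g\<close>.
\<close>

lemma spare_block_anticoncentration:
  assumes K: "K > 0" and \<epsilon>: "\<epsilon> > 0"
  shows "\<exists>\<delta>>0. \<forall>\<^sub>F N in sequentially. \<forall>s g G. \<forall>e::real. 1 \<le> \<bar>e\<bar> \<longrightarrow> g \<in> borel_measurable seqs \<longrightarrow>
    (\<forall>x. G x = g (mask (- {s * block_length K N<..s * block_length K N + block_length K N}) x)
       + e * (incr x (s * block_length K N) (s * block_length K N + block_length K N) / sqrt N)) \<longrightarrow>
    prob {w \<in> space M. \<bar>G (seq w)\<bar> \<le> \<delta>} \<le> \<epsilon>"
proof -
  obtain d where d: "d > 0" and ev: "\<forall>\<^sub>F n in sequentially. \<forall>a y.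
    prob {w \<in> space M. \<bar>incr (seq w) a (a + int n) / sqrt n - y\<bar> \<le> d} \<le> \<epsilon>"
    using incr_anticoncentration[OF \<epsilon>] by blast
  then obtain n0 where n0: "\<And>n a y. n \<ge> n0 \<Longrightarrow>
     prob {w \<in> space M. \<bar>incr (seq w) a (a + int n) / sqrt n - y\<bar> \<le> d} \<le> \<epsilon>"
    unfolding eventually_sequentially by blast
  have "\<forall>\<^sub>F N in sequentially. \<forall>s g G. \<forall>e::real. 1 \<le> \<bar>e\<bar> \<longrightarrow> g \<in> borel_measurable seqs \<longrightarrow>
    (\<forall>x. G x = g (mask (- {s * block_length K N<..s * block_length K N + block_length K N}) x)
       + e * (incr x (s * block_length K N) (s * block_length K N + block_length K N) / sqrt N)) \<longrightarrow>
    prob {w \<in> space M. \<bar>G (seq w)\<bar> \<le> d / sqrt K} \<le> \<epsilon>"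
    using eventually_ge_at_top[of "K * n0 + 1"]
  proof (eventually_elim, intro allI impI)
    fix N s g G and e :: real
    assume N: "K * n0 + 1 \<le> N" and e: "1 \<le> \<bar>e\<bar>" and g [measurable]: "g \<in> borel_measurable seqs"
      and G: "\<forall>x. G x = g (mask (- {s * block_length K N<..s * block_length K N + block_length K N}) x)
       + e * (incr x (s * block_length K N) (s * block_length K N + block_length K N) / sqrt N)"
    define n where "n = N div K + 1"
    let ?a = "s * int n"
    let ?J = "{?a<..?a + int n}"
    have L: "block_length K N = int n" by (simp add: block_length_def n_def)
    have "n0 = (K * n0) div K" using K by simp
    also have "\<dots> \<le> N div K" using N by (intro div_le_mono) auto
    finally have n: "n \<ge> n0" "n > 0" by (auto simp: n_def)
    \<comment> \<open>The factor that turns the increment in \<open>G\<close> into the normalized increment \<open>U\<close>.\<close>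
    define r where "r = sqrt N / (e * sqrt n)"
    have pos: "sqrt N > 0" "sqrt n > 0" "e \<noteq> 0" "sqrt K > 0" using N n e K by auto
    have r: "\<bar>r\<bar> \<le> sqrt K"
    proof -
      have "sqrt N \<le> sqrt K * sqrt n"
        using block_length_bounds(3)[OF K, of N] unfolding L by (simp add: real_sqrt_mult[symmetric])
      also have "\<dots> \<le> sqrt K * (\<bar>e\<bar> * sqrt n)" using e pos mult_right_mono[of 1 "\<bar>e\<bar>" "sqrt n"] by (intro mult_left_mono) auto
      finally show ?thesis using pos by (simp add: r_def abs_mult divide_le_eq)
    qed
    define U where "U w = incr (seq w) ?a (?a + int n) / sqrt n" for w
    define Y where "Y w = r * g (mask (- ?J) (seq w))" for w
    have "indep_var borel (\<lambda>w. r * g (mask (- ?J) (seq w))) borel (\<lambda>w. incr (mask ?J (seq w)) ?a (?a + int n) / sqrt n)"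
      by (rule indep_masked) auto
    then have "indep_var borel Y borel U" unfolding Y_def U_def by (simp add: incr_mask)
    then have "prob {w \<in> space M. \<bar>U w + Y w\<bar> \<le> d} \<le> \<epsilon>"
      by (rule indep_shift_anticoncentration) (simp add: U_def n0[OF n(1)])
    moreover have "prob {w \<in> space M. \<bar>G (seq w)\<bar> \<le> d / sqrt K} \<le> prob {w \<in> space M. \<bar>U w + Y w\<bar> \<le> d}"
    proof (intro finite_measure_mono subsetI)
      fix w assume w: "w \<in> {w \<in> space M. \<bar>G (seq w)\<bar> \<le> d / sqrt K}"
      have "U w + Y w = r * G (seq w)"
        using G[rule_format, of "seq w"] pos unfolding L U_def Y_def r_def by (simp add: field_simps)
      then have "\<bar>U w + Y w\<bar> = \<bar>r\<bar> * \<bar>G (seq w)\<bar>" by (simp add: abs_mult)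
      also have "\<dots> \<le> sqrt K * (d / sqrt K)" using r w by (intro mult_mono) auto
      also have "\<dots> = d" using pos by simp
      finally show "w \<in> {w \<in> space M. \<bar>U w + Y w\<bar> \<le> d}" using w by simp
    qed (unfold U_def Y_def, measurable)
    ultimately show "prob {w \<in> space M. \<bar>G (seq w)\<bar> \<le> d / sqrt K} \<le> \<epsilon>" by linarith
  qed
  then show ?thesis using d K by (intro exI[of _ "d / sqrt K"]) auto
qed

lemma near_ties_unlikely:
  assumes K: "K > 0" and \<epsilon>: "\<epsilon> > 0"
  shows "\<exists>\<delta>>0. \<forall>\<^sub>F N in sequentially.
    prob {w \<in> space M. \<exists>t\<in>{- int K..int K} \<times> {- int K..int K} \<times> {- int K..int K} \<times> {- int K..int K}.
      near_tie N (block_length K N) \<delta> (seq w) t} \<le> \<epsilon> \<and>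
    prob {w \<in> space M. \<exists>p\<in>{- int K..int K} \<times> {- int K..int K}.
      near_depth N (block_length K N) h \<delta> (seq w) p} \<le> \<epsilon>"
proof -
  let ?I = "{- int K..int K}"
  let ?I4 = "?I \<times> ?I \<times> ?I \<times> ?I" and ?I2 = "?I \<times> ?I"
  define c where "c = real (card ?I4)"
  have c: "c > 0" "real (card ?I2) \<le> c" "card ?I2 > 0"
  proof -
    define b where "b = real (card ?I)"
    have "1 \<le> b" by (simp add: b_def)
    then have "1 \<le> b * b" using mult_mono[of 1 b 1 b] by simp
    moreover have "c = (b * b) * (b * b)" "real (card ?I2) = b * b"
      unfolding c_def b_def by (simp_all only: card_cartesian_product of_nat_mult mult.assoc)
    ultimately show "c > 0" "real (card ?I2) \<le> c" "card ?I2 > 0"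
      using mult_right_mono[of 1 "b * b" "b * b"] by (auto intro!: Nat.gr0I)
  qed
  obtain \<delta> where \<delta>: "\<delta> > 0" and ev: "\<forall>\<^sub>F N in sequentially. \<forall>s g G. \<forall>e::real. 1 \<le> \<bar>e\<bar> \<longrightarrow> g \<in> borel_measurable seqs \<longrightarrow>
    (\<forall>x. G x = g (mask (- {s * block_length K N<..s * block_length K N + block_length K N}) x)
       + e * (incr x (s * block_length K N) (s * block_length K N + block_length K N) / sqrt N)) \<longrightarrow>
    prob {w \<in> space M. \<bar>G (seq w)\<bar> \<le> \<delta>} \<le> \<epsilon> / c"
    using spare_block_anticoncentration[OF K, of "\<epsilon> / c"] \<epsilon> c by auto
  from ev have "\<forall>\<^sub>F N in sequentially.
    prob {w \<in> space M. \<exists>t\<in>?I4. near_tie N (block_length K N) \<delta> (seq w) t} \<le> \<epsilon> \<and>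
    prob {w \<in> space M. \<exists>p\<in>?I2. near_depth N (block_length K N) h \<delta> (seq w) p} \<le> \<epsilon>"
  proof eventually_elim
    fix N
    let ?L = "block_length K N"
    assume conc: "\<forall>s g G. \<forall>e::real. 1 \<le> \<bar>e\<bar> \<longrightarrow> g \<in> borel_measurable seqs \<longrightarrow>
      (\<forall>x. G x = g (mask (- {s * ?L<..s * ?L + ?L}) x) + e * (incr x (s * ?L) (s * ?L + ?L) / sqrt N)) \<longrightarrow>
      prob {w \<in> space M. \<bar>G (seq w)\<bar> \<le> \<delta>} \<le> \<epsilon> / c"
    note L = block_length_bounds(1)[OF K, of N]
    have "prob (\<Union>t\<in>?I4. {w \<in> space M. near_tie N ?L \<delta> (seq w) t}) \<le> \<epsilon>"
    proof (rule prob_Union_le)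
      fix t assume t: "t \<in> ?I4"
      show "{w \<in> space M. near_tie N ?L \<delta> (seq w) t} \<in> events" by measurable
      obtain i j k l where ijkl: "t = (i, j, k, l)" by (cases t) auto
      define G where "G x = (cell_max N ?L x i - cell_min N ?L x j) - (cell_max N ?L x k - cell_min N ?L x l)" for x
      have G_meas [measurable]: "G \<in> borel_measurable seqs" unfolding G_def by measurable
      show "prob {w \<in> space M. near_tie N ?L \<delta> (seq w) t} \<le> \<epsilon> / real (card ?I4)"
      proof (cases "(\<forall>m\<in>{i, j, k, l}. cell N ?L m \<noteq> {}) \<and> 2 \<le> \<bar>j - l\<bar> \<and> 2 \<le> \<bar>i - j\<bar> \<and> 2 \<le> \<bar>i - l\<bar> \<and> 2 \<le> \<bar>k - j\<bar> \<and> 2 \<le> \<bar>k - l\<bar>")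
        case False
        then have "{w \<in> space M. near_tie N ?L \<delta> (seq w) t} = {}" by (auto simp: near_tie_def ijkl)
        then show ?thesis using \<epsilon> by (simp only: measure_empty) simp
      next
        case True
        obtain s where s: "s \<noteq> i" "s \<noteq> j" "s \<noteq> k" "s \<noteq> l"
          "1 \<le> \<bar>(of_bool (s < i) - of_bool (s < j)) - (of_bool (s < k) - of_bool (s < l)) :: real\<bar>" (is "1 \<le> \<bar>?e\<bar>")
          using True spare_index[of j l i k] by blast
        have "G x = G (mask (- {s * ?L<..s * ?L + ?L}) x) + ?e * (incr x (s * ?L) (s * ?L + ?L) / sqrt N)" for x
        proof -
          obtain C where C: "\<And>i. cell N ?L i \<noteq> {} \<Longrightarrow> i \<noteq> s \<Longrightarrow> cell_max N ?L x i = cell_max N ?L (mask (- {s * ?L<..s * ?L + ?L}) x) i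
             + (C + of_bool (s < i) * (incr x (s * ?L) (s * ?L + ?L) / sqrt N))"
            "\<And>i. cell N ?L i \<noteq> {} \<Longrightarrow> i \<noteq> s \<Longrightarrow> cell_min N ?L x i = cell_min N ?L (mask (- {s * ?L<..s * ?L + ?L}) x) i
             + (C + of_bool (s < i) * (incr x (s * ?L) (s * ?L + ?L) / sqrt N))"
            using cell_extrema_mask[OF L, of N s x] by metis
          have ne: "cell N ?L i \<noteq> {}" "cell N ?L j \<noteq> {}" "cell N ?L k \<noteq> {}" "cell N ?L l \<noteq> {}" using True by auto
          show ?thesis
            unfolding G_def C(1)[OF ne(1) s(1)[symmetric]] C(1)[OF ne(3) s(3)[symmetric]]
              C(2)[OF ne(2) s(2)[symmetric]] C(2)[OF ne(4) s(4)[symmetric]]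
            by (simp only: ring_distribs; simp)
        qed
        with conc s(5) G_meas have "prob {w \<in> space M. \<bar>G (seq w)\<bar> \<le> \<delta>} \<le> \<epsilon> / c" by blast
        then show ?thesis using True by (simp add: near_tie_def ijkl G_def c_def)
      qed
    qed auto
    moreover have "prob (\<Union>p\<in>?I2. {w \<in> space M. near_depth N ?L h \<delta> (seq w) p}) \<le> \<epsilon>"
    proof (rule prob_Union_le)
      fix p assume p: "p \<in> ?I2"
      show "{w \<in> space M. near_depth N ?L h \<delta> (seq w) p} \<in> events" by measurable
      obtain i j where ij: "p = (i, j)" by (cases p) auto
      define G where "G x = cell_max N ?L x i - cell_min N ?L x j - h" for x
      have G_meas [measurable]: "G \<in> borel_measurable seqs" unfolding G_def by measurable
      have "0 < real (card ?I2)" unfolding of_nat_0_less_iff by (rule c(3))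
      then have le: "\<epsilon> / c \<le> \<epsilon> / real (card ?I2)"
        by (intro divide_left_mono[OF c(2) less_imp_le[OF \<epsilon>]] mult_pos_pos c(1))
      show "prob {w \<in> space M. near_depth N ?L h \<delta> (seq w) p} \<le> \<epsilon> / real (card ?I2)"
      proof (cases "cell N ?L i \<noteq> {} \<and> cell N ?L j \<noteq> {} \<and> 2 \<le> \<bar>i - j\<bar>")
        case False
        then have "{w \<in> space M. near_depth N ?L h \<delta> (seq w) p} = {}" by (auto simp: near_depth_def ij)
        then show ?thesis using \<epsilon> by (simp only: measure_empty) simp
      next
        case True
        define s where "s = min i j + 1"
        have s: "s \<noteq> i" "s \<noteq> j" "1 \<le> \<bar>of_bool (s < i) - of_bool (s < j) :: real\<bar>" (is "1 \<le> \<bar>?e\<bar>")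
          using True by (auto simp: s_def min_def)
        have "G x = G (mask (- {s * ?L<..s * ?L + ?L}) x) + ?e * (incr x (s * ?L) (s * ?L + ?L) / sqrt N)" for x
        proof -
          obtain C where C: "\<And>i. cell N ?L i \<noteq> {} \<Longrightarrow> i \<noteq> s \<Longrightarrow> cell_max N ?L x i = cell_max N ?L (mask (- {s * ?L<..s * ?L + ?L}) x) i
             + (C + of_bool (s < i) * (incr x (s * ?L) (s * ?L + ?L) / sqrt N))"
            "\<And>i. cell N ?L i \<noteq> {} \<Longrightarrow> i \<noteq> s \<Longrightarrow> cell_min N ?L x i = cell_min N ?L (mask (- {s * ?L<..s * ?L + ?L}) x) i
             + (C + of_bool (s < i) * (incr x (s * ?L) (s * ?L + ?L) / sqrt N))"
            using cell_extrema_mask[OF L, of N s x] by metis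
          have ne: "cell N ?L i \<noteq> {}" "cell N ?L j \<noteq> {}" using True by auto
          show ?thesis
            unfolding G_def C(1)[OF ne(1) s(1)[symmetric]] C(2)[OF ne(2) s(2)[symmetric]]
            by (simp only: ring_distribs; simp)
        qed
        with conc s(3) G_meas have "prob {w \<in> space M. \<bar>G (seq w)\<bar> \<le> \<delta>} \<le> \<epsilon> / c" by blast
        then show ?thesis using True le by (simp add: near_depth_def ij G_def)
      qed
    qed auto
    moreover have "{w \<in> space M. \<exists>t\<in>?I4. near_tie N ?L \<delta> (seq w) t} = (\<Union>t\<in>?I4. {w \<in> space M. near_tie N ?L \<delta> (seq w) t})"
      "{w \<in> space M. \<exists>p\<in>?I2. near_depth N ?L h \<delta> (seq w) p} = (\<Union>p\<in>?I2. {w \<in> space M. near_depth N ?L h \<delta> (seq w) p})"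
      by blast+
    ultimately show "prob {w \<in> space M. \<exists>t\<in>?I4. near_tie N ?L \<delta> (seq w) t} \<le> \<epsilon> \<and>
      prob {w \<in> space M. \<exists>p\<in>?I2. near_depth N ?L h \<delta> (seq w) p} \<le> \<epsilon>"
      by (simp only:)
  qed
  with \<delta> show ?thesis by blast
qed

end

section \<open>Existence of a deep minimum\<close>

definition has_deep_minimum :: "nat \<Rightarrow> real \<Rightarrow> (int \<Rightarrow> real) \<Rightarrow> bool" where
  "has_deep_minimum N h v \<longleftrightarrow> (\<exists>k\<in>{- int N..int N}. \<exists>a\<in>{- int N..<k}. \<exists>b\<in>{k<..int N}.
     v k + h \<le> v a \<and> v k + h \<le> v b \<and> (\<forall>z\<in>{a..b}. v k \<le> v z))"

text \<open>
  The minimum over \<open>{s..e}\<close> lies at or below \<open>m\<close>, hence by \<open>h\<close> below both ends.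
\<close>

lemma has_deep_minimumI:
  assumes s: "- int N \<le> s" "s \<le> m" "m \<le> e" "e \<le> int N" and h: "h > 0"
    and down: "v m + h \<le> v s" and up: "v m + h \<le> v e"
  shows "has_deep_minimum N h v"
proof -
  have "Min (v ` {s..e}) \<in> v ` {s..e}" using s by (intro Min_in) auto
  then obtain k where k: "k \<in> {s..e}" "Min (v ` {s..e}) = v k" by auto
  have min: "v k \<le> v z" if "z \<in> {s..e}" for z
    unfolding k(2)[symmetric] using that by (intro Min_le) auto
  have "v k \<le> v m" using s by (intro min) auto
  then have deep: "v k + h \<le> v s" "v k + h \<le> v e" using down up by linarith+
  then have "k \<noteq> s" "k \<noteq> e" using h by auto
  then have sk: "s < k" "k < e" using k(1) by auto
  show ?thesis unfolding has_deep_minimum_def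
    by (rule bexI[of _ k], rule bexI[of _ s], rule bexI[of _ e]) (use sk s deep min in auto)
qed

text \<open>
  The leftmost lattice point that is an \<open>h\<close>-minimum is the least element of its class.
\<close>

lemma M_minus_nonempty:
  assumes N: "N > 0" and h: "h > 0" and deep: "has_deep_minimum N h v"
  shows "M_minus h (interp N v) \<noteq> {}"
proof -
  define D where "D = {k \<in> {- int N..int N}. of_int k / real N \<in> h_minima h (interp N v)}"
  have "finite D" unfolding D_def by (rule finite_subset[of _ "{- int N..int N}"]) auto
  moreover have "D \<noteq> {}"
    using deep unfolding D_def has_deep_minimum_def h_minima_lattice_iff[OF N h] by blast
  ultimately have D: "finite D" "D \<noteq> {}" by auto
  define k where "k = Min D"
  have k: "k \<in> D" using D by (simp add: k_def)
  have least: "k \<le> j" if "j \<in> D" for j using Min_le[OF D(1) that] by (simp add: k_def)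
  have "of_int k / real N \<in> M_minus h (interp N v)"
    unfolding M_minus_lattice_iff[OF N h]
  proof (intro conjI ballI impI)
    fix j assume j: "j \<in> {- int N..<k}" "of_int j / real N \<in> h_minima h (interp N v)"
    with k have "j \<in> D" by (auto simp: D_def)
    with least j show "\<exists>z\<in>{j..k}. h \<le> \<bar>v z - v k\<bar>" by fastforce
  qed (use k in \<open>simp add: D_def\<close>)
  then show ?thesis by blast
qed

context bounded_increments
begin

text \<open>
  The number \<open>R\<close> of independent attempts does not depend on \<open>N\<close>; \<open>h\<close> is the standard deviation of
  the scaled increment over a block, up to a factor that makes up for rounding the block length.
\<close>

lemma deep_minimum_likely:
  assumes \<epsilon>: "\<epsilon> > 0"
  shows "\<exists>h>0. \<forall>\<^sub>F N in sequentially.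
    prob {w \<in> space M. \<not> has_deep_minimum N h (\<lambda>k. walk (seq w) k / sqrt N)} \<le> \<epsilon>"
proof -
  obtain p where p: "p > 0" and ev: "\<forall>\<^sub>F n in sequentially. \<forall>a.
     p \<le> prob {w \<in> space M. incr (seq w) a (a + int n) \<le> - (\<sigma> * sqrt n)} \<and>
     p \<le> prob {w \<in> space M. \<sigma> * sqrt n \<le> incr (seq w) a (a + int n)}"
    using large_incr_prob by blast
  from ev obtain n0 where n0: "\<And>n a. n \<ge> n0 \<Longrightarrow> p \<le> prob {w \<in> space M. incr (seq w) a (a + int n) \<le> - (\<sigma> * sqrt n)}"
     "\<And>n a. n \<ge> n0 \<Longrightarrow> p \<le> prob {w \<in> space M. \<sigma> * sqrt n \<le> incr (seq w) a (a + int n)}"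
    unfolding eventually_sequentially by blast
  have "p \<le> 1" using n0(1)[of n0 0] by (rule order_trans) simp_all
  then have q: "0 \<le> 1 - p\<^sup>2" "1 - p\<^sup>2 < 1" using p by (simp_all add: power_le_one)
  obtain R0 where R0: "(1 - p\<^sup>2) ^ R0 < \<epsilon>" using real_arch_pow_inv[OF \<epsilon> q(2)] by blast
  define R where "R = Suc R0"
  have R: "R > 0" "(1 - p\<^sup>2) ^ R \<le> \<epsilon>"
    using mult_right_mono[of "1 - p\<^sup>2" 1 "(1 - p\<^sup>2) ^ R0"] q R0 by (simp_all add: R_def)
  \<comment> \<open>For \<open>N \<ge> 4 * R\<close> the block length \<open>n\<close> satisfies \<open>N \<le> 4 * R * n\<close>.\<close>
  define h where "h = \<sigma> / sqrt (4 * R)"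
  have h: "h > 0" using R \<sigma>_pos by (simp add: h_def)
  have "\<forall>\<^sub>F N in sequentially.
    prob {w \<in> space M. \<not> has_deep_minimum N h (\<lambda>k. walk (seq w) k / sqrt N)} \<le> \<epsilon>"
    using eventually_ge_at_top[of "2 * R * n0"] eventually_ge_at_top[of "4 * R"]
  proof eventually_elim
    fix N assume N: "2 * R * n0 \<le> N" "4 * R \<le> N"
    define n where "n = N div (2 * R)"
    have "n0 = (2 * R * n0) div (2 * R)" using R by simp
    also have "\<dots> \<le> n" unfolding n_def using N by (intro div_le_mono) auto
    finally have nn0: "n \<ge> n0" .
    have Nn: "2 * R * n \<le> N" unfolding n_def by simp
    have "N < 2 * R + 2 * R * n" unfolding n_def using R by (intro dividend_less_times_div) auto
    then have "real N \<le> 4 * R * n"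
    proof -
      have "N \<le> 4 * R * n" using \<open>N < _\<close> N(2) by linarith
      then have "real N \<le> real (4 * R * n)" by (simp only: of_nat_le_iff)
      then show ?thesis by simp
    qed
    then have hn: "h * sqrt N \<le> \<sigma> * sqrt n"
    proof -
      assume "real N \<le> 4 * R * n"
      then have "sqrt N \<le> sqrt (4 * R) * sqrt n" by (simp add: real_sqrt_mult[symmetric])
      then have "h * sqrt N \<le> h * (sqrt (4 * R) * sqrt n)" using h by (intro mult_left_mono) auto
      also have "\<dots> = \<sigma> * sqrt n" using R by (simp add: h_def)
      finally show ?thesis .
    qed
    have Npos: "N > 0" using N(2) R by simp
    define t where "t i = int i * (2 * int n)" for i
    define down where "down i x \<longleftrightarrow> incr x (t i) (t i + int n) \<le> - (\<sigma> * sqrt n)" for i x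
    define up where "up i x \<longleftrightarrow> \<sigma> * sqrt n \<le> incr x (t i + int n) (t i + int n + int n)" for i x
    have [measurable]: "Measurable.pred seqs (down i)" "Measurable.pred seqs (up i)" for i
      unfolding down_def up_def by measurable
    have valley: "p\<^sup>2 \<le> prob {w \<in> space M. down i (seq w) \<and> up i (seq w)}" for i
    proof -
      let ?I = "{t i<..t i + int n}" and ?J = "{t i + int n<..t i + int n + int n}"
      have "prob {w \<in> space M. down i (seq w) \<and> up i (seq w)}
         = prob {w \<in> space M. down i (seq w)} * prob {w \<in> space M. up i (seq w)}"
        using prob_masked_conj[of ?I ?J "down i" "up i"] by (simp add: down_def up_def incr_mask)
      moreover have "p \<le> prob {w \<in> space M. down i (seq w)}" "p \<le> prob {w \<in> space M. up i (seq w)}"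
        unfolding down_def up_def by (rule n0[OF nn0])+
      then have "p * p \<le> prob {w \<in> space M. down i (seq w)} * prob {w \<in> space M. up i (seq w)}"
        using p by (intro mult_mono) auto
      ultimately show ?thesis by (simp add: power2_eq_square)
    qed
    have none: "prob {w \<in> space M. \<forall>i<r. \<not> (down i (seq w) \<and> up i (seq w))} \<le> (1 - p\<^sup>2) ^ r" for r
    proof (induction r)
      case 0 show ?case by (simp add: prob_space)
    next
      case (Suc r)
      let ?I = "{t 0<..t r}" and ?J = "{t r<..t r + int n + int n}"
      let ?P = "\<lambda>x. \<forall>i<r. \<not> (down i x \<and> up i x)" and ?Q = "\<lambda>x. \<not> (down r x \<and> up r x)"
      have eqP: "?P (mask ?I x) = ?P x" for x
      proof -
        have "down i (mask ?I x) = down i x" "up i (mask ?I x) = up i x" if "i < r" for i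
        proof -
          have "t 0 \<le> t i" by (simp add: t_def)
          moreover have "t i + int n + int n = int (i + 1) * (2 * int n)" by (simp add: t_def algebra_simps)
          then have "t i + int n + int n \<le> t r" unfolding t_def using that by (simp add: mult_right_mono)
          ultimately show "down i (mask ?I x) = down i x" "up i (mask ?I x) = up i x"
            unfolding down_def up_def by (subst incr_mask; auto)+
        qed
        then show ?thesis by blast
      qed
      have eqQ: "?Q (mask ?J x) = ?Q x" for x
        unfolding down_def up_def by (subst (1 2) incr_mask) auto
      have m: "Measurable.pred seqs ?P" "Measurable.pred seqs ?Q" by measurable
      have "prob {w \<in> space M. \<forall>i<Suc r. \<not> (down i (seq w) \<and> up i (seq w))}
         = prob {w \<in> space M. ?P (seq w) \<and> ?Q (seq w)}"
        by (intro arg_cong[where f = prob]) (auto simp: less_Suc_eq)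
      also have "\<dots> = prob {w \<in> space M. ?P (seq w)} * prob {w \<in> space M. ?Q (seq w)}"
        using prob_masked_conj[OF _ m, of ?I ?J] unfolding eqP eqQ by auto
      also have "prob {w \<in> space M. ?Q (seq w)} = 1 - prob {w \<in> space M. down r (seq w) \<and> up r (seq w)}"
        by (rule prob_neg) measurable
      also have "prob {w \<in> space M. ?P (seq w)} * \<dots> \<le> (1 - p\<^sup>2) ^ r * (1 - p\<^sup>2)"
        using Suc valley[of r] q by (intro mult_mono) auto
      finally show ?case by (simp add: mult.commute)
    qed
    have "has_deep_minimum N h (\<lambda>k. walk (seq w) k / sqrt N)"
      if i: "i < R" "down i (seq w)" "up i (seq w)" for i w
    proof (rule has_deep_minimumI[of N "t i" "t i + int n" "t i + int n + int n"])
      have "t i + int n + int n = int (i + 1) * (2 * int n)" by (simp add: t_def algebra_simps)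
      also have "\<dots> \<le> int R * (2 * int n)" using i by (intro mult_right_mono) auto
      also have "\<dots> = int (2 * R * n)" by simp
      also have "\<dots> \<le> int N" using Nn by (simp only: of_nat_le_iff)
      finally show "t i + int n + int n \<le> int N" .
      have "0 \<le> t i" by (simp add: t_def)
      then show "- int N \<le> t i" by linarith
      have "walk (seq w) (t i + int n) - walk (seq w) (t i) \<le> - (h * sqrt N)"
        using i hn by (simp add: walk_diff down_def)
      then show "walk (seq w) (t i + int n) / sqrt N + h \<le> walk (seq w) (t i) / sqrt N"
        using divide_right_mono[of "walk (seq w) (t i + int n) + h * sqrt N" "walk (seq w) (t i)" "sqrt N"] Npos
        by (simp add: add_divide_distrib)
      have "h * sqrt N \<le> walk (seq w) (t i + int n + int n) - walk (seq w) (t i + int n)"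
        using i hn by (simp add: walk_diff up_def)
      then show "walk (seq w) (t i + int n) / sqrt N + h \<le> walk (seq w) (t i + int n + int n) / sqrt N"
        using divide_right_mono[of "walk (seq w) (t i + int n) + h * sqrt N" "walk (seq w) (t i + int n + int n)" "sqrt N"] Npos
        by (simp add: add_divide_distrib)
    qed (use h in simp_all)
    then have "prob {w \<in> space M. \<not> has_deep_minimum N h (\<lambda>k. walk (seq w) k / sqrt N)}
      \<le> prob {w \<in> space M. \<forall>i<R. \<not> (down i (seq w) \<and> up i (seq w))}"
      by (intro finite_measure_mono, blast, measurable)
    with none[of R] R(2) show "prob {w \<in> space M. \<not> has_deep_minimum N h (\<lambda>k. walk (seq w) k / sqrt N)} \<le> \<epsilon>"
      by linarith
  qed
  with h show ?thesis by blast
qed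

end

section \<open>Good paths have high probability\<close>

text \<open>
  The absence of the bad events for the walk gives the assumptions on blocks for the interpolated
  path. At most \<open>2 * K + 1\<close> blocks meet \<open>[-1, 1]\<close>.
\<close>

lemma good_path_if_generic:
  fixes x :: "int \<Rightarrow> real"
  assumes N: "N > 0" and K: "K > 0" and h: "h > 0" and \<delta>: "\<delta> > 0"
  defines "v \<equiv> \<lambda>k. walk x k / sqrt N" and "L \<equiv> block_length K N"
  assumes deep: "has_deep_minimum N h v"
    and osc: "\<And>k l. k \<in> {- int N..int N} \<Longrightarrow> l \<in> {- int N..int N} \<Longrightarrow> \<bar>k div L - l div L\<bar> \<le> 1 \<Longrightarrow> \<bar>v k - v l\<bar> < h"
    and ties: "\<And>t. t \<in> {- int K..int K} \<times> {- int K..int K} \<times> {- int K..int K} \<times> {- int K..int K} \<Longrightarrow> \<not> near_tie N L \<delta> x t"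
    and depths: "\<And>p. p \<in> {- int K..int K} \<times> {- int K..int K} \<Longrightarrow> \<not> near_depth N L h \<delta> x p"
  shows "interp N v \<in> good_paths h \<delta>" "card (M_minus h (interp N v)) \<le> 2 * K + 1"
proof -
  let ?\<gamma> = "interp N v"
  let ?\<Lambda> = "(\<lambda>k::int. of_int k / real N) ` {- int N..int N}"
  let ?\<beta> = "\<lambda>t. \<lfloor>real N * t\<rfloor> div L"
  have L: "L > 0" unfolding L_def by (rule block_length_bounds(1)[OF K])
  have \<beta>: "?\<beta> (of_int k / real N) = k div L" for k using N by simp
  have att: "\<exists>z\<in>?\<Lambda> \<inter> {of_int i / real N..of_int j / real N}. seg_max ?\<gamma> (of_int i / real N) (of_int j / real N) = ?\<gamma> z"
    if ij: "i \<le> j" "- int N \<le> i" "j \<le> int N" for i j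
  proof -
    obtain k where k: "k \<in> {i..j}" "seg_max ?\<gamma> (of_int i / real N) (of_int j / real N) = v k"
      using seg_max_interp_attained[OF N ij] by blast
    have "of_int k / real N \<in> ?\<Lambda>" using k ij by auto
    moreover have "of_int k / real N \<in> {of_int i / real N..of_int j / real N}"
      using k(1) by (simp add: divide_right_mono)
    ultimately show ?thesis using k(2) N by (intro bexI[of _ "of_int k / real N"]) simp_all
  qed
  interpret S: separated_blocks ?\<gamma> h ?\<Lambda> ?\<beta>
  proof
    show "continuous_on {-1..1} ?\<gamma>" by (rule continuous_on_interp[OF N])
    show "?\<Lambda> \<subseteq> {-1..1}" using N by (auto simp: divide_le_eq le_divide_eq)
    show "-1 \<in> ?\<Lambda>" using N by (intro image_eqI[of _ _ "- int N"]) auto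
    show "1 \<in> ?\<Lambda>" using N by (intro image_eqI[of _ _ "int N"]) auto
    show "M_minus h ?\<gamma> \<subseteq> ?\<Lambda>" by (rule M_minus_interp_subset[OF N h])
    show "M_minus h ?\<gamma> \<noteq> {}" by (rule M_minus_nonempty[OF N h deep])
    show "mono ?\<beta>"
      using L by (intro monoI zdiv_mono1 floor_mono mult_left_mono) auto
    show "\<exists>z\<in>?\<Lambda> \<inter> {min s t..max s t}. seg_max ?\<gamma> s t = ?\<gamma> z" if st: "s \<in> ?\<Lambda>" "t \<in> ?\<Lambda>" for s t
    proof -
      obtain i where i: "s = of_int i / real N" "i \<in> {- int N..int N}" using st(1) by blast
      obtain j where j: "t = of_int j / real N" "j \<in> {- int N..int N}" using st(2) by blast
      show ?thesis
      proof (cases "i \<le> j")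
        case True
        then have "s \<le> t" using N i j by (simp add: divide_right_mono)
        then show ?thesis using att[OF True] i j by simp
      next
        case False
        then have "t \<le> s" using N i j by (simp add: divide_right_mono)
        then show ?thesis using att[of j i] i j False by (simp add: seg_max_commute)
      qed
    qed
    show "\<bar>?\<gamma> s - ?\<gamma> t\<bar> < h" if "s \<in> ?\<Lambda>" "t \<in> ?\<Lambda>" "\<bar>?\<beta> s - ?\<beta> t\<bar> \<le> 1" for s t
      using that N by (auto simp: osc)
  qed (use h in auto)
  have cells: "?\<gamma> ` {t \<in> ?\<Lambda>. ?\<beta> t = i} = v ` cell N L i" for i
  proof -
    have "{t \<in> ?\<Lambda>. ?\<beta> t = i} = (\<lambda>k. of_int k / real N) ` cell N L i"
      using N by (auto simp: cell_def)
    then show ?thesis using N by (simp add: image_image)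
  qed
  have bmax: "S.blockmax i = cell_max N L x i" and bmin: "S.blockmin i = cell_min N L x i" for i
    by (simp_all only: S.blockmax_def S.blockmin_def cells cell_max_def cell_min_def) (simp_all only: v_def)
  have idx: "i \<in> {- int K..int K}" "cell N L i \<noteq> {}" if i: "i \<in> ?\<beta> ` ?\<Lambda>" for i
  proof -
    obtain k where k: "k \<in> {- int N..int N}" "i = k div L" using i N by auto
    show "i \<in> {- int K..int K}" unfolding k L_def by (rule div_block_length_range[OF K k(1)])
    show "cell N L i \<noteq> {}" using k by (auto simp: cell_def)
  qed
  show "?\<gamma> \<in> good_paths h \<delta>"
  proof (rule S.good_path_if_blocks_separated)
    show "\<delta> \<le> \<bar>S.blockmax i - S.blockmin j - h\<bar>"
      if "i \<in> ?\<beta> ` ?\<Lambda>" "j \<in> ?\<beta> ` ?\<Lambda>" "2 \<le> \<bar>i - j\<bar>" for i j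
      using depths[of "(i, j)"] idx[OF that(1)] idx[OF that(2)] that(3)
      unfolding bmax bmin by (auto simp: near_depth_def)
    show "\<delta> \<le> \<bar>(S.blockmax i - S.blockmin j) - (S.blockmax k - S.blockmin l)\<bar>"
      if "{i, j, k, l} \<subseteq> ?\<beta> ` ?\<Lambda>" "2 \<le> \<bar>j - l\<bar>" "2 \<le> \<bar>i - j\<bar>" "2 \<le> \<bar>i - l\<bar>" "2 \<le> \<bar>k - j\<bar>" "2 \<le> \<bar>k - l\<bar>" for i j k l
    proof -
      have mem: "i \<in> ?\<beta> ` ?\<Lambda>" "j \<in> ?\<beta> ` ?\<Lambda>" "k \<in> ?\<beta> ` ?\<Lambda>" "l \<in> ?\<beta> ` ?\<Lambda>" using that(1) by blast+
      show ?thesis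
        using ties[of "(i, j, k, l)"] idx[OF mem(1)] idx[OF mem(2)] idx[OF mem(3)] idx[OF mem(4)] that(2-6)
        unfolding bmax bmin near_tie_def by simp
    qed
  qed (use \<delta> in simp)
  have "card (M_minus h ?\<gamma>) \<le> card (?\<beta> ` ?\<Lambda>)" by (rule S.card_minima_le)
  also have "\<dots> \<le> card {- int K..int K}"
  proof (rule card_mono)
    show "?\<beta> ` ?\<Lambda> \<subseteq> {- int K..int K}" using idx(1) by blast
  qed simp
  finally show "card (M_minus h ?\<gamma>) \<le> 2 * K + 1" by simp
qed

context bounded_increments
begin

theorem good_paths_likely:
  assumes \<alpha>: "\<alpha> > 0"
  shows "\<exists>h>0. \<exists>\<delta>>0. \<exists>Q::nat. \<forall>\<^sub>F N in sequentially. 1 - \<alpha> \<le> prob {w \<in> space M.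
     interp N (\<lambda>k. walk (seq w) k / sqrt N) \<in> good_paths h \<delta> \<and>
     card (M_minus h (interp N (\<lambda>k. walk (seq w) k / sqrt N))) \<le> Q}"
proof -
  have \<alpha>4: "\<alpha> / 4 > 0" using \<alpha> by simp
  obtain h where h: "h > 0" and deep: "\<forall>\<^sub>F N in sequentially.
    prob {w \<in> space M. \<not> has_deep_minimum N h (\<lambda>k. walk (seq w) k / sqrt N)} \<le> \<alpha> / 4"
    using deep_minimum_likely[OF \<alpha>4] by blast
  obtain K where K: "K > 0" and osc: "\<forall>\<^sub>F N in sequentially. prob {w \<in> space M. \<exists>k\<in>{- int N..int N}. \<exists>l\<in>{- int N..int N}.
     \<bar>k div block_length K N - l div block_length K N\<bar> \<le> 1 \<and>
     h \<le> \<bar>walk (seq w) k / sqrt N - walk (seq w) l / sqrt N\<bar>} \<le> \<alpha> / 4"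
    using adjacent_blocks_oscillation[OF h \<alpha>4] by blast
  let ?I = "{- int K..int K}"
  obtain \<delta> where \<delta>: "\<delta> > 0" and ties: "\<forall>\<^sub>F N in sequentially.
    prob {w \<in> space M. \<exists>t\<in>?I \<times> ?I \<times> ?I \<times> ?I. near_tie N (block_length K N) \<delta> (seq w) t} \<le> \<alpha> / 4 \<and>
    prob {w \<in> space M. \<exists>p\<in>?I \<times> ?I. near_depth N (block_length K N) h \<delta> (seq w) p} \<le> \<alpha> / 4"
    using near_ties_unlikely[OF K \<alpha>4, of h] by blast
  have "\<forall>\<^sub>F N in sequentially. 1 - \<alpha> \<le> prob {w \<in> space M.
     interp N (\<lambda>k. walk (seq w) k / sqrt N) \<in> good_paths h \<delta> \<and>
     card (M_minus h (interp N (\<lambda>k. walk (seq w) k / sqrt N))) \<le> 2 * K + 1}"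
    using deep osc ties eventually_gt_at_top[of 0]
  proof eventually_elim
    case (elim N)
    let ?v = "\<lambda>w k. walk (seq w) k / sqrt N"
    let ?G = "{w \<in> space M. interp N (?v w) \<in> good_paths h \<delta> \<and> card (M_minus h (interp N (?v w))) \<le> 2 * K + 1}"
    let ?A = "{w \<in> space M. \<not> has_deep_minimum N h (?v w)}"
    let ?B = "{w \<in> space M. \<exists>k\<in>{- int N..int N}. \<exists>l\<in>{- int N..int N}.
     \<bar>k div block_length K N - l div block_length K N\<bar> \<le> 1 \<and> h \<le> \<bar>?v w k - ?v w l\<bar>}"
    let ?C = "{w \<in> space M. \<exists>t\<in>?I \<times> ?I \<times> ?I \<times> ?I. near_tie N (block_length K N) \<delta> (seq w) t}"
    let ?D = "{w \<in> space M. \<exists>p\<in>?I \<times> ?I. near_depth N (block_length K N) h \<delta> (seq w) p}"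
    have G: "?G \<in> events"
      by (rule sets_good_path[where v = "\<lambda>k w. walk (seq w) k / sqrt N"]) (use elim h in auto)
    have A: "?A \<in> events" unfolding has_deep_minimum_def by measurable
    have B: "?B \<in> events" by measurable
    have C: "?C \<in> events" by measurable
    have D: "?D \<in> events" by measurable
    have "space M - ?G \<subseteq> ?A \<union> ?B \<union> (?C \<union> ?D)"
    proof
      fix w assume w: "w \<in> space M - ?G"
      show "w \<in> ?A \<union> ?B \<union> (?C \<union> ?D)"
      proof (rule ccontr)
        assume no: "w \<notin> ?A \<union> ?B \<union> (?C \<union> ?D)"
        have deep_w: "has_deep_minimum N h (?v w)" using no w by blast
        have osc_w: "\<bar>?v w k - ?v w l\<bar> < h" if "k \<in> {- int N..int N}" "l \<in> {- int N..int N}"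
          "\<bar>k div block_length K N - l div block_length K N\<bar> \<le> 1" for k l
        proof (rule ccontr)
          assume "\<not> ?thesis"
          then have "h \<le> \<bar>?v w k - ?v w l\<bar>" by simp
          then have "w \<in> ?B" using that w by blast
          with no show False by blast
        qed
        have ties_w: "\<not> near_tie N (block_length K N) \<delta> (seq w) t" if "t \<in> ?I \<times> ?I \<times> ?I \<times> ?I" for t
          using no w that by blast
        have depths_w: "\<not> near_depth N (block_length K N) h \<delta> (seq w) p" if "p \<in> ?I \<times> ?I" for p
          using no w that by blast
        have "interp N (?v w) \<in> good_paths h \<delta>" "card (M_minus h (interp N (?v w))) \<le> 2 * K + 1"
          using good_path_if_generic[OF \<open>0 < N\<close> K h \<delta> deep_w osc_w ties_w depths_w] by blast+
        with w show False by blast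
      qed
    qed
    then have "prob (space M - ?G) \<le> prob (?A \<union> ?B \<union> (?C \<union> ?D))"
      using A B C D by (intro finite_measure_mono) auto
    also have "\<dots> \<le> (prob ?A + prob ?B) + (prob ?C + prob ?D)"
      using A B C D by (intro order_trans[OF measure_Un_le] add_mono measure_Un_le) auto
    also have "\<dots> \<le> \<alpha>" using elim by simp
    finally show ?case using prob_compl[OF G] by simp
  qed
  with h \<delta> show ?thesis by blast
qed

end

lemma potential_eq_walk: "potential w = walk (\<lambda>i. ln ((1 - w i) / w i))"
  by (simp add: fun_eq_iff potential_def walk_def)

theorem theorem2:
  fixes M :: "'a measure" and \<omega> :: "int \<Rightarrow> 'a \<Rightarrow> real" and \<kappa> \<alpha> :: real
  assumes "prob_space M"
    and "prob_space.indep_vars M (\<lambda>_. borel) \<omega> UNIV"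
    and "\<And>x. distr M borel (\<omega> x) = distr M borel (\<omega> 0)"
    and "\<kappa> > 0"
    and "\<And>x. AE w in M. \<omega> x w \<in> {\<kappa>..1 - \<kappa>}"
    and "prob_space.expectation M (\<lambda>w. ln (\<omega> 0 w / (1 - \<omega> 0 w))) = 0"
    and "prob_space.expectation M (\<lambda>w. (ln (\<omega> 0 w / (1 - \<omega> 0 w)))\<^sup>2) > 0"
    and "\<alpha> > 0"
  shows "\<exists>h>0. \<exists>\<delta>>0. \<exists>Q::nat.
    liminf (\<lambda>N. ereal (prob_space.prob M
      {w \<in> space M. scaled_potential (\<lambda>x. \<omega> x w) N \<in> good_paths h \<delta> \<and>
         card (M_minus h (scaled_potential (\<lambda>x. \<omega> x w) N)) \<le> Q}))
    \<ge> ereal (1 - \<alpha>)"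
proof -
  interpret prob_space M by fact
  have \<omega> [measurable]: "\<omega> i \<in> borel_measurable M" for i
    using assms(2) unfolding indep_vars_def2 by blast
  define X where "X i w = ln ((1 - \<omega> i w) / \<omega> i w)" for i w
  have [measurable]: "X i \<in> borel_measurable M" for i unfolding X_def by measurable
  define \<sigma> where "\<sigma> = sqrt (expectation (\<lambda>w. (ln (\<omega> 0 w / (1 - \<omega> 0 w)))\<^sup>2))"
  \<comment> \<open>The maximum with 1 only serves to make the bound positive.\<close>
  define B where "B = max 1 (ln ((1 - \<kappa>) / \<kappa>))"
  have flip: "AE w in M. X 0 w = - ln (\<omega> 0 w / (1 - \<omega> 0 w))"
    using assms(5)[of 0] by eventually_elim (use \<open>\<kappa> > 0\<close> in \<open>auto simp: X_def ln_div\<close>)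
  interpret bounded_increments M X B \<sigma>
  proof
    show "indep_vars (\<lambda>_. borel) X UNIV"
      unfolding X_def by (rule indep_vars_compose2[OF assms(2)]) auto
    show "distr M borel (X i) = distr M borel (X 0)" for i
    proof -
      have "distr M borel (X i) = distr (distr M borel (\<omega> i)) borel (\<lambda>z. ln ((1 - z) / z))" for i
        unfolding X_def by (subst distr_distr) (auto simp: comp_def)
      then show ?thesis using assms(3)[of i] by simp
    qed
    show "AE w in M. \<bar>X i w\<bar> \<le> B" for i
      using assms(5)[of i]
    proof eventually_elim
      case (elim w)
      then have w: "0 < \<omega> i w" "0 < 1 - \<omega> i w" "\<kappa> \<le> \<omega> i w" "\<omega> i w \<le> 1 - \<kappa>" using \<open>\<kappa> > 0\<close> by auto
      have "ln (1 - \<omega> i w) \<le> ln (1 - \<kappa>)" "ln \<kappa> \<le> ln (\<omega> i w)" "ln (\<omega> i w) \<le> ln (1 - \<kappa>)" "ln \<kappa> \<le> ln (1 - \<omega> i w)"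
        using w \<open>\<kappa> > 0\<close> by (subst ln_le_cancel_iff; linarith)+
      moreover have "X i w = ln (1 - \<omega> i w) - ln (\<omega> i w)" "ln ((1 - \<kappa>) / \<kappa>) = ln (1 - \<kappa>) - ln \<kappa>"
        using w \<open>\<kappa> > 0\<close> by (simp_all add: X_def ln_div)
      ultimately show ?case unfolding B_def by linarith
    qed
    have "expectation (X 0) = expectation (\<lambda>w. - ln (\<omega> 0 w / (1 - \<omega> 0 w)))"
      by (rule integral_cong_AE) (use flip in auto)
    then show "expectation (X 0) = 0" using assms(6) by simp
    have "expectation (\<lambda>w. (X 0 w)\<^sup>2) = expectation (\<lambda>w. (ln (\<omega> 0 w / (1 - \<omega> 0 w)))\<^sup>2)"
    proof (rule integral_cong_AE)
      show "AE w in M. (X 0 w)\<^sup>2 = (ln (\<omega> 0 w / (1 - \<omega> 0 w)))\<^sup>2" using flip by eventually_elim simp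
    qed auto
    then show "expectation (\<lambda>w. (X 0 w)\<^sup>2) = \<sigma>\<^sup>2" using assms(7) by (simp add: \<sigma>_def)
    show "B > 0" by (simp add: B_def)
    show "\<sigma> > 0" using assms(7) by (simp add: \<sigma>_def)
  qed
  have path: "scaled_potential (\<lambda>x. \<omega> x w) N = interp N (\<lambda>k. walk (seq w) k / sqrt N)" for w N
    unfolding scaled_potential_eq_interp potential_eq_walk X_def ..
  obtain h \<delta> and Q :: nat where "h > 0" "\<delta> > 0" and ev: "\<forall>\<^sub>F N in sequentially. 1 - \<alpha> \<le> prob {w \<in> space M.
     interp N (\<lambda>k. walk (seq w) k / sqrt N) \<in> good_paths h \<delta> \<and>
     card (M_minus h (interp N (\<lambda>k. walk (seq w) k / sqrt N))) \<le> Q}"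
    using good_paths_likely[OF \<open>\<alpha> > 0\<close>] by blast
  have "ereal (1 - \<alpha>) \<le> liminf (\<lambda>N. ereal (prob
      {w \<in> space M. scaled_potential (\<lambda>x. \<omega> x w) N \<in> good_paths h \<delta> \<and>
         card (M_minus h (scaled_potential (\<lambda>x. \<omega> x w) N)) \<le> Q}))"
    unfolding path by (rule Liminf_bounded) (use ev in simp)
  with \<open>h > 0\<close> \<open>\<delta> > 0\<close> show ?thesis by blast
qed

end
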